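(* Let $R$ be a ring and let $\mathcal{S}$ be a class of right $R$-modules that are strict $\mathcal{B}$-stationary with respect to a class $\mathcal{B}$ of right $R$-modules with $\mathcal{B}\subseteq\mathcal{S}^{\perp}$, where $\mathcal{S}^{\perp}=\{X\in\mathrm{Mod}\text{-}R\mid\mathrm{Ext}_R^1(S,X)=0\text{ for all }S\in\mathcal{S}\}$. Then any module isomorphic to a direct summand of an $(\mathcal{S}\cup\mathrm{Add}\,R)$-filtered module is strict $\mathcal{B}$-stationary.
   Context: $\mathrm{Add}\,R$ is the class of modules isomorphic to direct summands of direct sums of copies of the right module $R$ (i.e. projective right $R$-modules). For $v\in\mathrm{Hom}_R(N,N')$ and a right module $B$ let $H_v(B)=\{gv\mid g\in\mathrm{Hom}_R(N',B)\}$. A right module $M$ is strict $B$-stationary if $M=\varinjlim F_\alpha$ for some direct system $(F_\alpha,u_{\beta\alpha})_{I}$ of finitely presented right $R$-modules such that for every $\alpha\in I$ there is $\beta\ge\alpha$ with $H_{u_\alpha}(B)=H_{u_{\beta\alpha}}(B)$, where $u_\alpha:F_\alpha\to M$ is the canonical map; $M$ is strict $\mathcal{B}$-stationary if it is strict $B$-stationary for every $B\in\mathcal{B}$. For a class $\mathcal{C}$ of right modules, $M$ is $\mathcal{C}$-filtered if there are an ordinal $\tau$ and an increasing chain $(M_\alpha\mid\alpha\le\tau)$ of submodules of $M$ with $M_0=0$, $M_\tau=M$, $M_\alpha=\bigcup_{\beta<\alpha}M_\beta$ for all limit ordinals $\alpha\le\tau$, and $M_{\alpha+1}/M_\alpha\in\mathcal{C}$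 for all $\alpha<\tau$ (up to isomorphism). *)

theory Defs
  imports "HOL-Algebra.Module" "HOL-Algebra.AbelCoset" "HOL-Algebra.Elementary_Groups"
begin

section \<open>Right modules over a not necessarily commutative ring\<close>

text \<open>The locale \<^locale>\<open>module\<close> requires a commutative ring of scalars, so right modules are
introduced here. As in \<^typ>\<open>('a, 'b) module\<close>, the multiplicative fields inherited from
\<^typ>\<open>'m ring\<close> carry no meaning.\<close>

record ('r, 'm) rmodule = "'m ring" +
  rsmult :: "['m, 'r] \<Rightarrow> 'm"  (infixl \<open>\<star>\<index>\<close> 70)

locale right_module = R?: ring R + M?: abelian_group M
  for R :: "('r, 'z) ring_scheme" (structure)
    and M :: "('r, 'm, 'y) rmodule_scheme" (structure) +
  assumes rsmult_closed [simp, intro]: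
      "\<lbrakk>x \<in> carrier M; a \<in> carrier R\<rbrakk> \<Longrightarrow> x \<star>\<^bsub>M\<^esub> a \<in> carrier M"
    and rsmult_l_distr:
      "\<lbrakk>x \<in> carrier M; y \<in> carrier M; a \<in> carrier R\<rbrakk> \<Longrightarrow>
       (x \<oplus>\<^bsub>M\<^esub> y) \<star>\<^bsub>M\<^esub> a = x \<star>\<^bsub>M\<^esub> a \<oplus>\<^bsub>M\<^esub> y \<star>\<^bsub>M\<^esub> a"
    and rsmult_r_distr:
      "\<lbrakk>x \<in> carrier M; a \<in> carrier R; b \<in> carrier R\<rbrakk> \<Longrightarrow>
       x \<star>\<^bsub>M\<^esub> (a \<oplus>\<^bsub>R\<^esub> b) = x \<star>\<^bsub>M\<^esub> a \<oplus>\<^bsub>M\<^esub> x \<star>\<^bsub>M\<^esub> b"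
    and rsmult_assoc:
      "\<lbrakk>x \<in> carrier M; a \<in> carrier R; b \<in> carrier R\<rbrakk> \<Longrightarrow>
       x \<star>\<^bsub>M\<^esub> (a \<otimes>\<^bsub>R\<^esub> b) = (x \<star>\<^bsub>M\<^esub> a) \<star>\<^bsub>M\<^esub> b"
    and rsmult_one [simp]: "x \<in> carrier M \<Longrightarrow> x \<star>\<^bsub>M\<^esub> \<one>\<^bsub>R\<^esub> = x"

text \<open>\<open>Mod-R\<close>, relative to the universe given by the type \<^typ>\<open>'m\<close> of module elements.\<close>

definition rmods :: "('r, 'z) ring_scheme \<Rightarrow> ('r, 'm) rmodule set"
  where "rmods R = {M. right_module R M}"

text \<open>Homomorphisms are extensional, so that equality of homomorphisms (and of sets of them) is
equality on the carrier.\<close>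

definition rhom ::
    "('r, 'z) ring_scheme \<Rightarrow> ('r, 'm) rmodule \<Rightarrow> ('r, 'n) rmodule \<Rightarrow> ('m \<Rightarrow> 'n) set"
  where "rhom R M N =
    {f \<in> carrier M \<rightarrow>\<^sub>E carrier N.
       (\<forall>x\<in>carrier M. \<forall>y\<in>carrier M. f (x \<oplus>\<^bsub>M\<^esub> y) = f x \<oplus>\<^bsub>N\<^esub> f y) \<and>
       (\<forall>x\<in>carrier M. \<forall>a\<in>carrier R. f (x \<star>\<^bsub>M\<^esub> a) = f x \<star>\<^bsub>N\<^esub> a)}"

definition riso ::
    "('r, 'z) ring_scheme \<Rightarrow> ('r, 'm) rmodule \<Rightarrow> ('r, 'n) rmodule \<Rightarrow> ('m \<Rightarrow> 'n) set"
  where "riso R M N = {f \<in> rhom R M N. bij_betw f (carrier M) (carrier N)}"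

definition risomorphic ::
    "('r, 'z) ring_scheme \<Rightarrow> ('r, 'm) rmodule \<Rightarrow> ('r, 'n) rmodule \<Rightarrow> bool"
  where "risomorphic R M N \<longleftrightarrow> riso R M N \<noteq> {}"

definition rsubmodule :: "('r, 'z) ring_scheme \<Rightarrow> 'm set \<Rightarrow> ('r, 'm) rmodule \<Rightarrow> bool"
  where "rsubmodule R N M \<longleftrightarrow>
    additive_subgroup N M \<and> (\<forall>x\<in>N. \<forall>a\<in>carrier R. x \<star>\<^bsub>M\<^esub> a \<in> N)"

text \<open>A submodule \<open>N\<close> is turned into a module by \<open>M\<lparr>carrier := N\<rparr>\<close>.\<close>

definition rspan :: "('r, 'z) ring_scheme \<Rightarrow> ('r, 'm) rmodule \<Rightarrow> 'm set \<Rightarrow> 'm set"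
  where "rspan R M A = \<Inter>{N. rsubmodule R N M \<and> A \<subseteq> N}"

definition rquot :: "('r, 'm) rmodule \<Rightarrow> 'm set \<Rightarrow> ('r, 'm set) rmodule"
  where "rquot M K =
    \<lparr>carrier = a_rcosets\<^bsub>M\<^esub> K, monoid.mult = undefined, one = undefined,
     zero = K, add = set_add M,
     rsmult = (\<lambda>X a. (\<Union>x\<in>X. K +>\<^bsub>M\<^esub> (x \<star>\<^bsub>M\<^esub> a)))\<rparr>"

definition direct_summand :: "('r, 'z) ring_scheme \<Rightarrow> 'm set \<Rightarrow> ('r, 'm) rmodule \<Rightarrow> bool"
  where "direct_summand R D M \<longleftrightarrow>
    rsubmodule R D M \<and>
    (\<exists>E. rsubmodule R E M \<and> D \<inter> E = {\<zero>\<^bsub>M\<^esub>} \<and> D <+>\<^bsub>M\<^esub> E = carrier M)"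

text \<open>The direct sum \<open>R\<^sup>(\<^sup>X\<^sup>)\<close> of copies of the right module \<open>R\<close>.\<close>

definition rfree :: "('r, 'z) ring_scheme \<Rightarrow> 'x set \<Rightarrow> ('r, 'x \<Rightarrow> 'r) rmodule"
  where "rfree R X =
    \<lparr>carrier = {f \<in> X \<rightarrow>\<^sub>E carrier R. finite {x \<in> X. f x \<noteq> \<zero>\<^bsub>R\<^esub>}},
     monoid.mult = undefined, one = undefined,
     zero = (\<lambda>x\<in>X. \<zero>\<^bsub>R\<^esub>), add = (\<lambda>f g. \<lambda>x\<in>X. f x \<oplus>\<^bsub>R\<^esub> g x),
     rsmult = (\<lambda>f a. \<lambda>x\<in>X. f x \<otimes>\<^bsub>R\<^esub> a)\<rparr>"

text \<open>\<open>Add R\<close>. Index sets in the type of the elements of the module suffice: a direct summand \<open>P\<close>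
of any \<open>R\<^sup>(\<^sup>X\<^sup>)\<close> is projective, hence isomorphic to a direct summand of \<open>R\<^sup>(\<^sup>P\<^sup>)\<close>.\<close>

definition Add_R :: "('r, 'z) ring_scheme \<Rightarrow> ('r, 'm) rmodule set"
  where "Add_R R =
    {P \<in> rmods R. \<exists>(X::'m set) D. direct_summand R D (rfree R X) \<and>
                    risomorphic R P ((rfree R X)\<lparr>carrier := D\<rparr>)}"

definition fin_presented :: "('r, 'z) ring_scheme \<Rightarrow> ('r, 'm) rmodule \<Rightarrow> bool"
  where "fin_presented R M \<longleftrightarrow>
    right_module R M \<and>
    (\<exists>(n::nat) A. finite A \<and> A \<subseteq> carrier (rfree R {..<n}) \<and>
       risomorphic R M (rquot (rfree R {..<n}) (rspan R (rfree R {..<n}) A)))"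


section \<open>The functor \<open>Ext\<^sup>1\<close>\<close>

text \<open>\<open>Ext\<^sup>1(S, X)\<close> is the first cohomology group of \<open>Hom(P, X)\<close>, where \<open>P\<close> is the canonical free
resolution \<open>\<dots> \<longrightarrow> P\<^sub>2 \<longrightarrow> P\<^sub>1 \<longrightarrow> P\<^sub>0 \<longrightarrow> S \<longrightarrow> 0\<close>: each term is the free module on the carrier of the
kernel of the preceding map, mapping onto that kernel by the evident map.\<close>

definition free_cover ::
    "('r, 'z) ring_scheme \<Rightarrow> ('r, 'm) rmodule \<Rightarrow> ('m \<Rightarrow> 'r) \<Rightarrow> 'm"
  where "free_cover R S =
    (\<lambda>f\<in>carrier (rfree R (carrier S)).
       finsum S (\<lambda>x. x \<star>\<^bsub>S\<^esub> f x) {x \<in> carrier S. f x \<noteq> \<zero>\<^bsub>R\<^esub>})"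

definition syzygy :: "('r, 'z) ring_scheme \<Rightarrow> ('r, 'm) rmodule \<Rightarrow> ('r, 'm \<Rightarrow> 'r) rmodule"
  where "syzygy R S =
    (rfree R (carrier S))
      \<lparr>carrier := {f \<in> carrier (rfree R (carrier S)). free_cover R S f = \<zero>\<^bsub>S\<^esub>}\<rparr>"

definition Hom_group ::
    "('r, 'z) ring_scheme \<Rightarrow> ('r, 'm) rmodule \<Rightarrow> ('r, 'n) rmodule \<Rightarrow> ('m \<Rightarrow> 'n) monoid"
  where "Hom_group R M N =
    \<lparr>carrier = rhom R M N,
     monoid.mult = (\<lambda>f g. \<lambda>x\<in>carrier M. f x \<oplus>\<^bsub>N\<^esub> g x),
     one = (\<lambda>x\<in>carrier M. \<zero>\<^bsub>N\<^esub>)\<rparr>"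

text \<open>Here \<open>P\<^sub>0\<close>, \<open>P\<^sub>1\<close>, \<open>P\<^sub>2\<close> are the free modules on the carriers of \<open>S\<close>, \<open>syzygy R S\<close> and
\<open>syzygy R (syzygy R S)\<close>; the differentials \<open>P\<^sub>1 \<longrightarrow> P\<^sub>0\<close> and \<open>P\<^sub>2 \<longrightarrow> P\<^sub>1\<close> are the free covers
of the two syzygies, which are submodules of \<open>P\<^sub>0\<close> and \<open>P\<^sub>1\<close>.\<close>

definition Ext1 ::
    "('r, 'z) ring_scheme \<Rightarrow> ('r, 'm) rmodule \<Rightarrow> ('r, 'n) rmodule \<Rightarrow>
     ((('m \<Rightarrow> 'r) \<Rightarrow> 'r) \<Rightarrow> 'n) set monoid"
  where "Ext1 R S X =
    (let P0 = rfree R (carrier S);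
         P1 = rfree R (carrier (syzygy R S));
         P2 = rfree R (carrier (syzygy R (syzygy R S)));
         d1 = free_cover R (syzygy R S);
         d2 = free_cover R (syzygy R (syzygy R S));
         Z = {f \<in> rhom R P1 X. compose (carrier P2) f d2 = (\<lambda>x\<in>carrier P2. \<zero>\<^bsub>X\<^esub>)};
         B = {compose (carrier P1) g d1 | g. g \<in> rhom R P0 X}
     in ((Hom_group R P1 X)\<lparr>carrier := Z\<rparr>) Mod B)"

definition perp :: "('r, 'z) ring_scheme \<Rightarrow> ('r, 'm) rmodule set \<Rightarrow> ('r, 'n) rmodule set"
  where "perp R \<S> = {X \<in> rmods R. \<forall>S\<in>\<S>. trivial_group (Ext1 R S X)}"


section \<open>Direct limits\<close>

text \<open>\<open>u \<beta> \<alpha>\<close> is the map \<open>F \<alpha> \<longrightarrow> F \<beta>\<close> for \<open>\<alpha> \<le> \<beta>\<close>, and \<open>(\<alpha>, \<beta>) \<in> po\<close> stands for \<open>\<alpha> \<le> \<beta>\<close>.\<close>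

definition direct_system ::
    "('r, 'z) ring_scheme \<Rightarrow> 'i set \<Rightarrow> 'i rel \<Rightarrow> ('i \<Rightarrow> ('r, 'f) rmodule) \<Rightarrow>
     ('i \<Rightarrow> 'i \<Rightarrow> 'f \<Rightarrow> 'f) \<Rightarrow> bool"
  where "direct_system R I po F u \<longleftrightarrow>
    partial_order_on I po \<and> I \<noteq> {} \<and>
    (\<forall>\<alpha>\<in>I. \<forall>\<beta>\<in>I. \<exists>\<gamma>\<in>I. (\<alpha>, \<gamma>) \<in> po \<and> (\<beta>, \<gamma>) \<in> po) \<and>
    (\<forall>\<alpha>\<in>I. right_module R (F \<alpha>)) \<and>
    (\<forall>\<alpha> \<beta>. (\<alpha>, \<beta>) \<in> po \<longrightarrow> u \<beta> \<alpha> \<in> rhom R (F \<alpha>) (F \<beta>)) \<and>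
    (\<forall>\<alpha>\<in>I. u \<alpha> \<alpha> = (\<lambda>x\<in>carrier (F \<alpha>). x)) \<and>
    (\<forall>\<alpha> \<beta> \<gamma>. (\<alpha>, \<beta>) \<in> po \<longrightarrow> (\<beta>, \<gamma>) \<in> po \<longrightarrow>
       compose (carrier (F \<alpha>)) (u \<gamma> \<beta>) (u \<beta> \<alpha>) = u \<gamma> \<alpha>)"

definition dirlim_rel ::
    "'i set \<Rightarrow> 'i rel \<Rightarrow> ('i \<Rightarrow> ('r, 'f) rmodule) \<Rightarrow> ('i \<Rightarrow> 'i \<Rightarrow> 'f \<Rightarrow> 'f) \<Rightarrow>
     (('i \<times> 'f) \<times> ('i \<times> 'f)) set"
  where "dirlim_rel I po F u =
    {((\<alpha>, x), (\<beta>, y)) | \<alpha> x \<beta> y.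
       \<alpha> \<in> I \<and> x \<in> carrier (F \<alpha>) \<and> \<beta> \<in> I \<and> y \<in> carrier (F \<beta>) \<and>
       (\<exists>\<gamma>. (\<alpha>, \<gamma>) \<in> po \<and> (\<beta>, \<gamma>) \<in> po \<and> u \<gamma> \<alpha> x = u \<gamma> \<beta> y)}"

text \<open>The operations below are unions over all representatives of classes which coincide.\<close>

definition dirlim ::
    "'i set \<Rightarrow> 'i rel \<Rightarrow> ('i \<Rightarrow> ('r, 'f) rmodule) \<Rightarrow> ('i \<Rightarrow> 'i \<Rightarrow> 'f \<Rightarrow> 'f) \<Rightarrow>
     ('r, ('i \<times> 'f) set) rmodule"
  where "dirlim I po F u =
    \<lparr>carrier = (SIGMA \<alpha>:I. carrier (F \<alpha>)) // dirlim_rel I po F u,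
     monoid.mult = undefined, one = undefined,
     zero = dirlim_rel I po F u `` {(\<alpha>, \<zero>\<^bsub>F \<alpha>\<^esub>) | \<alpha>. \<alpha> \<in> I},
     add = (\<lambda>X Y. dirlim_rel I po F u ``
              {(\<gamma>, u \<gamma> \<alpha> x \<oplus>\<^bsub>F \<gamma>\<^esub> u \<gamma> \<beta> y) | \<alpha> x \<beta> y \<gamma>.
                 (\<alpha>, x) \<in> X \<and> (\<beta>, y) \<in> Y \<and> (\<alpha>, \<gamma>) \<in> po \<and> (\<beta>, \<gamma>) \<in> po}),
     rsmult = (\<lambda>X a. dirlim_rel I po F u `` {(\<alpha>, x \<star>\<^bsub>F \<alpha>\<^esub> a) | \<alpha> x. (\<alpha>, x) \<in> X})\<rparr>"

definition dirlim_map ::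
    "'i set \<Rightarrow> 'i rel \<Rightarrow> ('i \<Rightarrow> ('r, 'f) rmodule) \<Rightarrow> ('i \<Rightarrow> 'i \<Rightarrow> 'f \<Rightarrow> 'f) \<Rightarrow>
     'i \<Rightarrow> 'f \<Rightarrow> ('i \<times> 'f) set"
  where "dirlim_map I po F u \<alpha> = (\<lambda>x\<in>carrier (F \<alpha>). dirlim_rel I po F u `` {(\<alpha>, x)})"


section \<open>Strict stationary modules\<close>

definition Hset ::
    "('r, 'z) ring_scheme \<Rightarrow> ('r, 'm) rmodule \<Rightarrow> ('r, 'n) rmodule \<Rightarrow> ('m \<Rightarrow> 'n) \<Rightarrow>
     ('r, 'b) rmodule \<Rightarrow> ('m \<Rightarrow> 'b) set"
  where "Hset R N N' v B = {compose (carrier N) g v | g. g \<in> rhom R N' B}"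

text \<open>HOL has no quantification over types. The first two arguments record the types of the
indices of the direct system and of the elements of its modules. The types
\<^typ>\<open>'m set \<times> ('m \<Rightarrow> 'r) set\<close> and \<^typ>\<open>('m \<Rightarrow> 'r) set\<close> accommodate the canonical presentation of
\<open>M\<close>: the modules generated by a finite set of elements of \<open>M\<close> subject to a finite set of relations
holding in \<open>M\<close>. The isomorphism \<open>\<phi>\<close> expresses \<open>M = lim F \<alpha>\<close>, with canonical maps \<open>c \<alpha>\<close>.\<close>

definition strict_stationary_wrt ::
    "'i itself \<Rightarrow> 'f itself \<Rightarrow> ('r, 'z) ring_scheme \<Rightarrow> ('r, 'b) rmodule \<Rightarrow>
     ('r, 'm) rmodule \<Rightarrow> bool"
  where "strict_stationary_wrt ti tf R B M \<longleftrightarrow>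
    right_module R M \<and>
    (\<exists>(I::'i set) po (F::'i \<Rightarrow> ('r, 'f) rmodule) u \<phi> c.
       direct_system R I po F u \<and> (\<forall>\<alpha>\<in>I. fin_presented R (F \<alpha>)) \<and>
       \<phi> \<in> riso R (dirlim I po F u) M \<and>
       (\<forall>\<alpha>\<in>I. c \<alpha> = compose (carrier (F \<alpha>)) \<phi> (dirlim_map I po F u \<alpha>)) \<and>
       (\<forall>\<alpha>\<in>I. \<exists>\<beta>\<in>I. (\<alpha>, \<beta>) \<in> po \<and>
          Hset R (F \<alpha>) M (c \<alpha>) B = Hset R (F \<alpha>) (F \<beta>) (u \<beta> \<alpha>) B))"

definition strict_stationary ::
    "'i itself \<Rightarrow> 'f itself \<Rightarrow> ('r, 'z) ring_scheme \<Rightarrow> ('r, 'b) rmodule set \<Rightarrow>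
     ('r, 'm) rmodule \<Rightarrow> bool"
  where "strict_stationary ti tf R \<B> M \<longleftrightarrow>
    right_module R M \<and> (\<forall>B\<in>\<B>. strict_stationary_wrt ti tf R B M)"


section \<open>Filtrations\<close>

definition covered_by :: "'k rel \<Rightarrow> 'k \<Rightarrow> 'k \<Rightarrow> bool"
  where "covered_by r \<alpha> \<beta> \<longleftrightarrow>
    \<alpha> \<in> underS r \<beta> \<and> (\<forall>\<gamma>\<in>underS r \<beta>. (\<gamma>, \<alpha>) \<in> r)"

text \<open>The ordinals \<open>\<alpha> \<le> \<tau>\<close> are represented by a set \<open>W\<close> well-ordered by \<open>r\<close>, with greatest element
\<open>\<tau>\<close>, in a type given by the first argument; then \<open>\<alpha> + 1 = \<beta>\<close> reads \<open>covered_by r \<alpha> \<beta>\<close>.\<close>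

definition filtered ::
    "'k itself \<Rightarrow> ('r, 'z) ring_scheme \<Rightarrow> ('r, 'c) rmodule set \<Rightarrow> ('r, 'm) rmodule \<Rightarrow> bool"
  where "filtered tk R \<C> M \<longleftrightarrow>
    right_module R M \<and>
    (\<exists>(W::'k set) r \<tau> (N :: 'k \<Rightarrow> 'm set).
       well_order_on W r \<and> \<tau> \<in> W \<and> (\<forall>\<alpha>\<in>W. (\<alpha>, \<tau>) \<in> r) \<and>
       (\<forall>\<alpha>\<in>W. rsubmodule R (N \<alpha>) M) \<and>
       (\<forall>\<alpha> \<beta>. (\<alpha>, \<beta>) \<in> r \<longrightarrow> N \<alpha> \<subseteq> N \<beta>) \<and>
       (\<forall>\<alpha>\<in>W. underS r \<alpha> = {} \<longrightarrow> N \<alpha> = {\<zero>\<^bsub>M\<^esub>}) \<and>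
       N \<tau> = carrier M \<and>
       (\<forall>\<alpha>\<in>W. underS r \<alpha> \<noteq> {} \<and> \<not> (\<exists>\<beta>. covered_by r \<beta> \<alpha>) \<longrightarrow>
          N \<alpha> = (\<Union>\<beta>\<in>underS r \<alpha>. N \<beta>)) \<and>
       (\<forall>\<alpha> \<beta>. covered_by r \<alpha> \<beta> \<longrightarrow>
          (\<exists>C\<in>\<C>. risomorphic R (rquot (M\<lparr>carrier := N \<beta>\<rparr>) (N \<alpha>)) C)))"

end

theory Submission
  imports Defs
begin

text \<open>Strict \<open>B\<close>-stationarity of \<open>M\<close> has an elementwise form: for every finite \<open>X \<subseteq> M\<close> there is a
finite system of linear relations holding in \<open>M\<close> such that every solution of it in \<open>B\<close> agrees on
\<open>X\<close> with a homomorphism \<open>M \<longrightarrow> B\<close>. In one direction finite presentations of the modules of the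
direct system provide the relations; in the other direction the relations are added to an index of
the canonical presentation of \<open>M\<close>. The elementwise form passes to retracts. It also passes to an
extension \<open>0 \<longrightarrow> K \<longrightarrow> M \<longrightarrow> C \<longrightarrow> 0\<close> along which homomorphisms into \<open>B\<close> extend: subtracting from a
solution a homomorphism that extends its part on \<open>K\<close> leaves a solution on \<open>C\<close>. In a filtration with
factors in \<open>\<S> \<union> Add R\<close> every step is of this kind. By Zorn's lemma homomorphisms extend from each
level to the whole module, which settles the limit steps because a finite set lies in an earlier
level.\<close>

section \<open>Modules, submodules and homomorphisms\<close>

text \<open>Direct systems witnessing stationarity of a submodule K and of a factor C have unrelated
  index sets, with no evident way to merge them into a system for the extension. Finite sets of
  relations can simply be united; hence the detour through the elementwise form. A solution
  \<open>b\<close> there is an arbitrary function on the carrier, not a linear map, so the same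
  \<open>b\<close> can be read on K, on chosen representatives of C and on given elements of M.

  Vanishing of Ext serves only to extend homomorphisms from K to M. If P is a free cover of C with
  kernel Z, then M is the quotient of the direct sum of K and P that glues Z to its image in K; a
  homomorphism on K extends once its pull-back to Z extends to P. For a factor in
  \<open>Add_R R\<close> the surjection splits, and a retraction onto K does the same.

  At a limit level the relations come from an earlier level, but the homomorphism they produce lives
  only there. Extension must therefore be available from every level, not only across successor
  steps.\<close>

context right_module
begin

lemma zero_rsmult [simp]: "a \<in> carrier R \<Longrightarrow> \<zero>\<^bsub>M\<^esub> \<star>\<^bsub>M\<^esub> a = \<zero>\<^bsub>M\<^esub>"
  using rsmult_l_distr[of "\<zero>\<^bsub>M\<^esub>" "\<zero>\<^bsub>M\<^esub>" a] M.add.l_cancel_one'[of "\<zero>\<^bsub>M\<^esub> \<star>\<^bsub>M\<^esub> a" "\<zero>\<^bsub>M\<^esub> \<star>\<^bsub>M\<^esub> a"] by simp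

lemma rsmult_zero [simp]: "x \<in> carrier M \<Longrightarrow> x \<star>\<^bsub>M\<^esub> \<zero>\<^bsub>R\<^esub> = \<zero>\<^bsub>M\<^esub>"
  using rsmult_r_distr[of x "\<zero>\<^bsub>R\<^esub>" "\<zero>\<^bsub>R\<^esub>"] M.add.l_cancel_one'[of "x \<star>\<^bsub>M\<^esub> \<zero>\<^bsub>R\<^esub>" "x \<star>\<^bsub>M\<^esub> \<zero>\<^bsub>R\<^esub>"] by simp

lemma minus_zero [simp]: "\<ominus>\<^bsub>M\<^esub> \<zero>\<^bsub>M\<^esub> = \<zero>\<^bsub>M\<^esub>"
  by (rule M.minus_equality) simp_all

lemma minus_eq_zero_iff:
  assumes "x \<in> carrier M" "y \<in> carrier M"
  shows "x \<ominus>\<^bsub>M\<^esub> y = \<zero>\<^bsub>M\<^esub> \<longleftrightarrow> x = y"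
  using assms M.minus_equality[of x "\<ominus>\<^bsub>M\<^esub> y"] by (auto simp: a_minus_def M.r_neg)

text \<open>Turns negation into a scalar multiplication, so that closure of submodules under
  negatives and compatibility of homomorphisms with negatives follow from the conditions on
  scalars.\<close>

lemma rsmult_minus_one:
  assumes "x \<in> carrier M"
  shows "x \<star>\<^bsub>M\<^esub> (\<ominus>\<^bsub>R\<^esub> \<one>\<^bsub>R\<^esub>) = \<ominus>\<^bsub>M\<^esub> x"
proof -
  have "x \<oplus>\<^bsub>M\<^esub> x \<star>\<^bsub>M\<^esub> (\<ominus>\<^bsub>R\<^esub> \<one>\<^bsub>R\<^esub>) = x \<star>\<^bsub>M\<^esub> (\<one>\<^bsub>R\<^esub> \<oplus>\<^bsub>R\<^esub> (\<ominus>\<^bsub>R\<^esub> \<one>\<^bsub>R\<^esub>))"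
    using assms by (subst rsmult_r_distr) simp_all
  also have "\<dots> = \<zero>\<^bsub>M\<^esub>"
    using assms by (simp add: R.r_neg)
  finally show ?thesis
    using assms by (metis M.minus_equality M.a_comm R.a_inv_closed R.one_closed rsmult_closed)
qed

lemma minus_rsmult:
  assumes "x \<in> carrier M" "a \<in> carrier R"
  shows "(\<ominus>\<^bsub>M\<^esub> x) \<star>\<^bsub>M\<^esub> a = \<ominus>\<^bsub>M\<^esub> (x \<star>\<^bsub>M\<^esub> a)"
proof -
  have "(\<ominus>\<^bsub>M\<^esub> x) \<star>\<^bsub>M\<^esub> a \<oplus>\<^bsub>M\<^esub> x \<star>\<^bsub>M\<^esub> a = \<zero>\<^bsub>M\<^esub>"
    using assms by (simp add: rsmult_l_distr[symmetric] M.l_neg)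
  then show ?thesis
    using assms by (metis M.minus_equality M.a_inv_closed rsmult_closed)
qed

end

lemma rsubmoduleI:
  assumes "right_module R M" "N \<subseteq> carrier M" "\<zero>\<^bsub>M\<^esub> \<in> N"
    and "\<And>x y. x \<in> N \<Longrightarrow> y \<in> N \<Longrightarrow> x \<oplus>\<^bsub>M\<^esub> y \<in> N"
    and smult: "\<And>x a. x \<in> N \<Longrightarrow> a \<in> carrier R \<Longrightarrow> x \<star>\<^bsub>M\<^esub> a \<in> N"
  shows "rsubmodule R N M"
proof -
  interpret right_module R M by fact
  have "\<ominus>\<^bsub>M\<^esub> x \<in> N" if "x \<in> N" for x
    using smult[OF that, of "\<ominus>\<^bsub>R\<^esub> \<one>\<^bsub>R\<^esub>"] rsmult_minus_one[of x] that assms(2) by auto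
  then have "subgroup N (add_monoid M)"
    using assms by (intro M.add.subgroupI) (auto simp: a_inv_def)
  then show ?thesis
    using smult by (simp add: rsubmodule_def additive_subgroup_def)
qed

lemma rsubmoduleD:
  assumes "rsubmodule R N M"
  shows "N \<subseteq> carrier M" "\<zero>\<^bsub>M\<^esub> \<in> N"
    and "\<And>x y. x \<in> N \<Longrightarrow> y \<in> N \<Longrightarrow> x \<oplus>\<^bsub>M\<^esub> y \<in> N"
    and "\<And>x a. x \<in> N \<Longrightarrow> a \<in> carrier R \<Longrightarrow> x \<star>\<^bsub>M\<^esub> a \<in> N"
    and "\<And>x. x \<in> N \<Longrightarrow> \<ominus>\<^bsub>M\<^esub> x \<in> N"
  using assms subgroup.m_inv_closed[of N "add_monoid M"]
  by (auto simp: rsubmodule_def additive_subgroup_def a_inv_def subgroup_def)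

lemma right_module_submodule:
  assumes "right_module R M" "rsubmodule R N M"
  shows "right_module R (M\<lparr>carrier := N\<rparr>)"
proof -
  interpret right_module R M by fact
  note N = rsubmoduleD[OF assms(2)]
  have "abelian_group (M\<lparr>carrier := N\<rparr>)"
  proof (rule abelian_groupI)
    show "\<exists>y\<in>carrier (M\<lparr>carrier := N\<rparr>). y \<oplus>\<^bsub>M\<lparr>carrier := N\<rparr>\<^esub> x = \<zero>\<^bsub>M\<lparr>carrier := N\<rparr>\<^esub>"
      if "x \<in> carrier (M\<lparr>carrier := N\<rparr>)" for x
      using that N(1) N(5)[of x] by (auto intro!: bexI[of _ "\<ominus>\<^bsub>M\<^esub> x"] simp: M.l_neg subset_iff)
  qed (use N in \<open>auto simp: subset_iff M.a_ac\<close>)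
  then show ?thesis
    using N by (auto simp: right_module_def right_module_axioms_def R.ring_axioms
        subset_iff rsmult_l_distr rsmult_r_distr rsmult_assoc)
qed

section \<open>Homomorphisms, kernels, images and spans\<close>

lemma rhomI:
  assumes "f \<in> carrier M \<rightarrow>\<^sub>E carrier N"
    and "\<And>x y. x \<in> carrier M \<Longrightarrow> y \<in> carrier M \<Longrightarrow> f (x \<oplus>\<^bsub>M\<^esub> y) = f x \<oplus>\<^bsub>N\<^esub> f y"
    and "\<And>x a. x \<in> carrier M \<Longrightarrow> a \<in> carrier R \<Longrightarrow> f (x \<star>\<^bsub>M\<^esub> a) = f x \<star>\<^bsub>N\<^esub> a"
  shows "f \<in> rhom R M N"
  using assms by (simp add: rhom_def)

lemma rhomD:
  assumes "f \<in> rhom R M N"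
  shows "\<And>x. x \<in> carrier M \<Longrightarrow> f x \<in> carrier N"
    and "\<And>x y. x \<in> carrier M \<Longrightarrow> y \<in> carrier M \<Longrightarrow> f (x \<oplus>\<^bsub>M\<^esub> y) = f x \<oplus>\<^bsub>N\<^esub> f y"
    and "\<And>x a. x \<in> carrier M \<Longrightarrow> a \<in> carrier R \<Longrightarrow> f (x \<star>\<^bsub>M\<^esub> a) = f x \<star>\<^bsub>N\<^esub> a"
    and "f \<in> extensional (carrier M)"
  using assms by (auto simp: rhom_def PiE_def)

lemma rhom_zero:
  assumes "f \<in> rhom R M N" "right_module R M" "right_module R N"
  shows "f \<zero>\<^bsub>M\<^esub> = \<zero>\<^bsub>N\<^esub>"
proof -
  interpret M: right_module R M by fact
  interpret N: right_module R N by fact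
  show ?thesis
    using rhomD(1)[OF assms(1) M.zero_closed] rhomD(3)[OF assms(1) M.zero_closed, of "\<zero>\<^bsub>R\<^esub>"] by simp
qed

lemma rhom_minus:
  assumes "f \<in> rhom R M N" "right_module R M" "right_module R N" "x \<in> carrier M"
  shows "f (\<ominus>\<^bsub>M\<^esub> x) = \<ominus>\<^bsub>N\<^esub> f x"
proof -
  interpret M: right_module R M by fact
  interpret N: right_module R N by fact
  show ?thesis
    using rhomD(1,3)[OF assms(1), of x] assms(4)
    by (simp add: M.rsmult_minus_one[symmetric] N.rsmult_minus_one[symmetric])
qed

lemma rhom_diff:
  assumes "f \<in> rhom R M N" "right_module R M" "right_module R N" "x \<in> carrier M" "y \<in> carrier M"
  shows "f (x \<ominus>\<^bsub>M\<^esub> y) = f x \<ominus>\<^bsub>N\<^esub> f y"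
proof -
  interpret M: right_module R M by fact
  show ?thesis
    using assms by (simp add: a_minus_def rhomD(2)[OF assms(1)] rhom_minus)
qed

lemma rhom_compose:
  assumes "f \<in> rhom R M N" "g \<in> rhom R N Q" "right_module R M"
  shows "compose (carrier M) g f \<in> rhom R M Q"
proof -
  interpret right_module R M by fact
  show ?thesis
    by (rule rhomI) (auto simp: compose_eq rhomD[OF assms(1)] rhomD[OF assms(2)] compose_def)
qed

lemma rhom_restrict:
  assumes "f \<in> rhom R M Q" "rsubmodule R N M"
  shows "restrict f N \<in> rhom R (M\<lparr>carrier := N\<rparr>) Q"
  using rhomD[OF assms(1)] rsubmoduleD[OF assms(2)]
  by (intro rhomI) (auto simp: subset_iff)

lemma rhom_corestrict:
  assumes "f \<in> rhom R N M" "\<And>x. x \<in> carrier N \<Longrightarrow> f x \<in> K"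
  shows "f \<in> rhom R N (M\<lparr>carrier := K\<rparr>)"
  using rhomD[OF assms(1)] assms(2) by (intro rhomI) (auto simp: PiE_def)

lemma rhom_inclusion:
  assumes "rsubmodule R N M"
  shows "(\<lambda>x\<in>N. x) \<in> rhom R (M\<lparr>carrier := N\<rparr>) M"
  using rsubmoduleD[OF assms] by (intro rhomI) auto

lemma zero_rhom:
  assumes "right_module R M" "right_module R N"
  shows "(\<lambda>x\<in>carrier M. \<zero>\<^bsub>N\<^esub>) \<in> rhom R M N"
proof -
  interpret M: right_module R M by fact
  interpret N: right_module R N by fact
  show ?thesis by (intro rhomI) auto
qed

lemma rhom_add:
  assumes f: "f \<in> rhom R M N" and g: "g \<in> rhom R M N" and "right_module R M" "right_module R N"
  shows "(\<lambda>x\<in>carrier M. f x \<oplus>\<^bsub>N\<^esub> g x) \<in> rhom R M N"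
proof -
  interpret M: right_module R M by fact
  interpret N: right_module R N by fact
  note fg = rhomD[OF f] rhomD[OF g]
  show ?thesis
  proof (rule rhomI)
    fix x y assume xy: "x \<in> carrier M" "y \<in> carrier M"
    then have "f x \<oplus>\<^bsub>N\<^esub> f y \<oplus>\<^bsub>N\<^esub> (g x \<oplus>\<^bsub>N\<^esub> g y) = f x \<oplus>\<^bsub>N\<^esub> g x \<oplus>\<^bsub>N\<^esub> (f y \<oplus>\<^bsub>N\<^esub> g y)"
      by (simp add: fg N.M.a_ac)
    with xy show "(\<lambda>x\<in>carrier M. f x \<oplus>\<^bsub>N\<^esub> g x) (x \<oplus>\<^bsub>M\<^esub> y) =
        (\<lambda>x\<in>carrier M. f x \<oplus>\<^bsub>N\<^esub> g x) x \<oplus>\<^bsub>N\<^esub> (\<lambda>x\<in>carrier M. f x \<oplus>\<^bsub>N\<^esub> g x) y"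
      by (simp add: fg)
  qed (auto simp: fg N.rsmult_l_distr)
qed

lemma rsubmodule_kernel:
  assumes f: "f \<in> rhom R M N" and "right_module R M" "right_module R N"
  shows "rsubmodule R {x \<in> carrier M. f x = \<zero>\<^bsub>N\<^esub>} M"
proof -
  interpret M: right_module R M by fact
  interpret N: right_module R N by fact
  show ?thesis
    by (rule rsubmoduleI[OF assms(2)]) (auto simp: rhomD[OF f] rhom_zero[OF assms])
qed

lemma rsubmodule_image:
  assumes f: "f \<in> rhom R M N" and "right_module R M" "right_module R N" and K: "rsubmodule R K M"
  shows "rsubmodule R (f ` K) N"
proof -
  interpret M: right_module R M by fact
  interpret N: right_module R N by fact
  note K' = rsubmoduleD[OF K]
  have K'': "\<And>x. x \<in> K \<Longrightarrow> x \<in> carrier M"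
    using K' by blast
  show ?thesis
  proof (rule rsubmoduleI[OF assms(3)])
    show "\<zero>\<^bsub>N\<^esub> \<in> f ` K"
      using rhom_zero[OF assms(1-3)] K'(2) by force
    fix y assume "y \<in> f ` K"
    then obtain x where x: "x \<in> K" "y = f x" by blast
    show "y \<star>\<^bsub>N\<^esub> a \<in> f ` K" if "a \<in> carrier R" for a
      using x that K'(4)[of x a] K'' by (simp add: rhomD(3)[OF f, symmetric])
    show "y \<oplus>\<^bsub>N\<^esub> z \<in> f ` K" if "z \<in> f ` K" for z
    proof -
      obtain x' where "x' \<in> K" "z = f x'" using \<open>z \<in> f ` K\<close> by blast
      with x K'(3)[of x x'] K'' show ?thesis by (simp add: rhomD(2)[OF f, symmetric])
    qed
  qed (use K' rhomD[OF f] in auto)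
qed

lemma rspan_least: "rsubmodule R N M \<Longrightarrow> A \<subseteq> N \<Longrightarrow> rspan R M A \<subseteq> N"
  by (auto simp: rspan_def)

lemma rspan_superset: "A \<subseteq> rspan R M A"
  by (auto simp: rspan_def)

lemma rsubmodule_carrier:
  assumes "right_module R M"
  shows "rsubmodule R (carrier M) M"
proof -
  interpret right_module R M by fact
  show ?thesis by (rule rsubmoduleI[OF assms]) auto
qed

lemma rsubmodule_rspan:
  assumes "right_module R M" "A \<subseteq> carrier M"
  shows "rsubmodule R (rspan R M A) M"
proof (rule rsubmoduleI[OF assms(1)])
  show "rspan R M A \<subseteq> carrier M"
    by (rule rspan_least[OF rsubmodule_carrier[OF assms(1)] assms(2)])
qed (auto simp: rspan_def rsubmoduleD)

text \<open>Homomorphisms that are given by a choice of preimages are obtained from their graphs, so that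
only single-valuedness at zero has to be checked.\<close>

definition lin_graph ::
    "('r, 'z) ring_scheme \<Rightarrow> ('r, 'm) rmodule \<Rightarrow> ('r, 'n) rmodule \<Rightarrow> ('m \<times> 'n) set \<Rightarrow> bool"
  where "lin_graph R M B G \<longleftrightarrow>
    G \<subseteq> carrier M \<times> carrier B \<and>
    (\<forall>x b y c. (x, b) \<in> G \<longrightarrow> (y, c) \<in> G \<longrightarrow> (x \<oplus>\<^bsub>M\<^esub> y, b \<oplus>\<^bsub>B\<^esub> c) \<in> G) \<and>
    (\<forall>x b a. (x, b) \<in> G \<longrightarrow> a \<in> carrier R \<longrightarrow> (x \<star>\<^bsub>M\<^esub> a, b \<star>\<^bsub>B\<^esub> a) \<in> G) \<and>
    (\<forall>b. (\<zero>\<^bsub>M\<^esub>, b) \<in> G \<longrightarrow> b = \<zero>\<^bsub>B\<^esub>)"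

lemma lin_graphI:
  assumes "\<And>x b. (x, b) \<in> G \<Longrightarrow> x \<in> carrier M \<and> b \<in> carrier B"
    and "\<And>x b y c. (x, b) \<in> G \<Longrightarrow> (y, c) \<in> G \<Longrightarrow> (x \<oplus>\<^bsub>M\<^esub> y, b \<oplus>\<^bsub>B\<^esub> c) \<in> G"
    and "\<And>x b a. (x, b) \<in> G \<Longrightarrow> a \<in> carrier R \<Longrightarrow> (x \<star>\<^bsub>M\<^esub> a, b \<star>\<^bsub>B\<^esub> a) \<in> G"
    and "\<And>b. (\<zero>\<^bsub>M\<^esub>, b) \<in> G \<Longrightarrow> b = \<zero>\<^bsub>B\<^esub>"
  shows "lin_graph R M B G"
  unfolding lin_graph_def using assms by (intro conjI allI impI subsetI; clarsimp)

lemma rhom_of_lin_graph: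
  assumes "right_module R M" "right_module R B" and G: "lin_graph R M B G"
  obtains h where "h \<in> rhom R (M\<lparr>carrier := Domain G\<rparr>) B" "\<And>x b. (x, b) \<in> G \<Longrightarrow> h x = b"
proof -
  interpret M: right_module R M by fact
  interpret B: right_module R B by fact
  have car: "x \<in> carrier M" "b \<in> carrier B" if "(x, b) \<in> G" for x b
    using G that by (auto simp: lin_graph_def)
  have add: "(x \<oplus>\<^bsub>M\<^esub> y, b \<oplus>\<^bsub>B\<^esub> c) \<in> G" if "(x, b) \<in> G" "(y, c) \<in> G" for x b y c
    using G that by (auto simp: lin_graph_def)
  have smult: "(x \<star>\<^bsub>M\<^esub> a, b \<star>\<^bsub>B\<^esub> a) \<in> G" if "(x, b) \<in> G" "a \<in> carrier R" for x b a
    using G that by (auto simp: lin_graph_def)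
  \<comment> \<open>The pair of negatives of \<open>x\<close> and \<open>c\<close> belongs to the
    graph by the scalar -1. Adding it to \<open>(x, b)\<close> gives a pair over zero with second
    component \<open>b - c\<close>, which must vanish.\<close>
  have uniq: "b = c" if b: "(x, b) \<in> G" and c: "(x, c) \<in> G" for x b c
  proof -
    have "(\<ominus>\<^bsub>M\<^esub> x, \<ominus>\<^bsub>B\<^esub> c) \<in> G"
      using smult[OF c, of "\<ominus>\<^bsub>R\<^esub> \<one>\<^bsub>R\<^esub>"] car[OF c]
      by (simp add: M.rsmult_minus_one B.rsmult_minus_one)
    from add[OF b this] have "(\<zero>\<^bsub>M\<^esub>, b \<ominus>\<^bsub>B\<^esub> c) \<in> G"
      using car[OF b] by (simp add: M.M.r_neg a_minus_def)
    then have "b \<ominus>\<^bsub>B\<^esub> c = \<zero>\<^bsub>B\<^esub>"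
      using G by (auto simp: lin_graph_def)
    with car(2)[OF b] car(2)[OF c] show ?thesis
      by (simp add: B.minus_eq_zero_iff)
  qed
  define h where "h = (\<lambda>x\<in>Domain G. THE b. (x, b) \<in> G)"
  have h: "h x = b" if "(x, b) \<in> G" for x b
    using that uniq by (auto simp: h_def intro!: the_equality)
  have hG: "(x, h x) \<in> G" if "x \<in> Domain G" for x
    using that h by blast
  have "h \<in> rhom R (M\<lparr>carrier := Domain G\<rparr>) B"
  proof (rule rhomI)
    show "h \<in> carrier (M\<lparr>carrier := Domain G\<rparr>) \<rightarrow>\<^sub>E carrier B"
      using hG car by (fastforce simp: h_def)
    show "h (x \<oplus>\<^bsub>M\<lparr>carrier := Domain G\<rparr>\<^esub> y) = h x \<oplus>\<^bsub>B\<^esub> h y"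
      if "x \<in> carrier (M\<lparr>carrier := Domain G\<rparr>)" "y \<in> carrier (M\<lparr>carrier := Domain G\<rparr>)" for x y
      using h[OF add[OF hG hG], of x y] that by simp
    show "h (x \<star>\<^bsub>M\<lparr>carrier := Domain G\<rparr>\<^esub> a) = h x \<star>\<^bsub>B\<^esub> a"
      if "x \<in> carrier (M\<lparr>carrier := Domain G\<rparr>)" "a \<in> carrier R" for x a
      using h[OF smult[OF hG], of x a] that by simp
  qed
  with h that show thesis by blast
qed

text \<open>Partial homomorphisms on different submodules become comparable by inclusion of their
  graphs, the order to which Zorn's lemma is applied later.\<close>

lemma lin_graph_of_rhom:
  assumes "right_module R M" "right_module R B" and K: "rsubmodule R K M"
    and f: "f \<in> rhom R (M\<lparr>carrier := K\<rparr>) B"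
  shows "lin_graph R M B ((\<lambda>x. (x, f x)) ` K)"
proof -
  note K' = rsubmoduleD[OF K] and f' = rhomD[OF f, simplified]
  show ?thesis
    using K' rhom_zero[OF f right_module_submodule[OF assms(1) K] assms(2)]
    by (intro lin_graphI) (auto simp: f'(1) f'(2,3)[symmetric])
qed

text \<open>The pairs \<open>(q p, f p)\<close> form a linear graph: single-valuedness at zero is
  the inclusion of the kernel of \<open>q\<close> in that of \<open>f\<close>, and surjectivity of
  \<open>q\<close> makes the domain everything.\<close>

lemma rhom_factor:
  assumes "right_module R P" "right_module R Q" "right_module R B"
    and q: "q \<in> rhom R P Q" and surj: "q ` carrier P = carrier Q"
    and f: "f \<in> rhom R P B"
    and ker: "\<And>p. p \<in> carrier P \<Longrightarrow> q p = \<zero>\<^bsub>Q\<^esub> \<Longrightarrow> f p = \<zero>\<^bsub>B\<^esub>"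
  shows "\<exists>h\<in>rhom R Q B. \<forall>p\<in>carrier P. h (q p) = f p"
proof -
  interpret P: right_module R P by fact
  interpret Q: right_module R Q by fact
  define G where "G = (\<lambda>p. (q p, f p)) ` carrier P"
  have GI: "(q p, f p) \<in> G" if "p \<in> carrier P" for p
    using that by (simp add: G_def)
  have "lin_graph R Q B G"
  proof (rule lin_graphI)
    fix x b y c assume "(x, b) \<in> G" "(y, c) \<in> G"
    then obtain p p' where "p \<in> carrier P" "p' \<in> carrier P" "x = q p" "b = f p" "y = q p'" "c = f p'"
      by (auto simp: G_def)
    then show "(x \<oplus>\<^bsub>Q\<^esub> y, b \<oplus>\<^bsub>B\<^esub> c) \<in> G"
      using GI[of "p \<oplus>\<^bsub>P\<^esub> p'"] by (simp add: rhomD[OF q] rhomD[OF f])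
  next
    fix x b a assume "(x, b) \<in> G" and a: "a \<in> carrier R"
    then obtain p where "p \<in> carrier P" "x = q p" "b = f p"
      by (auto simp: G_def)
    then show "(x \<star>\<^bsub>Q\<^esub> a, b \<star>\<^bsub>B\<^esub> a) \<in> G"
      using GI[of "p \<star>\<^bsub>P\<^esub> a"] a by (simp add: rhomD[OF q] rhomD[OF f])
  next
    fix x b assume "(x, b) \<in> G"
    then show "x \<in> carrier Q \<and> b \<in> carrier B"
      by (auto simp: G_def rhomD(1)[OF q] rhomD(1)[OF f])
  next
    fix b assume "(\<zero>\<^bsub>Q\<^esub>, b) \<in> G"
    then obtain p where "p \<in> carrier P" "q p = \<zero>\<^bsub>Q\<^esub>" "b = f p"
      by (auto simp: G_def)
    with ker show "b = \<zero>\<^bsub>B\<^esub>" by simp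
  qed
  from rhom_of_lin_graph[OF assms(2,3) this] obtain h
    where h: "h \<in> rhom R (Q\<lparr>carrier := Domain G\<rparr>) B" "\<And>x b. (x, b) \<in> G \<Longrightarrow> h x = b"
    by blast
  have "Domain G = carrier Q"
    by (simp add: G_def surj[symmetric] Domain_fst image_image)
  with h(1) have "h \<in> rhom R Q B" by simp
  moreover have "\<forall>p\<in>carrier P. h (q p) = f p"
    using h(2) GI by blast
  ultimately show ?thesis by blast
qed

section \<open>Quotients\<close>

text \<open>Module axioms are equations, so they pass along a surjection respecting the operations.
  \<open>Q\<close> starts as a bare structure; this is how cosets are recognised as a
  module.\<close>

lemma right_module_image:
  assumes "right_module R P"
    and surj: "q ` carrier P = carrier Q"
    and add: "\<And>x y. x \<in> carrier P \<Longrightarrow> y \<in> carrier P \<Longrightarrow> q (x \<oplus>\<^bsub>P\<^esub> y) = q x \<oplus>\<^bsub>Q\<^esub> q y"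
    and smult: "\<And>x a. x \<in> carrier P \<Longrightarrow> a \<in> carrier R \<Longrightarrow> q (x \<star>\<^bsub>P\<^esub> a) = q x \<star>\<^bsub>Q\<^esub> a"
    and zero: "q \<zero>\<^bsub>P\<^esub> = \<zero>\<^bsub>Q\<^esub>"
  shows "right_module R Q"
proof -
  interpret P: right_module R P by fact
  have elim: thesis if "x \<in> carrier Q" "\<And>p. p \<in> carrier P \<Longrightarrow> x = q p \<Longrightarrow> thesis" for x thesis
    using that surj by blast
  have qc: "q p \<in> carrier Q" if "p \<in> carrier P" for p
    using that surj by blast
  have "abelian_group Q"
  proof (rule abelian_groupI)
    fix x y z assume "x \<in> carrier Q" "y \<in> carrier Q" "z \<in> carrier Q"
    then show "x \<oplus>\<^bsub>Q\<^esub> y \<oplus>\<^bsub>Q\<^esub> z = x \<oplus>\<^bsub>Q\<^esub> (y \<oplus>\<^bsub>Q\<^esub> z)"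
      by (elim elim) (simp add: add[symmetric] P.M.a_assoc)
  next
    fix x y assume "x \<in> carrier Q" "y \<in> carrier Q"
    then show "x \<oplus>\<^bsub>Q\<^esub> y = y \<oplus>\<^bsub>Q\<^esub> x" "x \<oplus>\<^bsub>Q\<^esub> y \<in> carrier Q"
      by (elim elim, simp add: add[symmetric] P.M.a_comm qc)+
  next
    fix x assume x: "x \<in> carrier Q"
    show "\<zero>\<^bsub>Q\<^esub> \<oplus>\<^bsub>Q\<^esub> x = x"
      using x by (elim elim) (simp add: add[symmetric] zero[symmetric])
    show "\<exists>y\<in>carrier Q. y \<oplus>\<^bsub>Q\<^esub> x = \<zero>\<^bsub>Q\<^esub>"
      using x
    proof (elim elim)
      fix p assume "p \<in> carrier P" "x = q p"
      then show ?thesis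
        by (auto simp: add[symmetric] zero[symmetric] P.M.l_neg qc intro!: bexI[of _ "q (\<ominus>\<^bsub>P\<^esub> p)"])
    qed
  qed (simp add: zero[symmetric] qc)
  moreover have "right_module_axioms R Q"
  proof
    fix x y a b assume x: "x \<in> carrier Q" and y: "y \<in> carrier Q"
      and ab: "a \<in> carrier R" "b \<in> carrier R"
    show "(x \<oplus>\<^bsub>Q\<^esub> y) \<star>\<^bsub>Q\<^esub> a = x \<star>\<^bsub>Q\<^esub> a \<oplus>\<^bsub>Q\<^esub> y \<star>\<^bsub>Q\<^esub> a"
      using x y ab by (elim elim) (simp add: add[symmetric] smult[symmetric] P.rsmult_l_distr)
    show "x \<star>\<^bsub>Q\<^esub> (a \<oplus>\<^bsub>R\<^esub> b) = x \<star>\<^bsub>Q\<^esub> a \<oplus>\<^bsub>Q\<^esub> x \<star>\<^bsub>Q\<^esub> b"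
      using x ab by (elim elim) (simp add: add[symmetric] smult[symmetric] P.rsmult_r_distr)
    show "x \<star>\<^bsub>Q\<^esub> (a \<otimes>\<^bsub>R\<^esub> b) = x \<star>\<^bsub>Q\<^esub> a \<star>\<^bsub>Q\<^esub> b"
      using x ab by (elim elim) (simp add: smult[symmetric] P.rsmult_assoc)
  next
    fix x a assume x: "x \<in> carrier Q"
    show "x \<star>\<^bsub>Q\<^esub> \<one>\<^bsub>R\<^esub> = x"
      using x by (elim elim) (simp add: smult[symmetric])
    assume "a \<in> carrier R"
    with x show "x \<star>\<^bsub>Q\<^esub> a \<in> carrier Q"
      by (elim elim) (simp add: smult[symmetric] qc)
  qed
  ultimately show ?thesis
    by (simp add: right_module_def P.R.ring_axioms)
qed

definition qmap :: "('r, 'm) rmodule \<Rightarrow> 'm set \<Rightarrow> 'm \<Rightarrow> 'm set"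
  where "qmap M K = (\<lambda>x\<in>carrier M. K +>\<^bsub>M\<^esub> x)"

context
  fixes R :: "('r, 'z) ring_scheme" and M :: "('r, 'm) rmodule" and K
  assumes M: "right_module R M" and K: "rsubmodule R K M"
begin

interpretation right_module R M by (rule M)

interpretation K: abelian_subgroup K M
  using K by (intro abelian_subgroupI3 M.abelian_group_axioms) (simp add: rsubmodule_def)

lemma qmap_eq_iff:
  assumes "x \<in> carrier M" "y \<in> carrier M"
  shows "qmap M K x = qmap M K y \<longleftrightarrow> x \<ominus>\<^bsub>M\<^esub> y \<in> K"
  using assms K.a_rcos_module[of y x] M.a_repr_independence[OF _ assms(2) K.a_subgroup, of x]
    K.a_rcos_self[of x]
  by (auto simp: qmap_def a_minus_def)

lemma qmap_image: "qmap M K ` carrier M = carrier (rquot M K)"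
  by (auto simp: qmap_def rquot_def A_RCOSETS_def RCOSETS_def a_r_coset_def)

lemma mem_qmap: "x \<in> carrier M \<Longrightarrow> y \<in> qmap M K x \<longleftrightarrow> y \<in> carrier M \<and> qmap M K y = qmap M K x"
  using K.a_rcos_self[of y] M.a_repr_independence[OF _ _ K.a_subgroup, of y x]
    K.a_elemrcos_carrier[of x y]
  by (auto simp: qmap_def)

text \<open>Scalar multiplication in \<open>rquot\<close> is a union over all representatives of a
  coset. Two representatives differ by an element of \<open>K\<close>, hence so do their multiples
  by \<open>a\<close>, and every member of the union is the same coset.\<close>

lemma qmap_smult:
  assumes x: "x \<in> carrier M" and a: "a \<in> carrier R"
  shows "qmap M K (x \<star>\<^bsub>M\<^esub> a) = qmap M K x \<star>\<^bsub>rquot M K\<^esub> a"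
proof -
  have "K +>\<^bsub>M\<^esub> (y \<star>\<^bsub>M\<^esub> a) = qmap M K (x \<star>\<^bsub>M\<^esub> a)" if "y \<in> qmap M K x" for y
  proof -
    have y: "y \<in> carrier M" "y \<ominus>\<^bsub>M\<^esub> x \<in> K"
      using that x qmap_eq_iff[of y x] by (auto simp: mem_qmap)
    have "y \<star>\<^bsub>M\<^esub> a \<ominus>\<^bsub>M\<^esub> x \<star>\<^bsub>M\<^esub> a = (y \<ominus>\<^bsub>M\<^esub> x) \<star>\<^bsub>M\<^esub> a"
      using x y(1) a by (simp add: a_minus_def rsmult_l_distr minus_rsmult)
    with y a have "y \<star>\<^bsub>M\<^esub> a \<ominus>\<^bsub>M\<^esub> x \<star>\<^bsub>M\<^esub> a \<in> K"
      using rsubmoduleD(4)[OF K] by simp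
    with x y a show ?thesis
      using qmap_eq_iff[of "y \<star>\<^bsub>M\<^esub> a" "x \<star>\<^bsub>M\<^esub> a"] by (simp add: qmap_def)
  qed
  moreover have "x \<in> qmap M K x"
    using x by (simp add: mem_qmap)
  ultimately show ?thesis
    by (auto simp: rquot_def)
qed

lemma qmap_add:
  "x \<in> carrier M \<Longrightarrow> y \<in> carrier M \<Longrightarrow>
    qmap M K (x \<oplus>\<^bsub>M\<^esub> y) = qmap M K x \<oplus>\<^bsub>rquot M K\<^esub> qmap M K y"
  by (simp add: qmap_def rquot_def K.a_rcos_sum)

lemma qmap_eq_zero: "x \<in> carrier M \<Longrightarrow> qmap M K x = \<zero>\<^bsub>rquot M K\<^esub> \<longleftrightarrow> x \<in> K"
  using qmap_eq_iff[of x "\<zero>\<^bsub>M\<^esub>"] rsubmoduleD(1)[OF K]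
  by (simp add: rquot_def qmap_def a_minus_def)

lemma right_module_rquot: "right_module R (rquot M K)"
  by (rule right_module_image[OF M qmap_image])
    (simp_all add: qmap_add qmap_smult qmap_eq_zero rsubmoduleD(2)[OF K])

lemma qmap_rhom: "qmap M K \<in> rhom R M (rquot M K)"
  using qmap_image by (intro rhomI) (auto simp: qmap_add qmap_smult, auto simp: qmap_def)

end

section \<open>Isomorphisms and the first isomorphism theorem\<close>

lemma riso_inverse:
  assumes f: "f \<in> riso R M N" and "right_module R M"
  obtains g where "g \<in> riso R N M" "\<And>x. x \<in> carrier M \<Longrightarrow> g (f x) = x"
    "\<And>y. y \<in> carrier N \<Longrightarrow> f (g y) = y"
proof -
  interpret M: right_module R M by fact
  have fh: "f \<in> rhom R M N" and bij: "bij_betw f (carrier M) (carrier N)"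
    using f by (auto simp: riso_def)
  define g where "g = (\<lambda>y\<in>carrier N. the_inv_into (carrier M) f y)"
  have gf: "g (f x) = x" if "x \<in> carrier M" for x
    using that bij rhomD(1)[OF fh] by (simp add: g_def the_inv_into_f_f bij_betw_def)
  have elim: thesis if "y \<in> carrier N" "\<And>x. x \<in> carrier M \<Longrightarrow> y = f x \<Longrightarrow> thesis" for y thesis
    using that bij by (auto simp: bij_betw_def)
  have fg: "f (g y) = y" if "y \<in> carrier N" for y
    using that by (elim elim) (simp add: gf)
  have "g \<in> rhom R N M"
  proof (rule rhomI)
    show "g \<in> carrier N \<rightarrow>\<^sub>E carrier M"
    proof
      fix y assume "y \<in> carrier N" then show "g y \<in> carrier M"
        by (elim elim) (simp add: gf)
    qed (simp add: g_def)
    show "g (x \<oplus>\<^bsub>N\<^esub> y) = g x \<oplus>\<^bsub>M\<^esub> g y" if "x \<in> carrier N" "y \<in> carrier N" for x y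
      using that by (elim elim) (simp add: gf rhomD(2)[OF fh, symmetric])
    show "g (x \<star>\<^bsub>N\<^esub> a) = g x \<star>\<^bsub>M\<^esub> a" if "x \<in> carrier N" "a \<in> carrier R" for x a
      using that(1) by (elim elim) (simp add: gf rhomD(3)[OF fh, symmetric] that)
  qed
  moreover have "bij_betw g (carrier N) (carrier M)"
    by (rule bij_betwI[where g = f]) (use fg gf rhomD(1)[OF \<open>g \<in> rhom R N M\<close>] rhomD(1)[OF fh] in auto)
  ultimately show thesis
    using that[of g] fg gf by (simp add: riso_def)
qed

text \<open>The projection onto the quotient by the kernel factors through \<open>q\<close>. The
  factor is injective because both maps identify \<open>x\<close> and \<open>y\<close> exactly when
  \<open>x - y\<close> lies in the kernel.\<close>

lemma first_isomorphism:
  assumes P: "right_module R P" and Q: "right_module R Q"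
    and q: "q \<in> rhom R P Q" and surj: "q ` carrier P = carrier Q"
  shows "risomorphic R Q (rquot P {p \<in> carrier P. q p = \<zero>\<^bsub>Q\<^esub>})"
proof -
  let ?K = "{p \<in> carrier P. q p = \<zero>\<^bsub>Q\<^esub>}"
  have K: "rsubmodule R ?K P"
    by (rule rsubmodule_kernel[OF q P Q])
  interpret P: right_module R P by fact
  interpret Q: right_module R Q by fact
  note qK = qmap_image[OF P K] qmap_rhom[OF P K] qmap_eq_zero[OF P K] right_module_rquot[OF P K]
  obtain h where h: "h \<in> rhom R Q (rquot P ?K)" "\<forall>p\<in>carrier P. h (q p) = qmap P ?K p"
    using rhom_factor[OF P Q qK(4) q surj qK(2)] qK(3) by auto
  have "bij_betw h (carrier Q) (carrier (rquot P ?K))"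
    unfolding bij_betw_def
  proof
    have "qmap P ?K x = qmap P ?K y \<longleftrightarrow> q x = q y" if "x \<in> carrier P" "y \<in> carrier P" for x y
      using that qmap_eq_iff[OF P K] rhomD(1)[OF q]
      by (simp add: rhom_diff[OF q P Q] Q.minus_eq_zero_iff)
    then have "inj_on h (q ` carrier P)"
      by (auto simp: inj_on_def h(2))
    then show "inj_on h (carrier Q)"
      by (simp add: surj)
    have "h ` q ` carrier P = carrier (rquot P ?K)"
      unfolding qK(1)[symmetric] image_image using h(2) by (intro image_cong) auto
    then show "h ` carrier Q = carrier (rquot P ?K)"
      by (simp add: surj)
  qed
  with h(1) show ?thesis
    unfolding risomorphic_def riso_def by blast
qed

section \<open>Linear combinations and free modules\<close>

text \<open>Formal combinations are lists, in which a generator may occur repeatedly. They can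
  therefore be pushed along maps that are not injective, simply by \<open>map\<close>, without
  collecting coefficients.\<close>

definition lincomb :: "('r, 'n) rmodule \<Rightarrow> ('m \<Rightarrow> 'n) \<Rightarrow> ('m \<times> 'r) list \<Rightarrow> 'n"
  where "lincomb B b l = foldr (\<lambda>(x, a) s. b x \<star>\<^bsub>B\<^esub> a \<oplus>\<^bsub>B\<^esub> s) l \<zero>\<^bsub>B\<^esub>"

lemma lincomb_Nil [simp]: "lincomb B b [] = \<zero>\<^bsub>B\<^esub>"
  by (simp add: lincomb_def)

lemma lincomb_Cons [simp]: "lincomb B b ((x, a) # l) = b x \<star>\<^bsub>B\<^esub> a \<oplus>\<^bsub>B\<^esub> lincomb B b l"
  by (simp add: lincomb_def)

lemma lincomb_carrier_update [simp]: "lincomb (M\<lparr>carrier := K\<rparr>) b l = lincomb M b l"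
  by (simp add: lincomb_def)

lemma lincomb_map_prod [simp]: "lincomb B b (map (map_prod p id) l) = lincomb B (\<lambda>x. b (p x)) l"
  by (induction l) auto

lemma lincomb_cong: "(\<And>x a. (x, a) \<in> set l \<Longrightarrow> b x = c x) \<Longrightarrow> lincomb B b l = lincomb B c l"
proof (induction l)
  case (Cons p l)
  obtain x a where p: "p = (x, a)" by force
  have "b x = c x" using Cons.prems[of x a] p by simp
  moreover have "lincomb B b l = lincomb B c l" by (rule Cons.IH) (use Cons.prems in auto)
  ultimately show ?case by (simp add: p)
qed simp

lemma lincomb_closed:
  assumes "right_module R B" "set l \<subseteq> X \<times> carrier R" "\<And>x. x \<in> X \<Longrightarrow> b x \<in> carrier B"
  shows "lincomb B b l \<in> carrier B"
proof -
  interpret B: right_module R B by fact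
  show ?thesis
    using assms(2,3) by (induction l) auto
qed

lemma lincomb_diff:
  assumes "right_module R B" "set l \<subseteq> X \<times> carrier R"
    "\<And>x. x \<in> X \<Longrightarrow> b x \<in> carrier B" "\<And>x. x \<in> X \<Longrightarrow> c x \<in> carrier B"
  shows "lincomb B (\<lambda>x. b x \<ominus>\<^bsub>B\<^esub> c x) l = lincomb B b l \<ominus>\<^bsub>B\<^esub> lincomb B c l"
proof -
  interpret B: right_module R B by fact
  show ?thesis
    using assms(2)
  proof (induction l)
    case (Cons p l)
    obtain x a where p: "p = (x, a)" by force
    with Cons have "b x \<in> carrier B" "c x \<in> carrier B" "a \<in> carrier R"
      "lincomb B b l \<in> carrier B" "lincomb B c l \<in> carrier B"
      using assms(3,4) lincomb_closed[OF assms(1), of l X] by auto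
    then show ?case
      using Cons by (simp add: p a_minus_def B.rsmult_l_distr B.minus_rsmult B.M.minus_add B.M.a_ac)
  qed (simp add: a_minus_def)
qed

lemma rhom_lincomb:
  assumes "f \<in> rhom R M B" "right_module R M" "right_module R B"
    "set l \<subseteq> X \<times> carrier R" "\<And>x. x \<in> X \<Longrightarrow> b x \<in> carrier M"
  shows "f (lincomb M b l) = lincomb B (\<lambda>x. f (b x)) l"
proof -
  interpret M: right_module R M by fact
  show ?thesis
    using assms(4)
  proof (induction l)
    case Nil
    then show ?case by (simp add: rhom_zero[OF assms(1-3)])
  next
    case (Cons p l)
    then show ?case
      using lincomb_closed[OF assms(2), of l X b] assms(5)
      by (cases p) (simp add: rhomD(2,3)[OF assms(1)])
  qed
qed

lemma lincomb_mem_submodule: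
  assumes "rsubmodule R K M" "set l \<subseteq> X \<times> carrier R" "\<And>x. x \<in> X \<Longrightarrow> b x \<in> K"
  shows "lincomb M b l \<in> K"
  using assms(2) by (induction l) (auto simp: rsubmoduleD[OF assms(1)] assms(3))

section \<open>Free modules and their universal property\<close>

definition runit :: "('r, 'z) ring_scheme \<Rightarrow> 'x set \<Rightarrow> 'x \<Rightarrow> 'x \<Rightarrow> 'r"
  where "runit R X x = (\<lambda>y\<in>X. if y = x then \<one>\<^bsub>R\<^esub> else \<zero>\<^bsub>R\<^esub>)"

lemma rfree_simps:
  "carrier (rfree R X) = {f \<in> X \<rightarrow>\<^sub>E carrier R. finite {x \<in> X. f x \<noteq> \<zero>\<^bsub>R\<^esub>}}"
  "\<zero>\<^bsub>rfree R X\<^esub> = (\<lambda>x\<in>X. \<zero>\<^bsub>R\<^esub>)"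
  "f \<oplus>\<^bsub>rfree R X\<^esub> g = (\<lambda>x\<in>X. f x \<oplus>\<^bsub>R\<^esub> g x)"
  "f \<star>\<^bsub>rfree R X\<^esub> a = (\<lambda>x\<in>X. f x \<otimes>\<^bsub>R\<^esub> a)"
  by (simp_all add: rfree_def)

lemma right_module_rfree:
  assumes "ring R"
  shows "right_module R (rfree R X)"
proof -
  interpret R: ring R by fact
  let ?P = "rfree R X"
  have fin: "finite {x \<in> X. h x \<noteq> \<zero>\<^bsub>R\<^esub>}"
    if "f \<in> carrier (?P)" "g \<in> carrier (?P)"
      "\<And>x. x \<in> X \<Longrightarrow> f x = \<zero>\<^bsub>R\<^esub> \<Longrightarrow> g x = \<zero>\<^bsub>R\<^esub> \<Longrightarrow> h x = \<zero>\<^bsub>R\<^esub>" for f g h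
  proof -
    have "finite ({x \<in> X. f x \<noteq> \<zero>\<^bsub>R\<^esub>} \<union> {x \<in> X. g x \<noteq> \<zero>\<^bsub>R\<^esub>})"
      using that by (simp add: rfree_simps)
    then show ?thesis
      by (rule finite_subset[rotated]) (use that(3) in blast)
  qed
  have car: "f x \<in> carrier R" if "f \<in> carrier (?P)" "x \<in> X" for f x
    using that by (auto simp: rfree_simps)
  have ext: "f = g" if "f \<in> carrier (?P)" "g \<in> carrier (?P)"
    "\<And>x. x \<in> X \<Longrightarrow> f x = g x" for f g
    using that by (intro PiE_ext[of f X "\<lambda>_. carrier R" g]) (auto simp: rfree_simps)
  have zero: "\<zero>\<^bsub>?P\<^esub> \<in> carrier (?P)"
    by (auto simp: rfree_simps)
  have add: "f \<oplus>\<^bsub>?P\<^esub> g \<in> carrier (?P)"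
    if "f \<in> carrier (?P)" "g \<in> carrier (?P)" for f g
    using fin[OF that, of "f \<oplus>\<^bsub>?P\<^esub> g"] car[OF that(1)] car[OF that(2)]
    by (simp add: rfree_simps)
  have smult: "f \<star>\<^bsub>?P\<^esub> a \<in> carrier (?P)"
    if "f \<in> carrier (?P)" "a \<in> carrier R" for f a
    using fin[OF that(1) that(1), of "f \<star>\<^bsub>?P\<^esub> a"] car[OF that(1)] that(2)
    by (simp add: rfree_simps)
  have "abelian_group (?P)"
  proof (rule abelian_groupI)
    fix f assume f: "f \<in> carrier (?P)"
    have "f \<star>\<^bsub>?P\<^esub> (\<ominus>\<^bsub>R\<^esub> \<one>\<^bsub>R\<^esub>) \<oplus>\<^bsub>?P\<^esub> f = \<zero>\<^bsub>?P\<^esub>"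
      by (rule ext[OF add[OF smult[OF f] f] zero]) (use f car in \<open>auto simp: rfree_simps(2-) R.r_minus R.l_neg\<close>)
    moreover have "f \<star>\<^bsub>?P\<^esub> (\<ominus>\<^bsub>R\<^esub> \<one>\<^bsub>R\<^esub>) \<in> carrier (?P)"
      by (rule smult[OF f]) simp
    ultimately show "\<exists>g\<in>carrier (?P). g \<oplus>\<^bsub>?P\<^esub> f = \<zero>\<^bsub>?P\<^esub>"
      by blast
  next
    fix f g h
    assume f: "f \<in> carrier (?P)" and g: "g \<in> carrier (?P)" and h: "h \<in> carrier (?P)"
    show "f \<oplus>\<^bsub>?P\<^esub> g \<oplus>\<^bsub>?P\<^esub> h = f \<oplus>\<^bsub>?P\<^esub> (g \<oplus>\<^bsub>?P\<^esub> h)"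
      by (rule ext[OF add[OF add[OF f g] h] add[OF f add[OF g h]]])
        (use f g h car in \<open>simp add: rfree_simps(2-) R.a_assoc\<close>)
  next
    fix f g assume f: "f \<in> carrier (?P)" and g: "g \<in> carrier (?P)"
    show "f \<oplus>\<^bsub>?P\<^esub> g = g \<oplus>\<^bsub>?P\<^esub> f"
      by (rule ext[OF add[OF f g] add[OF g f]]) (use f g car in \<open>simp add: rfree_simps(2-) R.a_comm\<close>)
    show "\<zero>\<^bsub>?P\<^esub> \<oplus>\<^bsub>?P\<^esub> f = f"
      by (rule ext[OF add[OF zero f] f]) (use f car in \<open>simp add: rfree_simps(2-)\<close>)
  qed (fact add zero)+
  moreover have "right_module_axioms R (?P)"
  proof
    fix f g a b
    assume f: "f \<in> carrier (?P)" and g: "g \<in> carrier (?P)"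
      and a: "a \<in> carrier R" and b: "b \<in> carrier R"
    show "(f \<oplus>\<^bsub>?P\<^esub> g) \<star>\<^bsub>?P\<^esub> a = f \<star>\<^bsub>?P\<^esub> a \<oplus>\<^bsub>?P\<^esub> g \<star>\<^bsub>?P\<^esub> a"
      by (rule ext[OF smult[OF add[OF f g] a] add[OF smult[OF f a] smult[OF g a]]])
        (use f g a car in \<open>simp add: rfree_simps(2-) R.l_distr\<close>)
    show "f \<star>\<^bsub>?P\<^esub> (a \<oplus>\<^bsub>R\<^esub> b) = f \<star>\<^bsub>?P\<^esub> a \<oplus>\<^bsub>?P\<^esub> f \<star>\<^bsub>?P\<^esub> b"
      by (rule ext[OF smult[OF f R.a_closed[OF a b]] add[OF smult[OF f a] smult[OF f b]]])
        (use f a b car in \<open>simp add: rfree_simps(2-) R.r_distr\<close>)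
    show "f \<star>\<^bsub>?P\<^esub> (a \<otimes>\<^bsub>R\<^esub> b) = f \<star>\<^bsub>?P\<^esub> a \<star>\<^bsub>?P\<^esub> b"
      by (rule ext[OF smult[OF f R.m_closed[OF a b]] smult[OF smult[OF f a] b]])
        (use f a b car in \<open>simp add: rfree_simps(2-) R.m_assoc\<close>)
  next
    fix f assume f: "f \<in> carrier (?P)"
    show "f \<star>\<^bsub>?P\<^esub> \<one>\<^bsub>R\<^esub> = f"
      by (rule ext[OF smult[OF f R.one_closed] f]) (use f car in \<open>simp add: rfree_simps(2-)\<close>)
  qed (fact smult)
  ultimately show ?thesis
    using assms by (simp add: right_module_def)
qed

text \<open>For \<open>x\<close> outside \<open>X\<close> the function is the zero vector, so
  closure holds for every \<open>x\<close>. Choices of preimages can thus be made for all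
  \<open>x\<close> at once.\<close>

lemma runit_closed:
  assumes "ring R"
  shows "runit R X x \<in> carrier (rfree R X)"
proof -
  interpret R: ring R by fact
  have "{y \<in> X. runit R X x y \<noteq> \<zero>\<^bsub>R\<^esub>} \<subseteq> {x}"
    by (auto simp: runit_def)
  then have "finite {y \<in> X. runit R X x y \<noteq> \<zero>\<^bsub>R\<^esub>}"
    by (rule finite_subset) simp
  then show ?thesis
    by (auto simp: rfree_simps(1)) (auto simp: runit_def)
qed

text \<open>Induction on the support, splitting off one coordinate at a time. The set
  \<open>Y\<close> bounds the support, which lets the canonical presentation express an element
  supported on \<open>Y\<close> by generators from \<open>Y\<close> alone.\<close>

lemma rfree_lincomb:
  assumes "ring R" "e \<in> carrier (rfree R X)" "\<And>x. x \<in> X - Y \<Longrightarrow> e x = \<zero>\<^bsub>R\<^esub>"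
  obtains l where "set l \<subseteq> (X \<inter> Y) \<times> carrier R" "e = lincomb (rfree R X) (runit R X) l"
proof -
  interpret R: ring R by fact
  have claim: "\<exists>l. set l \<subseteq> S \<times> carrier R \<and> e = lincomb (rfree R X) (runit R X) l"
    if "finite S" "S \<subseteq> X" "e \<in> X \<rightarrow>\<^sub>E carrier R" "\<And>x. x \<in> X - S \<Longrightarrow> e x = \<zero>\<^bsub>R\<^esub>" for S e
    using that
  proof (induction S arbitrary: e rule: finite_induct)
    case empty
    then have "e = \<zero>\<^bsub>rfree R X\<^esub>"
      by (intro PiE_ext[of e X "\<lambda>_. carrier R"]) (auto simp: rfree_simps)
    then show ?case by (intro exI[of _ "[]"]) simp
  next
    case (insert z S)
    have "\<exists>l. set l \<subseteq> S \<times> carrier R \<and> e(z := \<zero>\<^bsub>R\<^esub>) = lincomb (rfree R X) (runit R X) l"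
      by (rule insert.IH) (use insert.prems in auto)
    then obtain l where l: "set l \<subseteq> S \<times> carrier R"
      "e(z := \<zero>\<^bsub>R\<^esub>) = lincomb (rfree R X) (runit R X) l" by blast
    have ex: "e x \<in> carrier R" if "x \<in> X" for x using that insert.prems by auto
    then have ez: "e z \<in> carrier R" using insert.prems by auto
    have "e = lincomb (rfree R X) (runit R X) ((z, e z) # l)"
    proof (rule PiE_ext)
      show "lincomb (rfree R X) (runit R X) ((z, e z) # l) \<in> X \<rightarrow>\<^sub>E carrier R"
        unfolding lincomb_Cons l(2)[symmetric] using ez ex
        by (auto simp: rfree_simps runit_def)
      fix x assume "x \<in> X"
      then show "e x = lincomb (rfree R X) (runit R X) ((z, e z) # l) x"
        unfolding lincomb_Cons l(2)[symmetric] using ez ex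
        by (simp add: rfree_simps runit_def)
    qed (fact insert.prems)
    with l(1) ez show ?case by (intro exI[of _ "(z, e z) # l"]) auto
  qed
  have "\<exists>l. set l \<subseteq> {x \<in> X. e x \<noteq> \<zero>\<^bsub>R\<^esub>} \<times> carrier R \<and> e = lincomb (rfree R X) (runit R X) l"
    by (rule claim) (use assms(2) in \<open>simp_all add: rfree_simps(1)\<close>)
  then obtain l where l: "set l \<subseteq> {x \<in> X. e x \<noteq> \<zero>\<^bsub>R\<^esub>} \<times> carrier R"
    "e = lincomb (rfree R X) (runit R X) l"
    by blast
  have "{x \<in> X. e x \<noteq> \<zero>\<^bsub>R\<^esub>} \<subseteq> X \<inter> Y"
    using assms(3) by blast
  with l(1) have "set l \<subseteq> (X \<inter> Y) \<times> carrier R"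
    by blast
  then show thesis
    using l(2) by (rule that)
qed

text \<open>The homomorphism with prescribed images \<open>b\<close> of the basis. The sum has the
  shape used in \<open>free_cover\<close>, which becomes the case where \<open>b\<close> is the
  identity.\<close>

definition free_ext ::
    "('r, 'z) ring_scheme \<Rightarrow> 'x set \<Rightarrow> ('r, 'm) rmodule \<Rightarrow> ('x \<Rightarrow> 'm) \<Rightarrow> ('x \<Rightarrow> 'r) \<Rightarrow> 'm"
  where "free_ext R X B b =
    (\<lambda>f\<in>carrier (rfree R X). finsum B (\<lambda>x. b x \<star>\<^bsub>B\<^esub> f x) {x \<in> X. f x \<noteq> \<zero>\<^bsub>R\<^esub>})"

lemma free_cover_eq_free_ext: "free_cover R S = free_ext R (carrier S) S (\<lambda>x. x)"
  by (simp add: free_cover_def free_ext_def)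

lemma (in right_module) finsum_rsmult:
  assumes "finite A" "f \<in> A \<rightarrow> carrier M" "a \<in> carrier R"
  shows "finsum M f A \<star>\<^bsub>M\<^esub> a = finsum M (\<lambda>x. f x \<star>\<^bsub>M\<^esub> a) A"
  using assms
proof (induction A rule: finite_induct)
  case (insert x A)
  then show ?case
    by (subst M.finsum_insert M.finsum_insert; auto simp: rsmult_l_distr)+
qed simp

lemma
  assumes B: "right_module R B" and b: "\<And>x. x \<in> X \<Longrightarrow> b x \<in> carrier B"
  shows free_ext_rhom: "free_ext R X B b \<in> rhom R (rfree R X) B"
    and free_ext_runit: "x \<in> X \<Longrightarrow> free_ext R X B b (runit R X x) = b x"
proof -
  interpret B: right_module R B by fact
  interpret P: right_module R "rfree R X" by (rule right_module_rfree) unfold_locales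
  have car: "f x \<in> carrier R" if "f \<in> carrier (rfree R X)" "x \<in> X" for f x
    using that by (auto simp: rfree_simps)
  \<comment> \<open>The supports of \<open>f\<close>, \<open>g\<close> and their sum differ. Added
    zero terms allow all three sums to be taken over one finite set \<open>T\<close>.\<close>
  have eq: "free_ext R X B b f = finsum B (\<lambda>x. b x \<star>\<^bsub>B\<^esub> f x) T"
    if f: "f \<in> carrier (rfree R X)" and T: "finite T" "T \<subseteq> X" "{x \<in> X. f x \<noteq> \<zero>\<^bsub>R\<^esub>} \<subseteq> T" for f T
    unfolding free_ext_def
    using T b car[OF f] f
    by (auto intro!: B.M.add.finprod_mono_neutral_cong_left simp: subset_iff)
  show "free_ext R X B b \<in> rhom R (rfree R X) B"
  proof (rule rhomI)
    show "free_ext R X B b \<in> carrier (rfree R X) \<rightarrow>\<^sub>E carrier B"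
      using b car by (auto simp: free_ext_def intro!: B.M.finsum_closed)
  next
    fix f g assume f: "f \<in> carrier (rfree R X)" and g: "g \<in> carrier (rfree R X)"
    let ?T = "{x \<in> X. f x \<noteq> \<zero>\<^bsub>R\<^esub>} \<union> {x \<in> X. g x \<noteq> \<zero>\<^bsub>R\<^esub>}"
    have T: "finite ?T" "?T \<subseteq> X"
      using f g by (auto simp: rfree_simps)
    have "free_ext R X B b (f \<oplus>\<^bsub>rfree R X\<^esub> g) =
        finsum B (\<lambda>x. b x \<star>\<^bsub>B\<^esub> (f \<oplus>\<^bsub>rfree R X\<^esub> g) x) ?T"
      using f g by (intro eq T P.M.a_closed) (auto simp: rfree_simps(3))
    also have "\<dots> = finsum B (\<lambda>x. b x \<star>\<^bsub>B\<^esub> f x \<oplus>\<^bsub>B\<^esub> b x \<star>\<^bsub>B\<^esub> g x) ?T"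
      using b car[OF f] car[OF g]
      by (intro B.M.finsum_cong) (auto simp: rfree_simps(3) B.rsmult_r_distr simp_implies_def)
    also have "\<dots> = free_ext R X B b f \<oplus>\<^bsub>B\<^esub> free_ext R X B b g"
      using b car[OF f] car[OF g]
      by (subst B.M.finsum_addf) (auto simp: eq[OF f T] eq[OF g T])
    finally show "free_ext R X B b (f \<oplus>\<^bsub>rfree R X\<^esub> g) =
        free_ext R X B b f \<oplus>\<^bsub>B\<^esub> free_ext R X B b g" .
  next
    fix f a assume f: "f \<in> carrier (rfree R X)" and a: "a \<in> carrier R"
    let ?T = "{x \<in> X. f x \<noteq> \<zero>\<^bsub>R\<^esub>}"
    have T: "finite ?T" "?T \<subseteq> X"
      using f by (auto simp: rfree_simps)
    have "free_ext R X B b (f \<star>\<^bsub>rfree R X\<^esub> a) = finsum B (\<lambda>x. b x \<star>\<^bsub>B\<^esub> (f \<star>\<^bsub>rfree R X\<^esub> a) x) ?T"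
      using f a by (intro eq T P.rsmult_closed) (auto simp: rfree_simps(4))
    also have "\<dots> = finsum B (\<lambda>x. b x \<star>\<^bsub>B\<^esub> f x \<star>\<^bsub>B\<^esub> a) ?T"
      using b car[OF f] a
      by (intro B.M.finsum_cong) (auto simp: rfree_simps(4) B.rsmult_assoc simp_implies_def)
    also have "\<dots> = free_ext R X B b f \<star>\<^bsub>B\<^esub> a"
      using b car[OF f] a T by (subst B.finsum_rsmult[symmetric]) (auto simp: eq[OF f T])
    finally show "free_ext R X B b (f \<star>\<^bsub>rfree R X\<^esub> a) = free_ext R X B b f \<star>\<^bsub>B\<^esub> a" .
  qed
  assume x: "x \<in> X"
  have "free_ext R X B b (runit R X x) = finsum B (\<lambda>y. b y \<star>\<^bsub>B\<^esub> runit R X x y) {x}"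
    using x by (intro eq runit_closed B.R.ring_axioms) (auto simp: runit_def)
  also have "\<dots> = b x"
    using x b by (simp add: runit_def)
  finally show "free_ext R X B b (runit R X x) = b x" .
qed

lemma rhom_rfree_lincomb:
  assumes "ring R" "right_module R B" "f \<in> rhom R (rfree R X) B" "set l \<subseteq> X \<times> carrier R"
  shows "f (lincomb (rfree R X) (runit R X) l) = lincomb B (\<lambda>x. f (runit R X x)) l"
  using rhom_lincomb[OF assms(3) right_module_rfree[OF assms(1)] assms(2,4)] by (simp add: runit_closed assms(1))

lemma rhom_rfree_eqI:
  assumes "ring R" "right_module R B" "f \<in> rhom R (rfree R X) B" "g \<in> rhom R (rfree R X) B"
    "\<And>x. x \<in> X \<Longrightarrow> f (runit R X x) = g (runit R X x)" "e \<in> carrier (rfree R X)"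
  shows "f e = g e"
proof -
  obtain l where l: "set l \<subseteq> X \<times> carrier R" "e = lincomb (rfree R X) (runit R X) l"
    using rfree_lincomb[OF assms(1,6), of X] by auto
  show ?thesis
    unfolding l(2) rhom_rfree_lincomb[OF assms(1-3) l(1)] rhom_rfree_lincomb[OF assms(1,2,4) l(1)]
    by (rule lincomb_cong) (use l(1) assms(5) in auto)
qed

section \<open>Stationarity in terms of finite systems of relations\<close>

definition module_relations ::
    "('r, 'z) ring_scheme \<Rightarrow> ('r, 'm) rmodule \<Rightarrow> ('m \<times> 'r) list set"
  where "module_relations R M =
    {l. set l \<subseteq> carrier M \<times> carrier R \<and> lincomb M (\<lambda>x. x) l = \<zero>\<^bsub>M\<^esub>}"

text \<open>The elementwise form of strict stationarity: a finite system \<open>E\<close> of relations holding in \<open>M\<close>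
is such that a solution \<open>b\<close> of \<open>E\<close> in \<open>B\<close> is, on the given finite set \<open>X\<close>, a restriction of a
homomorphism. Only the finitely many values of \<open>b\<close> on the elements occurring in \<open>E\<close> or \<open>X\<close> matter.\<close>

definition controls ::
    "('r, 'z) ring_scheme \<Rightarrow> ('r, 'b) rmodule \<Rightarrow> ('r, 'm) rmodule \<Rightarrow> 'm set \<Rightarrow>
     ('m \<times> 'r) list set \<Rightarrow> bool"
  where "controls R B M X E \<longleftrightarrow>
    finite E \<and> E \<subseteq> module_relations R M \<and>
    (\<forall>b. b \<in> carrier M \<rightarrow> carrier B \<longrightarrow> (\<forall>l\<in>E. lincomb B b l = \<zero>\<^bsub>B\<^esub>) \<longrightarrow>
      (\<exists>f\<in>rhom R M B. \<forall>x\<in>X. f x = b x))"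

definition rel_stationary ::
    "('r, 'z) ring_scheme \<Rightarrow> ('r, 'b) rmodule \<Rightarrow> ('r, 'm) rmodule \<Rightarrow> bool"
  where "rel_stationary R B M \<longleftrightarrow>
    (\<forall>X. finite X \<longrightarrow> X \<subseteq> carrier M \<longrightarrow> (\<exists>E. controls R B M X E))"

lemma rel_stationaryI:
  "(\<And>X. finite X \<Longrightarrow> X \<subseteq> carrier M \<Longrightarrow> \<exists>E. controls R B M X E) \<Longrightarrow> rel_stationary R B M"
  by (simp add: rel_stationary_def)

lemma rel_stationaryE:
  assumes "rel_stationary R B M" "finite X" "X \<subseteq> carrier M"
  obtains E where "finite E" "E \<subseteq> module_relations R M"
    "\<forall>b. b \<in> carrier M \<rightarrow> carrier B \<longrightarrow> (\<forall>l\<in>E. lincomb B b l = \<zero>\<^bsub>B\<^esub>) \<longrightarrow>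
      (\<exists>f\<in>rhom R M B. \<forall>x\<in>X. f x = b x)"
proof -
  have "\<exists>E. controls R B M X E"
    using assms by (simp add: rel_stationary_def)
  then show thesis
    unfolding controls_def by (elim exE conjE) (rule that)
qed

lemma rel_stationary_retract:
  assumes M: "right_module R M" and N: "right_module R N"
    and stat: "rel_stationary R B M"
    and i: "i \<in> rhom R N M" and p: "p \<in> rhom R M N" and pi: "\<And>x. x \<in> carrier N \<Longrightarrow> p (i x) = x"
  shows "rel_stationary R B N"
proof (rule rel_stationaryI)
  fix X assume X: "finite X" "X \<subseteq> carrier N"
  have iX: "i ` X \<subseteq> carrier M"
    using X(2) rhomD(1)[OF i] by blast
  obtain E where E: "finite E" "E \<subseteq> module_relations R M"
    "\<forall>b. b \<in> carrier M \<rightarrow> carrier B \<longrightarrow> (\<forall>l\<in>E. lincomb B b l = \<zero>\<^bsub>B\<^esub>) \<longrightarrow>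
      (\<exists>f\<in>rhom R M B. \<forall>x\<in>i ` X. f x = b x)"
    by (rule rel_stationaryE[OF stat finite_imageI[OF X(1)] iX])
  let ?E = "map (map_prod p id) ` E"
  have "?E \<subseteq> module_relations R N"
  proof
    fix l' assume "l' \<in> ?E"
    then obtain l where l: "l \<in> E" "l' = map (map_prod p id) l" by blast
    then have l1: "set l \<subseteq> carrier M \<times> carrier R" "lincomb M (\<lambda>x. x) l = \<zero>\<^bsub>M\<^esub>"
      using E(2) by (auto simp: module_relations_def)
    have "lincomb N (\<lambda>x. x) l' = p (lincomb M (\<lambda>x. x) l)"
      using rhom_lincomb[OF p M N l1(1), of "\<lambda>x. x"] by (simp add: l(2))
    also have "\<dots> = \<zero>\<^bsub>N\<^esub>"
      by (simp add: l1(2) rhom_zero[OF p M N])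
    finally show "l' \<in> module_relations R N"
      using l1(1) rhomD(1)[OF p] by (auto simp: module_relations_def l(2))
  qed
  moreover have "\<exists>f\<in>rhom R N B. \<forall>x\<in>X. f x = b x"
    if b: "b \<in> carrier N \<rightarrow> carrier B" "\<forall>l\<in>?E. lincomb B b l = \<zero>\<^bsub>B\<^esub>" for b
  proof -
    have "\<exists>f\<in>rhom R M B. \<forall>x\<in>i ` X. f x = b (p x)"
      by (rule E(3)[rule_format]) (use b rhomD(1)[OF p] in auto)
    then obtain f where f: "f \<in> rhom R M B" "\<forall>x\<in>i ` X. f x = b (p x)" by blast
    have "compose (carrier N) f i x = b x" if "x \<in> X" for x
      using f(2) pi X(2) that by (auto simp: compose_eq)
    then show ?thesis
      using rhom_compose[OF i f(1) N] by blast
  qed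
  ultimately show "\<exists>E. controls R B N X E"
      unfolding controls_def
    using E(1) by (intro exI[of _ ?E]) simp
qed

text \<open>Surjectivity of restriction from Hom(M, B) to Hom(K, B). Isolating it lets factors with
  vanishing Ext, projective factors and whole filtrations feed the same arguments.\<close>

definition hom_extends ::
    "('r, 'z) ring_scheme \<Rightarrow> ('r, 'm) rmodule \<Rightarrow> 'm set \<Rightarrow> ('r, 'b) rmodule \<Rightarrow> bool"
  where "hom_extends R M K B \<longleftrightarrow>
    (\<forall>f\<in>rhom R (M\<lparr>carrier := K\<rparr>) B. \<exists>g\<in>rhom R M B. \<forall>x\<in>K. g x = f x)"

text \<open>Elements and relations of \<open>C\<close> are lifted to \<open>M\<close> by a section
  of \<open>\<pi>\<close>, and the lifting errors are elements of \<open>K\<close>. Only finitely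
  many errors occur, so \<open>K\<close> is asked to control exactly these; additional relations tie
  them to \<open>X\<close> and to the lifted relations.\<close>

lemma rel_stationary_extension:
  assumes M: "right_module R M" and C: "right_module R C" and B: "right_module R B"
    and \<pi>: "\<pi> \<in> rhom R M C" and surj: "\<pi> ` carrier M = carrier C"
    and K_def: "K = {x \<in> carrier M. \<pi> x = \<zero>\<^bsub>C\<^esub>}"
    and statK: "rel_stationary R B (M\<lparr>carrier := K\<rparr>)" and statC: "rel_stationary R B C"
    and ext: "hom_extends R M K B"
  shows "rel_stationary R B M"
proof (rule rel_stationaryI)
  interpret M: right_module R M by fact
  interpret C: right_module R C by fact
  interpret B: right_module R B by fact
  \<comment> \<open>The section \<open>s\<close> is merely a function; it need not be
    additive.\<close>
  have "\<forall>c\<in>carrier C. \<exists>x. x \<in> carrier M \<and> \<pi> x = c"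
    by (auto simp: surj[symmetric])
  from bchoice[OF this] obtain s
    where s: "\<And>c. c \<in> carrier C \<Longrightarrow> s c \<in> carrier M" "\<And>c. c \<in> carrier C \<Longrightarrow> \<pi> (s c) = c"
    by blast
  fix X assume X: "finite X" "X \<subseteq> carrier M"
  have \<pi>X: "\<pi> ` X \<subseteq> carrier C"
    using X(2) rhomD(1)[OF \<pi>] by blast
  obtain EC where EC: "finite EC" "EC \<subseteq> module_relations R C"
    "\<forall>b. b \<in> carrier C \<rightarrow> carrier B \<longrightarrow> (\<forall>l\<in>EC. lincomb B b l = \<zero>\<^bsub>B\<^esub>) \<longrightarrow>
      (\<exists>f\<in>rhom R C B. \<forall>x\<in>\<pi> ` X. f x = b x)"
    by (rule rel_stationaryE[OF statC finite_imageI[OF X(1)] \<pi>X])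
  \<comment> \<open>The two kinds of error: \<open>ax x\<close> measures how far \<open>x\<close> is
    from the chosen representative of its class, and \<open>ae l\<close> is what a relation
    \<open>l\<close> of \<open>C\<close> evaluates to after lifting its generators by
    \<open>s\<close>. Both are killed by \<open>\<pi>\<close>.\<close>
  define ax where "ax x = x \<ominus>\<^bsub>M\<^esub> s (\<pi> x)" for x
  define ae where "ae l = lincomb M s l" for l
  have EC1: "set l \<subseteq> carrier C \<times> carrier R" "lincomb C (\<lambda>x. x) l = \<zero>\<^bsub>C\<^esub>" if "l \<in> EC" for l
    using EC(2) that by (auto simp: module_relations_def)
  have K: "x \<in> K \<longleftrightarrow> x \<in> carrier M \<and> \<pi> x = \<zero>\<^bsub>C\<^esub>" for x
    by (simp add: K_def)
  have ax: "ax x \<in> K" if "x \<in> X" for x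
  proof -
    have x: "x \<in> carrier M" "\<pi> x \<in> carrier C"
      using that X(2) rhomD(1)[OF \<pi>] by blast+
    then show ?thesis
      by (simp add: K ax_def s rhom_diff[OF \<pi> M C] C.minus_eq_zero_iff)
  qed
  have ae: "ae l \<in> K" if l: "l \<in> EC" for l
  proof -
    have "\<pi> (ae l) = lincomb C (\<lambda>x. \<pi> (s x)) l"
      unfolding ae_def by (rule rhom_lincomb[OF \<pi> M C EC1(1)[OF l] s(1)])
    also have "\<dots> = lincomb C (\<lambda>x. x) l"
      by (rule lincomb_cong) (use EC1(1)[OF l] s in auto)
    finally have "\<pi> (ae l) = \<zero>\<^bsub>C\<^esub>"
      using EC1(2)[OF l] by simp
    moreover have "ae l \<in> carrier M"
      unfolding ae_def by (rule lincomb_closed[OF M EC1(1)[OF l] s(1)])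
    ultimately show ?thesis by (simp add: K)
  qed
  have "finite (ae ` EC \<union> ax ` X)" "ae ` EC \<union> ax ` X \<subseteq> carrier (M\<lparr>carrier := K\<rparr>)"
    using EC(1) X(1) ae ax by auto
  then obtain EK where EK: "finite EK"
    "EK \<subseteq> module_relations R (M\<lparr>carrier := K\<rparr>)"
    "\<forall>b. b \<in> carrier (M\<lparr>carrier := K\<rparr>) \<rightarrow> carrier B \<longrightarrow> (\<forall>l\<in>EK. lincomb B b l = \<zero>\<^bsub>B\<^esub>) \<longrightarrow>
      (\<exists>f\<in>rhom R (M\<lparr>carrier := K\<rparr>) B. \<forall>x\<in>ae ` EC \<union> ax ` X. f x = b x)"
    by (rule rel_stationaryE[OF statK])
  define m1 where "m1 = \<ominus>\<^bsub>R\<^esub> \<one>\<^bsub>R\<^esub>"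
  have m1: "m1 \<in> carrier R" "\<And>x. x \<in> carrier M \<Longrightarrow> x \<star>\<^bsub>M\<^esub> m1 = \<ominus>\<^bsub>M\<^esub> x"
    "\<And>x. x \<in> carrier B \<Longrightarrow> x \<star>\<^bsub>B\<^esub> m1 = \<ominus>\<^bsub>B\<^esub> x"
    by (simp_all add: m1_def M.rsmult_minus_one B.rsmult_minus_one)
  \<comment> \<open>Since \<open>b\<close> is no homomorphism, the definitions of
    \<open>ae l\<close> and \<open>ax x\<close> have to be imposed on it as relations:
    \<open>re l\<close> says that the lifted combination equals \<open>ae l\<close>, and
    \<open>rx x\<close> says that \<open>x\<close> is the sum of \<open>s (\<pi> x)\<close> and
    \<open>ax x\<close>.\<close>
  define re where "re l = (ae l, m1) # map (map_prod s id) l" for l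
  define rx where "rx x = [(x, \<one>\<^bsub>R\<^esub>), (s (\<pi> x), m1), (ax x, m1)]" for x
  let ?E = "EK \<union> re ` EC \<union> rx ` X"
  have "re l \<in> module_relations R M" if l: "l \<in> EC" for l
  proof -
    have "ae l \<in> carrier M"
      using ae[OF l] by (simp add: K)
    moreover have "set (map (map_prod s id) l) \<subseteq> carrier M \<times> carrier R"
      using EC1(1)[OF l] s(1) by auto
    moreover have "lincomb M (\<lambda>x. x) (map (map_prod s id) l) = ae l"
      by (simp add: ae_def)
    ultimately show ?thesis
      by (simp add: module_relations_def re_def m1 M.M.l_neg del: lincomb_map_prod)
  qed
  moreover have "rx x \<in> module_relations R M" if x: "x \<in> X" for x
  proof -
    have car: "x \<in> carrier M" "s (\<pi> x) \<in> carrier M" "ax x \<in> carrier M"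
      using x X(2) s(1) rhomD(1)[OF \<pi>] ax[OF x] by (auto simp: K)
    then have "x \<oplus>\<^bsub>M\<^esub> (\<ominus>\<^bsub>M\<^esub> s (\<pi> x) \<oplus>\<^bsub>M\<^esub> \<ominus>\<^bsub>M\<^esub> ax x) = ax x \<oplus>\<^bsub>M\<^esub> \<ominus>\<^bsub>M\<^esub> ax x"
      by (simp add: ax_def a_minus_def M.M.a_assoc)
    with car show ?thesis
      by (simp add: module_relations_def rx_def m1 M.M.r_neg)
  qed
  moreover have "EK \<subseteq> module_relations R M"
  proof
    fix l assume "l \<in> EK"
    then have "set l \<subseteq> K \<times> carrier R" "lincomb M (\<lambda>x. x) l = \<zero>\<^bsub>M\<^esub>"
      using EK(2) by (auto simp: module_relations_def)
    moreover have "K \<times> carrier R \<subseteq> carrier M \<times> carrier R"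
      by (auto simp: K)
    ultimately show "l \<in> module_relations R M"
      by (simp add: module_relations_def)
  qed
  ultimately have E: "?E \<subseteq> module_relations R M"
    by blast
  have "\<exists>k\<in>rhom R M B. \<forall>x\<in>X. k x = b x"
    if b: "b \<in> carrier M \<rightarrow> carrier B" and rel: "\<forall>l\<in>?E. lincomb B b l = \<zero>\<^bsub>B\<^esub>" for b
  proof -
    have bM: "b x \<in> carrier B" if "x \<in> carrier M" for x
      by (rule funcset_mem[OF b that])
    have "\<exists>f\<in>rhom R (M\<lparr>carrier := K\<rparr>) B. \<forall>x\<in>ae ` EC \<union> ax ` X. f x = b x"
      by (rule EK(3)[rule_format]) (use rel bM in \<open>auto simp: K\<close>)
    then obtain f where f: "f \<in> rhom R (M\<lparr>carrier := K\<rparr>) B"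
      "\<And>l. l \<in> EC \<Longrightarrow> f (ae l) = b (ae l)" "\<And>x. x \<in> X \<Longrightarrow> f (ax x) = b (ax x)"
      by blast
    obtain g where g: "g \<in> rhom R M B" "\<And>x. x \<in> K \<Longrightarrow> g x = f x"
      using ext f(1) unfolding hom_extends_def by blast
    note gM = rhomD(1)[OF g(1)]
    \<comment> \<open>The part of \<open>b\<close> not explained by \<open>g\<close>, read on
      representatives. On a relation \<open>l\<close> of \<open>C\<close> it yields
      \<open>b (ae l) - g (ae l)\<close>, which is zero because \<open>g\<close> extends
      \<open>f\<close> and \<open>f\<close> agrees with \<open>b\<close> on the errors.\<close>
    define d where "d c = b (s c) \<ominus>\<^bsub>B\<^esub> g (s c)" for c
    have "lincomb B d l = \<zero>\<^bsub>B\<^esub>" if l: "l \<in> EC" for l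
    proof -
      have aeM: "ae l \<in> carrier M"
        using ae[OF l] by (simp add: K)
      have cb: "lincomb B (\<lambda>x. b (s x)) l \<in> carrier B"
        by (rule lincomb_closed[OF B EC1(1)[OF l]]) (simp add: bM s)
      have "lincomb B b (re l) = \<zero>\<^bsub>B\<^esub>"
        using rel l by blast
      then have "\<ominus>\<^bsub>B\<^esub> b (ae l) \<oplus>\<^bsub>B\<^esub> lincomb B (\<lambda>x. b (s x)) l = \<zero>\<^bsub>B\<^esub>"
        using aeM bM by (simp add: re_def m1)
      then have "lincomb B (\<lambda>x. b (s x)) l = b (ae l)"
        using cb bM[OF aeM] by (metis B.M.a_comm B.M.a_inv_closed B.M.minus_equality B.M.minus_minus)
      moreover have "lincomb B (\<lambda>x. g (s x)) l = g (ae l)"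
        unfolding ae_def by (rule rhom_lincomb[OF g(1) M B EC1(1)[OF l] s(1), symmetric])
      moreover have "lincomb B d l = lincomb B (\<lambda>x. b (s x)) l \<ominus>\<^bsub>B\<^esub> lincomb B (\<lambda>x. g (s x)) l"
        unfolding d_def by (rule lincomb_diff[OF B EC1(1)[OF l]]) (simp_all add: bM gM s)
      ultimately show ?thesis
        using g(2)[OF ae[OF l]] f(2)[OF l] bM[OF aeM] by (simp add: B.minus_eq_zero_iff)
    qed
    moreover have "d \<in> carrier C \<rightarrow> carrier B"
      by (auto simp: d_def bM gM s)
    ultimately have "\<exists>f\<in>rhom R C B. \<forall>x\<in>\<pi> ` X. f x = d x"
      by (intro EC(3)[rule_format])
    then obtain h where h: "h \<in> rhom R C B" "\<And>x. x \<in> X \<Longrightarrow> h (\<pi> x) = d (\<pi> x)"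
      by blast
    \<comment> \<open>At \<open>x\<close> in \<open>X\<close> the value is
      \<open>g x + b (s (\<pi> x)) - g (s (\<pi> x))\<close>, that is
      \<open>g (ax x) + b (s (\<pi> x))\<close>. Here \<open>g\<close> may be replaced by
      \<open>b\<close>, and the relation \<open>rx x\<close> turns the sum into
      \<open>b x\<close>.\<close>
    define k where "k = (\<lambda>x\<in>carrier M. g x \<oplus>\<^bsub>B\<^esub> compose (carrier M) h \<pi> x)"
    have "k \<in> rhom R M B"
      unfolding k_def by (intro rhom_add g(1) rhom_compose[OF \<pi> h(1)] M B)
    moreover have "k x = b x" if x: "x \<in> X" for x
    proof -
      have car: "x \<in> carrier M" "s (\<pi> x) \<in> carrier M" "ax x \<in> carrier M"
        using x X(2) s(1) rhomD(1)[OF \<pi>] ax[OF x] by (auto simp: K)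
      note carB = bM[OF car(1)] bM[OF car(2)] bM[OF car(3)] gM[OF car(1)] gM[OF car(2)]
      have "g x \<ominus>\<^bsub>B\<^esub> g (s (\<pi> x)) = b (ax x)"
        using g(2)[OF ax[OF x]] f(3)[OF x] car rhom_diff[OF g(1) M B car(1,2)]
        by (simp add: ax_def)
      moreover have "k x = (g x \<ominus>\<^bsub>B\<^esub> g (s (\<pi> x))) \<oplus>\<^bsub>B\<^esub> b (s (\<pi> x))"
        using car(1) carB by (simp add: k_def compose_eq h(2)[OF x] d_def a_minus_def B.M.a_ac)
      ultimately have kx: "k x = b (ax x) \<oplus>\<^bsub>B\<^esub> b (s (\<pi> x))"
        by simp
      have "lincomb B b (rx x) = \<zero>\<^bsub>B\<^esub>"
        using rel x by blast
      then have "b x \<oplus>\<^bsub>B\<^esub> (\<ominus>\<^bsub>B\<^esub> b (s (\<pi> x)) \<oplus>\<^bsub>B\<^esub> \<ominus>\<^bsub>B\<^esub> b (ax x)) = \<zero>\<^bsub>B\<^esub>"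
        using carB by (simp add: rx_def m1)
      then have "b x \<ominus>\<^bsub>B\<^esub> (b (ax x) \<oplus>\<^bsub>B\<^esub> b (s (\<pi> x))) = \<zero>\<^bsub>B\<^esub>"
        using carB by (simp add: a_minus_def B.M.minus_add B.M.a_ac)
      then have "b x = b (ax x) \<oplus>\<^bsub>B\<^esub> b (s (\<pi> x))"
        using carB B.minus_eq_zero_iff by simp
      with kx show ?thesis by simp
    qed
    ultimately show ?thesis by blast
  qed
  moreover have "finite ?E"
    using EK(1) EC(1) X(1) by simp
  ultimately show "\<exists>E. controls R B M X E"
      unfolding controls_def
    using E by (intro exI[of _ ?E]) simp
qed

text \<open>The values of a solution on basis vectors already define a homomorphism. One relation
  per \<open>y\<close>, expressing it through the basis, forces agreement at
  \<open>y\<close>.\<close>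

lemma rel_stationary_rfree:
  assumes R: "ring R" and B: "right_module R B"
  shows "rel_stationary R B (rfree R X)"
proof (rule rel_stationaryI)
  let ?P = "rfree R X"
  have P: "right_module R ?P"
    by (rule right_module_rfree[OF R])
  interpret P: right_module R ?P by (rule P)
  interpret B: right_module R B by (rule B)
  fix Y assume Y: "finite Y" "Y \<subseteq> carrier ?P"
  have "\<forall>y\<in>Y. \<exists>l. set l \<subseteq> X \<times> carrier R \<and> lincomb ?P (runit R X) l = y"
  proof
    fix y assume "y \<in> Y"
    then have "y \<in> carrier ?P" using Y(2) by blast
    then obtain l where "set l \<subseteq> (X \<inter> X) \<times> carrier R" "y = lincomb ?P (runit R X) l"
      by (rule rfree_lincomb[OF R, of _ _ X]) auto
    then show "\<exists>l. set l \<subseteq> X \<times> carrier R \<and> lincomb ?P (runit R X) l = y"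
      by auto
  qed
  from bchoice[OF this] obtain L
    where "\<forall>y\<in>Y. set (L y) \<subseteq> X \<times> carrier R \<and> lincomb ?P (runit R X) (L y) = y" ..
  then have L: "set (L y) \<subseteq> X \<times> carrier R" "lincomb ?P (runit R X) (L y) = y" if "y \<in> Y" for y
    using that by simp_all
  define r where "r y = (y, \<ominus>\<^bsub>R\<^esub> \<one>\<^bsub>R\<^esub>) # map (map_prod (runit R X) id) (L y)" for y
  have "r y \<in> module_relations R ?P" if y: "y \<in> Y" for y
  proof -
    have "y \<in> carrier ?P" "set (map (map_prod (runit R X) id) (L y)) \<subseteq> carrier ?P \<times> carrier R"
      using y Y(2) L(1)[OF y] by (auto simp: runit_closed[OF R])
    then show ?thesis
      using L(2)[OF y] by (simp add: module_relations_def r_def P.rsmult_minus_one P.M.l_neg)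
  qed
  moreover have "\<exists>f\<in>rhom R ?P B. \<forall>y\<in>Y. f y = b y"
    if b: "b \<in> carrier ?P \<rightarrow> carrier B" and rel: "\<forall>l\<in>r ` Y. lincomb B b l = \<zero>\<^bsub>B\<^esub>" for b
  proof -
    have bu: "b (runit R X x) \<in> carrier B" for x
      by (rule funcset_mem[OF b runit_closed[OF R]])
    define f where "f = free_ext R X B (\<lambda>x. b (runit R X x))"
    have f: "f \<in> rhom R ?P B"
      unfolding f_def by (rule free_ext_rhom[OF B bu])
    have fu: "f (runit R X x) = b (runit R X x)" if "x \<in> X" for x
      unfolding f_def by (rule free_ext_runit[OF B bu that])
    have "f y = b y" if y: "y \<in> Y" for y
    proof -
      let ?c = "lincomb B (\<lambda>x. b (runit R X x)) (L y)"
      have "f y = f (lincomb ?P (runit R X) (L y))"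
        by (simp add: L(2)[OF y])
      also have "\<dots> = lincomb B (\<lambda>x. f (runit R X x)) (L y)"
        by (rule rhom_rfree_lincomb[OF R B f L(1)[OF y]])
      also have "\<dots> = ?c"
        by (rule lincomb_cong) (use L(1)[OF y] fu in auto)
      finally have fy: "f y = ?c" .
      have by': "b y \<in> carrier B"
        by (rule funcset_mem[OF b]) (use y Y(2) in blast)
      have c: "?c \<in> carrier B"
        by (rule lincomb_closed[OF B L(1)[OF y] bu])
      have "\<ominus>\<^bsub>B\<^esub> b y \<oplus>\<^bsub>B\<^esub> ?c = \<zero>\<^bsub>B\<^esub>"
        using rel y by' by (auto simp: r_def B.rsmult_minus_one)
      then have "?c \<ominus>\<^bsub>B\<^esub> b y = \<zero>\<^bsub>B\<^esub>"
        using c by' by (simp add: a_minus_def B.M.a_comm)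
      then show ?thesis
        using fy c by' by (simp add: B.minus_eq_zero_iff)
    qed
    with f show ?thesis by blast
  qed
  ultimately show "\<exists>E. controls R B ?P Y E"
      unfolding controls_def
    using Y(1) by (intro exI[of _ "r ` Y"]) auto
qed

section \<open>Direct summands and projective modules\<close>

lemma riso_retract:
  assumes "right_module R M" "risomorphic R M N"
  obtains i p where "i \<in> rhom R M N" "p \<in> rhom R N M"
    "\<And>x. x \<in> carrier M \<Longrightarrow> p (i x) = x" "\<And>y. y \<in> carrier N \<Longrightarrow> i (p y) = y"
proof -
  obtain f where f: "f \<in> riso R M N"
    using assms(2) unfolding risomorphic_def by blast
  obtain g where "g \<in> riso R N M" "\<And>x. x \<in> carrier M \<Longrightarrow> g (f x) = x"
    "\<And>y. y \<in> carrier N \<Longrightarrow> f (g y) = y"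
    by (fact riso_inverse[OF f assms(1)])
  with f show thesis
    by (intro that[of f g]) (simp_all add: riso_def)
qed

lemma direct_summand_retract:
  assumes M: "right_module R M" and N: "right_module R N"
    and D: "direct_summand R D M" and iso: "risomorphic R N (M\<lparr>carrier := D\<rparr>)"
  obtains i p where "i \<in> rhom R N M" "p \<in> rhom R M N" "\<And>x. x \<in> carrier N \<Longrightarrow> p (i x) = x"
proof -
  interpret M: right_module R M by fact
  obtain E where DM: "rsubmodule R D M" and EM: "rsubmodule R E M"
    and DE: "D \<inter> E = {\<zero>\<^bsub>M\<^esub>}" "D <+>\<^bsub>M\<^esub> E = carrier M"
    using D unfolding direct_summand_def by blast
  note D' = rsubmoduleD[OF DM] and E' = rsubmoduleD[OF EM]
  have car: "x \<in> D \<Longrightarrow> x \<in> carrier M" "x \<in> E \<Longrightarrow> x \<in> carrier M" for x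
    using D'(1) E'(1) by blast+
  let ?D = "M\<lparr>carrier := D\<rparr>"
  have Dmod: "right_module R ?D"
    by (rule right_module_submodule[OF M DM])
  \<comment> \<open>Graph of the projection onto \<open>D\<close> along \<open>E\<close>. It is
    single-valued at zero since \<open>d + e = 0\<close> puts \<open>d = -e\<close> into both
    summands.\<close>
  define G where "G = (\<lambda>(d, e). (d \<oplus>\<^bsub>M\<^esub> e, d)) ` (D \<times> E)"
  have GI: "(d \<oplus>\<^bsub>M\<^esub> e, d) \<in> G" if "d \<in> D" "e \<in> E" for d e
    unfolding G_def using that by (intro image_eqI[of _ _ "(d, e)"]) auto
  have GE: thesis if "(x, y) \<in> G" "\<And>e. y \<in> D \<Longrightarrow> e \<in> E \<Longrightarrow> x = y \<oplus>\<^bsub>M\<^esub> e \<Longrightarrow> thesis" for x y thesis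
    using that by (auto simp: G_def)
  have "lin_graph R M ?D G"
  proof (rule lin_graphI)
    fix x d assume "(x, d) \<in> G"
    then obtain e where e: "d \<in> D" "e \<in> E" "x = d \<oplus>\<^bsub>M\<^esub> e" by (rule GE)
    then show "x \<in> carrier M \<and> d \<in> carrier ?D"
      by (simp add: car)
    show "(x \<star>\<^bsub>M\<^esub> a, d \<star>\<^bsub>?D\<^esub> a) \<in> G" if "a \<in> carrier R" for a
      using GI[OF D'(4)[OF e(1) that] E'(4)[OF e(2) that]] e that
      by (simp add: M.rsmult_l_distr car)
    fix x' d' assume "(x', d') \<in> G"
    then obtain e' where e': "d' \<in> D" "e' \<in> E" "x' = d' \<oplus>\<^bsub>M\<^esub> e'" by (rule GE)
    show "(x \<oplus>\<^bsub>M\<^esub> x', d \<oplus>\<^bsub>?D\<^esub> d') \<in> G"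
      using GI[OF D'(3)[OF e(1) e'(1)] E'(3)[OF e(2) e'(2)]] e e'
      by (simp add: M.M.a_ac car)
  next
    fix d assume "(\<zero>\<^bsub>M\<^esub>, d) \<in> G"
    then obtain e where e: "d \<in> D" "e \<in> E" "\<zero>\<^bsub>M\<^esub> = d \<oplus>\<^bsub>M\<^esub> e" by (rule GE)
    then have "\<ominus>\<^bsub>M\<^esub> e = d"
      using M.M.minus_equality[of d e] by (simp add: car)
    then have "d \<in> D \<inter> E"
      using e(1) E'(5)[OF e(2)] by simp
    then show "d = \<zero>\<^bsub>?D\<^esub>"
      by (simp add: DE(1))
  qed
  from rhom_of_lin_graph[OF M Dmod this] obtain q
    where q: "q \<in> rhom R (M\<lparr>carrier := Domain G\<rparr>) ?D" "\<And>x b. (x, b) \<in> G \<Longrightarrow> q x = b"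
    by blast
  have "Domain G = D <+>\<^bsub>M\<^esub> E"
    by (force simp: G_def set_add_def set_mult_def)
  with q(1) have qh: "q \<in> rhom R M ?D"
    by (simp add: DE(2))
  have qD: "q d = d" if "d \<in> D" for d
    using q(2)[OF GI[OF that E'(2)]] that by (simp add: car)
  obtain i0 p0 where ip: "i0 \<in> rhom R N ?D" "p0 \<in> rhom R ?D N" "\<And>x. x \<in> carrier N \<Longrightarrow> p0 (i0 x) = x"
    "\<And>y. y \<in> carrier ?D \<Longrightarrow> i0 (p0 y) = y"
    by (fact riso_retract[OF N iso])
  define i where "i = compose (carrier N) (\<lambda>x\<in>D. x) i0"
  define p where "p = compose (carrier M) p0 q"
  have "i \<in> rhom R N M"
    unfolding i_def by (rule rhom_compose[OF ip(1) rhom_inclusion[OF DM] N])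
  moreover have "p \<in> rhom R M N"
    unfolding p_def by (rule rhom_compose[OF qh ip(2) M])
  moreover have "p (i x) = x" if "x \<in> carrier N" for x
    using rhomD(1)[OF ip(1) that] ip(3)[OF that] that
    by (simp add: p_def i_def compose_eq qD car)
  ultimately show thesis by (rule that)
qed

lemma Add_R_retract:
  fixes P :: "('r, 'm) rmodule"
  assumes "ring R" "P \<in> Add_R R"
  obtains i and X :: "'m set" and p where "i \<in> rhom R P (rfree R X)" "p \<in> rhom R (rfree R X) P"
    "\<And>x. x \<in> carrier P \<Longrightarrow> p (i x) = x"
proof -
  obtain X :: "'m set" and D where P: "right_module R P" and D: "direct_summand R D (rfree R X)"
    "risomorphic R P ((rfree R X)\<lparr>carrier := D\<rparr>)"
    using assms(2) unfolding Add_R_def rmods_def by blast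
  obtain i p where "i \<in> rhom R P (rfree R X)" "p \<in> rhom R (rfree R X) P"
    "\<And>x. x \<in> carrier P \<Longrightarrow> p (i x) = x"
    by (fact direct_summand_retract[OF right_module_rfree[OF assms(1)] P D])
  then show thesis by (rule that)
qed

lemma rel_stationary_Add_R:
  fixes P :: "('r, 'm) rmodule"
  assumes R: "ring R" and P: "P \<in> Add_R R" and B: "right_module R B"
  shows "rel_stationary R B P"
proof -
  have Pm: "right_module R P"
    using P by (simp add: Add_R_def rmods_def)
  obtain i and X :: "'m set" and p where "i \<in> rhom R P (rfree R X)" "p \<in> rhom R (rfree R X) P"
    "\<And>x. x \<in> carrier P \<Longrightarrow> p (i x) = x"
    by (fact Add_R_retract[OF R P])
  then show ?thesis
    by (rule rel_stationary_retract[OF right_module_rfree[OF R] Pm rel_stationary_rfree[OF R B]])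
qed

text \<open>Projectivity of a free module: preimages are chosen for the images of the basis vectors
  only, and both maps agree because they agree on the basis.\<close>

lemma lift_free_ext:
  assumes R: "ring R" and M: "right_module R M" and C: "right_module R C"
    and \<pi>: "\<pi> \<in> rhom R M C" and surj: "\<pi> ` carrier M = carrier C"
    and p: "p \<in> rhom R (rfree R X) C"
  obtains q where "q \<in> rhom R (rfree R X) M" "\<And>e. e \<in> carrier (rfree R X) \<Longrightarrow> \<pi> (q e) = p e"
proof -
  have "\<exists>y. y \<in> carrier M \<and> \<pi> y = p (runit R X x)" for x
  proof -
    have "p (runit R X x) \<in> \<pi> ` carrier M"
      unfolding surj by (rule rhomD(1)[OF p runit_closed[OF R]])
    then show ?thesis by auto
  qed
  then have "\<forall>x. \<exists>y. y \<in> carrier M \<and> \<pi> y = p (runit R X x)" ..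
  from choice[OF this] obtain c where "\<forall>x. c x \<in> carrier M \<and> \<pi> (c x) = p (runit R X x)" ..
  then have c: "c x \<in> carrier M" "\<pi> (c x) = p (runit R X x)" for x
    by simp_all
  define q where "q = free_ext R X M c"
  have q: "q \<in> rhom R (rfree R X) M"
    unfolding q_def by (rule free_ext_rhom[OF M c(1)])
  have "compose (carrier (rfree R X)) \<pi> q e = p e" if "e \<in> carrier (rfree R X)" for e
  proof (rule rhom_rfree_eqI[OF R C _ p _ that])
    show "compose (carrier (rfree R X)) \<pi> q \<in> rhom R (rfree R X) C"
      by (rule rhom_compose[OF q \<pi> right_module_rfree[OF R]])
    fix x assume "x \<in> X"
    then have "q (runit R X x) = c x"
      unfolding q_def by (rule free_ext_runit[OF M c(1)])
    then show "compose (carrier (rfree R X)) \<pi> q (runit R X x) = p (runit R X x)"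
      by (simp add: compose_eq runit_closed[OF R] c(2))
  qed
  then have "\<pi> (q e) = p e" if "e \<in> carrier (rfree R X)" for e
    using that by (simp add: compose_eq)
  with q show thesis by (rule that)
qed

text \<open>A projective quotient splits off. The endomorphism \<open>t\<close>, which goes down by
  \<open>\<pi>\<close> and back by a lift, satisfies \<open>\<pi> (t x) = \<pi> x\<close> and kills
  \<open>K\<close>; hence \<open>x - t x\<close> defines a retraction \<open>r\<close> of
  \<open>M\<close> onto \<open>K\<close>, and \<open>f\<close> after \<open>r\<close> is the
  extension.\<close>

lemma hom_extends_Add_R:
  fixes P :: "('r, 'm) rmodule"
  assumes R: "ring R" and M: "right_module R M" and P: "P \<in> Add_R R" and B: "right_module R B"
    and \<pi>: "\<pi> \<in> rhom R M P" and surj: "\<pi> ` carrier M = carrier P"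
    and K_def: "K = {x \<in> carrier M. \<pi> x = \<zero>\<^bsub>P\<^esub>}"
  shows "hom_extends R M K B"
  unfolding hom_extends_def
proof
  have Pm: "right_module R P"
    using P by (simp add: Add_R_def rmods_def)
  interpret M: right_module R M by fact
  interpret P: right_module R P by (rule Pm)
  obtain i and X :: "'m set" and p where ip: "i \<in> rhom R P (rfree R X)" "p \<in> rhom R (rfree R X) P"
    "\<And>x. x \<in> carrier P \<Longrightarrow> p (i x) = x"
    by (fact Add_R_retract[OF R P])
  obtain q where q: "q \<in> rhom R (rfree R X) M"
    "\<And>e. e \<in> carrier (rfree R X) \<Longrightarrow> \<pi> (q e) = p e"
    by (fact lift_free_ext[OF R M Pm \<pi> surj ip(2)])
  have K: "rsubmodule R K M"
    unfolding K_def by (rule rsubmodule_kernel[OF \<pi> M Pm])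
  have \<pi>c: "\<pi> x \<in> carrier P" if "x \<in> carrier M" for x
    using rhomD(1)[OF \<pi> that] .
  define t where "t x = q (i (\<pi> x))" for x
  have tc: "t x \<in> carrier M" "\<pi> (t x) = \<pi> x" if "x \<in> carrier M" for x
    using rhomD(1)[OF ip(1) \<pi>c[OF that]] rhomD(1)[OF q(1)] q(2) ip(3)[OF \<pi>c[OF that]]
    by (simp_all add: t_def)
  have tadd: "t (x \<oplus>\<^bsub>M\<^esub> y) = t x \<oplus>\<^bsub>M\<^esub> t y" if "x \<in> carrier M" "y \<in> carrier M" for x y
    using rhomD(1,2)[OF ip(1)] \<pi>c that by (simp add: t_def rhomD(2)[OF \<pi>] rhomD(2)[OF q(1)])
  have tsmult: "t (x \<star>\<^bsub>M\<^esub> a) = t x \<star>\<^bsub>M\<^esub> a" if "x \<in> carrier M" "a \<in> carrier R" for x a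
    using rhomD(1,3)[OF ip(1)] \<pi>c that by (simp add: t_def rhomD(3)[OF \<pi>] rhomD(3)[OF q(1)])
  define r where "r = (\<lambda>x\<in>carrier M. x \<ominus>\<^bsub>M\<^esub> t x)"
  have r: "r \<in> rhom R M (M\<lparr>carrier := K\<rparr>)"
  proof (rule rhomI)
    show "r \<in> carrier M \<rightarrow>\<^sub>E carrier (M\<lparr>carrier := K\<rparr>)"
      using \<pi>c by (auto simp: r_def K_def tc rhom_diff[OF \<pi> M Pm] P.minus_eq_zero_iff)
    show "r (x \<oplus>\<^bsub>M\<^esub> y) = r x \<oplus>\<^bsub>M\<lparr>carrier := K\<rparr>\<^esub> r y" if "x \<in> carrier M" "y \<in> carrier M" for x y
      using that tc(1) by (simp add: r_def tadd a_minus_def M.M.minus_add M.M.a_ac)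
    show "r (x \<star>\<^bsub>M\<^esub> a) = r x \<star>\<^bsub>M\<lparr>carrier := K\<rparr>\<^esub> a" if "x \<in> carrier M" "a \<in> carrier R" for x a
      using that tc(1) by (simp add: r_def tsmult a_minus_def M.rsmult_l_distr M.minus_rsmult)
  qed
  fix f assume f: "f \<in> rhom R (M\<lparr>carrier := K\<rparr>) B"
  have "compose (carrier M) f r x = f x" if "x \<in> K" for x
  proof -
    have x: "x \<in> carrier M" "\<pi> x = \<zero>\<^bsub>P\<^esub>"
      using that by (simp_all add: K_def)
    have "t x = \<zero>\<^bsub>M\<^esub>"
      by (simp add: t_def x(2) rhom_zero[OF ip(1) Pm right_module_rfree[OF R]]
          rhom_zero[OF q(1) right_module_rfree[OF R] M])
    then show ?thesis
      using x(1) by (simp add: compose_eq r_def a_minus_def)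
  qed
  then show "\<exists>g\<in>rhom R M B. \<forall>x\<in>K. g x = f x"
    using rhom_compose[OF r f M] by blast
qed

section \<open>Vanishing of \<open>Ext\<^sup>1\<close> and extension of homomorphisms\<close>

lemma free_cover_rhom:
  assumes "right_module R S"
  shows "free_cover R S \<in> rhom R (rfree R (carrier S)) S"
  unfolding free_cover_eq_free_ext by (rule free_ext_rhom[OF assms])

lemma free_cover_runit:
  assumes "right_module R S" "x \<in> carrier S"
  shows "free_cover R S (runit R (carrier S) x) = x"
  unfolding free_cover_eq_free_ext by (rule free_ext_runit[OF assms(1) _ assms(2)])

lemma syzygy_rsubmodule:
  assumes "right_module R S"
  shows "rsubmodule R (carrier (syzygy R S)) (rfree R (carrier S))"
proof -
  interpret right_module R S by fact
  show ?thesis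
    using rsubmodule_kernel[OF free_cover_rhom[OF assms] right_module_rfree[OF R.ring_axioms] assms]
    by (simp add: syzygy_def)
qed

lemma syzygy_eq: "syzygy R S = (rfree R (carrier S))\<lparr>carrier := carrier (syzygy R S)\<rparr>"
  by (simp add: syzygy_def)

lemma right_module_syzygy:
  assumes "right_module R S"
  shows "right_module R (syzygy R S)"
proof -
  interpret right_module R S by fact
  show ?thesis
    by (subst syzygy_eq)
      (rule right_module_submodule[OF right_module_rfree[OF R.ring_axioms] syzygy_rsubmodule[OF assms]])
qed

text \<open>If \<open>Ext\<^sup>1(S, B) = 0\<close>, a homomorphism on the first syzygy is a cocycle after composition with
\<open>P\<^sub>1 \<longrightarrow> P\<^sub>0\<close>, hence a coboundary.\<close>

lemma Ext1_trivial_imp_extends: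
  assumes S: "right_module R S" and B: "right_module R B" and triv: "trivial_group (Ext1 R S B)"
    and \<phi>: "\<phi> \<in> rhom R (syzygy R S) B"
  obtains g where "g \<in> rhom R (rfree R (carrier S)) B" "\<And>e. e \<in> carrier (syzygy R S) \<Longrightarrow> g e = \<phi> e"
proof -
  interpret S: right_module R S by fact
  interpret B: right_module R B by fact
  let ?K = "syzygy R S"
  let ?L = "syzygy R ?K"
  let ?P0 = "rfree R (carrier S)" and ?P1 = "rfree R (carrier ?K)" and ?P2 = "rfree R (carrier ?L)"
  let ?d1 = "free_cover R ?K" and ?d2 = "free_cover R ?L"
  have Km: "right_module R ?K" by (rule right_module_syzygy[OF S])
  have Lm: "right_module R ?L" by (rule right_module_syzygy[OF Km])
  have Pm: "right_module R (rfree R X)" for X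
    by (rule right_module_rfree[OF S.R.ring_axioms])
  define z where "z = compose (carrier ?P1) \<phi> ?d1"
  define Z where "Z = {f \<in> rhom R ?P1 B. compose (carrier ?P2) f ?d2 = (\<lambda>x\<in>carrier ?P2. \<zero>\<^bsub>B\<^esub>)}"
  define H where "H = {compose (carrier ?P1) g ?d1 | g. g \<in> rhom R ?P0 B}"
  define G where "G = (Hom_group R ?P1 B)\<lparr>carrier := Z\<rparr>"
  have Ext: "Ext1 R S B = G Mod H"
    by (simp add: Ext1_def Z_def H_def G_def Let_def)
  have zh: "z \<in> rhom R ?P1 B"
    unfolding z_def by (rule rhom_compose[OF free_cover_rhom[OF Km] \<phi> Pm])
  have "z (?d2 x) = \<zero>\<^bsub>B\<^esub>" if "x \<in> carrier ?P2" for x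
  proof -
    have "?d2 x \<in> carrier ?L"
      by (rule rhomD(1)[OF free_cover_rhom[OF Lm] that])
    then have "?d2 x \<in> carrier ?P1" "?d1 (?d2 x) = \<zero>\<^bsub>?K\<^esub>"
      by (simp_all add: syzygy_def[of R ?K])
    then show ?thesis
      by (simp add: z_def compose_eq rhom_zero[OF \<phi> Km B])
  qed
  then have "compose (carrier ?P2) z ?d2 = (\<lambda>x\<in>carrier ?P2. \<zero>\<^bsub>B\<^esub>)"
    by (intro extensionalityI[of _ "carrier ?P2"]) (simp_all add: compose_eq)
  with zh have "z \<in> Z"
    by (simp add: Z_def)
  then have "H #>\<^bsub>G\<^esub> z \<in> carrier (Ext1 R S B)"
    unfolding Ext FactGroup_def RCOSETS_def by (auto simp: G_def)
  then have coset: "H #>\<^bsub>G\<^esub> z = H"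
    using triv by (simp add: trivial_group_def Ext FactGroup_def)
  \<comment> \<open>The zero coboundary. Reading the equality of cosets at this element shows that
    \<open>o0\<close> plus \<open>z\<close>, which has the values of \<open>z\<close>, is a
    coboundary.\<close>
  define o0 where "o0 = compose (carrier ?P1) (\<lambda>x\<in>carrier ?P0. \<zero>\<^bsub>B\<^esub>) ?d1"
  have "o0 \<in> H"
    unfolding H_def o0_def using zero_rhom[OF Pm B] by blast
  then have "o0 \<otimes>\<^bsub>G\<^esub> z \<in> H #>\<^bsub>G\<^esub> z"
    unfolding r_coset_def by blast
  then have "o0 \<otimes>\<^bsub>G\<^esub> z \<in> H"
    by (simp only: coset)
  then obtain g where g: "g \<in> rhom R ?P0 B" and oz: "o0 \<otimes>\<^bsub>G\<^esub> z = compose (carrier ?P1) g ?d1"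
    unfolding H_def by blast
  have ozx: "(o0 \<otimes>\<^bsub>G\<^esub> z) x = z x" if "x \<in> carrier ?P1" for x
  proof -
    have "?d1 x \<in> carrier ?P0"
      using rhomD(1)[OF free_cover_rhom[OF Km] that] by (simp add: syzygy_def[of R S])
    then show ?thesis
      using that rhomD(1)[OF zh that] by (simp add: G_def Hom_group_def o0_def compose_eq)
  qed
  \<comment> \<open>Evaluation at the basis vector of \<open>e\<close> in the free module on the
    syzygy: the differential sends it to \<open>e\<close>, so the coboundary gives
    \<open>g e\<close> and the cocycle gives \<open>\<phi> e\<close>.\<close>
  have "g e = \<phi> e" if "e \<in> carrier ?K" for e
    using ozx[OF runit_closed[OF S.R.ring_axioms, of "carrier ?K" e], unfolded oz] that
    by (simp add: z_def compose_eq runit_closed[OF S.R.ring_axioms] free_cover_runit[OF Km])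
  with g show thesis by (rule that)
qed

text \<open>The lift \<open>q\<close> of the free cover maps the syzygy into \<open>K\<close>. By
  vanishing of Ext, \<open>f\<close> after \<open>q\<close> extends from the syzygy to a
  homomorphism \<open>g\<close> on the free module. Since \<open>M\<close> is the sum of
  \<open>K\<close> and the image of \<open>q\<close>, the rule sending \<open>x + q e\<close> to
  \<open>f x + g e\<close> defines the extension; it is well defined because \<open>f\<close> and
  \<open>g\<close> agree along the syzygy.\<close>

lemma hom_extends_perp:
  assumes R: "ring R" and M: "right_module R M" and S: "right_module R S" and B: "right_module R B"
    and triv: "trivial_group (Ext1 R S B)"
    and \<pi>: "\<pi> \<in> rhom R M S" and surj: "\<pi> ` carrier M = carrier S"
    and K_def: "K = {x \<in> carrier M. \<pi> x = \<zero>\<^bsub>S\<^esub>}"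
  shows "hom_extends R M K B"
  unfolding hom_extends_def
proof
  interpret M: right_module R M by fact
  interpret S: right_module R S by fact
  interpret B: right_module R B by fact
  let ?P = "rfree R (carrier S)" and ?Z = "syzygy R S"
  have Pm: "right_module R ?P"
    by (rule right_module_rfree[OF R])
  interpret P: right_module R ?P by (rule Pm)
  obtain q where q: "q \<in> rhom R ?P M" "\<And>e. e \<in> carrier ?P \<Longrightarrow> \<pi> (q e) = free_cover R S e"
    by (fact lift_free_ext[OF R M S \<pi> surj free_cover_rhom[OF S]])
  have K: "rsubmodule R K M"
    unfolding K_def by (rule rsubmodule_kernel[OF \<pi> M S])
  note K' = rsubmoduleD[OF K]
  have KM: "x \<in> carrier M" if "x \<in> K" for x
    using that by (simp add: K_def)
  have ZP: "e \<in> carrier ?P" "q e \<in> K" if "e \<in> carrier ?Z" for e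
    using that rhomD(1)[OF q(1)] q(2) by (simp_all add: syzygy_def K_def)
  let ?K = "M\<lparr>carrier := K\<rparr>"
  fix f assume f: "f \<in> rhom R ?K B"
  note f' = rhomD[OF f, simplified]
  have "restrict q (carrier ?Z) \<in> rhom R ?Z M"
    by (subst syzygy_eq) (rule rhom_restrict[OF q(1) syzygy_rsubmodule[OF S]])
  then have qZ: "restrict q (carrier ?Z) \<in> rhom R ?Z ?K"
    by (rule rhom_corestrict) (simp add: ZP(2))
  obtain g where g: "g \<in> rhom R ?P B"
    "\<And>e. e \<in> carrier ?Z \<Longrightarrow> g e = compose (carrier ?Z) f (restrict q (carrier ?Z)) e"
    by (fact Ext1_trivial_imp_extends[OF S B triv rhom_compose[OF qZ f right_module_syzygy[OF S]]])
  have gZ: "g e = f (q e)" if "e \<in> carrier ?Z" for e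
    using g(2)[OF that] that by (simp add: compose_eq)
  define G where "G = (\<lambda>(x, e). (x \<oplus>\<^bsub>M\<^esub> q e, f x \<oplus>\<^bsub>B\<^esub> g e)) ` (K \<times> carrier ?P)"
  have GI: "(x \<oplus>\<^bsub>M\<^esub> q e, f x \<oplus>\<^bsub>B\<^esub> g e) \<in> G" if "x \<in> K" "e \<in> carrier ?P" for x e
    unfolding G_def using that by (intro image_eqI[of _ _ "(x, e)"]) auto
  have GE: thesis if "(y, b) \<in> G"
    "\<And>x e. x \<in> K \<Longrightarrow> e \<in> carrier ?P \<Longrightarrow> y = x \<oplus>\<^bsub>M\<^esub> q e \<Longrightarrow> b = f x \<oplus>\<^bsub>B\<^esub> g e \<Longrightarrow> thesis"
    for y b thesis
    using that by (auto simp: G_def)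
  note qc = rhomD(1)[OF q(1)] and gc = rhomD(1)[OF g(1)]
  have "lin_graph R M B G"
  proof (rule lin_graphI)
    fix y b assume "(y, b) \<in> G"
    then obtain x e where 1: "x \<in> K" "e \<in> carrier ?P" "y = x \<oplus>\<^bsub>M\<^esub> q e" "b = f x \<oplus>\<^bsub>B\<^esub> g e"
      by (rule GE)
    then show "y \<in> carrier M \<and> b \<in> carrier B"
      by (simp add: KM f'(1) qc gc)
    show "(y \<star>\<^bsub>M\<^esub> a, b \<star>\<^bsub>B\<^esub> a) \<in> G" if a: "a \<in> carrier R" for a
      using GI[OF K'(4)[OF 1(1) a] P.rsmult_closed[OF 1(2) a]] 1 a
      by (simp add: f' rhomD(3)[OF q(1)] rhomD(3)[OF g(1)] M.rsmult_l_distr B.rsmult_l_distr KM qc gc)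
    fix y' b' assume "(y', b') \<in> G"
    then obtain x' e' where 2: "x' \<in> K" "e' \<in> carrier ?P" "y' = x' \<oplus>\<^bsub>M\<^esub> q e'" "b' = f x' \<oplus>\<^bsub>B\<^esub> g e'"
      by (rule GE)
    show "(y \<oplus>\<^bsub>M\<^esub> y', b \<oplus>\<^bsub>B\<^esub> b') \<in> G"
      using GI[OF K'(3)[OF 1(1) 2(1)] P.M.a_closed[OF 1(2) 2(2)]] 1 2
      by (simp add: f' rhomD(2)[OF q(1)] rhomD(2)[OF g(1)] M.M.a_ac B.M.a_ac KM qc gc)
  next
    fix b assume "(\<zero>\<^bsub>M\<^esub>, b) \<in> G"
    then obtain x e where 1: "x \<in> K" "e \<in> carrier ?P" "\<zero>\<^bsub>M\<^esub> = x \<oplus>\<^bsub>M\<^esub> q e" "b = f x \<oplus>\<^bsub>B\<^esub> g e"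
      by (rule GE)
    \<comment> \<open>Here \<open>q e = -x\<close> lies in \<open>K\<close>, so \<open>e\<close> is
      in the syzygy. There \<open>g e = f (q e)\<close>, which cancels \<open>f x\<close>.\<close>
    then have qe: "q e = \<ominus>\<^bsub>M\<^esub> x"
      using M.M.minus_equality[of "q e" x] M.M.a_comm[of x "q e"] by (simp add: KM qc)
    then have "free_cover R S e = \<zero>\<^bsub>S\<^esub>"
      using 1(1) K'(5)[OF 1(1)] q(2)[OF 1(2)] by (simp add: K_def)
    then have "e \<in> carrier ?Z"
      using 1(2) by (simp add: syzygy_def)
    then have "g e = f (\<ominus>\<^bsub>M\<^esub> x)"
      by (simp add: gZ qe)
    then have "b = f (x \<oplus>\<^bsub>M\<^esub> (\<ominus>\<^bsub>M\<^esub> x))"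
      using 1(1,4) K'(5)[OF 1(1)] by (simp add: f')
    then show "b = \<zero>\<^bsub>B\<^esub>"
      using 1(1) rhom_zero[OF f right_module_submodule[OF M K] B] by (simp add: KM M.M.r_neg)
  qed
  from rhom_of_lin_graph[OF M B this] obtain h
    where h: "h \<in> rhom R (M\<lparr>carrier := Domain G\<rparr>) B" "\<And>y b. (y, b) \<in> G \<Longrightarrow> h y = b"
    by blast
  have "Domain G = carrier M"
  proof (intro equalityI subsetI)
    fix y assume y: "y \<in> carrier M"
    \<comment> \<open>The basis vector belonging to the class of \<open>y\<close>: its image under
      \<open>q\<close> has the same class, so \<open>y - q e\<close> lies in
      \<open>K\<close>.\<close>
    define e where "e = runit R (carrier S) (\<pi> y)"
    have e: "e \<in> carrier ?P"
      unfolding e_def by (rule runit_closed[OF R])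
    have "\<pi> (q e) = \<pi> y"
      using q(2)[OF e] rhomD(1)[OF \<pi> y] by (simp add: e_def free_cover_runit[OF S])
    then have "y \<ominus>\<^bsub>M\<^esub> q e \<in> K"
      using y qc[OF e] rhomD(1)[OF \<pi> y]
      by (simp add: K_def rhom_diff[OF \<pi> M S] S.minus_eq_zero_iff)
    moreover have "(y \<ominus>\<^bsub>M\<^esub> q e) \<oplus>\<^bsub>M\<^esub> q e = y"
      using y qc[OF e] by (simp add: a_minus_def M.M.a_assoc M.M.l_neg)
    ultimately show "y \<in> Domain G"
      using GI[of "y \<ominus>\<^bsub>M\<^esub> q e" e] e by auto
  qed (auto elim!: GE simp: KM qc)
  with h(1) have "h \<in> rhom R M B" by simp
  moreover have "h x = f x" if "x \<in> K" for x
  proof -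
    have "q \<zero>\<^bsub>?P\<^esub> = \<zero>\<^bsub>M\<^esub>" "g \<zero>\<^bsub>?P\<^esub> = \<zero>\<^bsub>B\<^esub>"
      by (rule rhom_zero[OF q(1) Pm M], rule rhom_zero[OF g(1) Pm B])
    then show ?thesis
      using h(2)[OF GI[OF that P.M.zero_closed]] that by (simp add: KM f'(1))
  qed
  ultimately show "\<exists>g\<in>rhom R M B. \<forall>x\<in>K. g x = f x"
    by blast
qed

section \<open>Filtrations\<close>

text \<open>Only the chain is recorded here. What the factors contribute enters the lemmas as
  premises about each pair in \<open>covered_by\<close>.\<close>

locale submodule_filtration =
  fixes R :: "('r, 'z) ring_scheme" and M :: "('r, 'm) rmodule"
    and W :: "'k set" and r \<tau> and N :: "'k \<Rightarrow> 'm set"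
  assumes M: "right_module R M"
    and wo: "well_order_on W r" and \<tau>: "\<tau> \<in> W"
    and sub: "\<And>\<alpha>. \<alpha> \<in> W \<Longrightarrow> rsubmodule R (N \<alpha>) M"
    and mono: "\<And>\<alpha> \<beta>. (\<alpha>, \<beta>) \<in> r \<Longrightarrow> N \<alpha> \<subseteq> N \<beta>"
    and bottom: "\<And>\<alpha>. \<alpha> \<in> W \<Longrightarrow> underS r \<alpha> = {} \<Longrightarrow> N \<alpha> = {\<zero>\<^bsub>M\<^esub>}"
    and top: "N \<tau> = carrier M"
    and limit: "\<And>\<alpha>. \<alpha> \<in> W \<Longrightarrow> underS r \<alpha> \<noteq> {} \<Longrightarrow> \<nexists>\<beta>. covered_by r \<beta> \<alpha> \<Longrightarrow>
      N \<alpha> = (\<Union>\<beta>\<in>underS r \<alpha>. N \<beta>)"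
begin

lemma r_W: "(\<alpha>, \<beta>) \<in> r \<Longrightarrow> \<alpha> \<in> W \<and> \<beta> \<in> W"
  using wo by (auto simp: well_order_on_def order_on_defs)

lemma wf_r: "wf (r - Id)"
  using wo by (simp add: well_order_on_def)

lemma le_cases: "\<alpha> \<in> W \<Longrightarrow> \<beta> \<in> W \<Longrightarrow> (\<alpha>, \<beta>) \<in> r \<or> \<beta> \<in> underS r \<alpha>"
  using wo by (cases "\<alpha> = \<beta>") (auto simp: well_order_on_def order_on_defs total_on_def refl_on_def underS_def)

lemma underS_W: "\<alpha> \<in> underS r \<beta> \<Longrightarrow> \<alpha> \<in> W \<and> \<beta> \<in> W"
  using r_W by (auto simp: underS_def)

lemma mono_underS: "\<alpha> \<in> underS r \<beta> \<Longrightarrow> N \<alpha> \<subseteq> N \<beta>"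
  using mono by (auto simp: underS_def)

text \<open>Zorn's lemma replaces a transfinite recursion that would have to carry compatible
  choices of extensions; compatibility is the inclusion of graphs.\<close>

lemma hom_extends_level:
  assumes B: "right_module R B"
    and step: "\<And>\<alpha> \<beta>. covered_by r \<alpha> \<beta> \<Longrightarrow> hom_extends R (M\<lparr>carrier := N \<beta>\<rparr>) (N \<alpha>) B"
    and \<beta>: "\<beta> \<in> W"
  shows "hom_extends R M (N \<beta>) B"
  unfolding hom_extends_def
proof
  fix f assume f: "f \<in> rhom R (M\<lparr>carrier := N \<beta>\<rparr>) B"
  define G0 where "G0 = (\<lambda>x. (x, f x)) ` N \<beta>"
  have lin0: "lin_graph R M B G0"
    unfolding G0_def by (rule lin_graph_of_rhom[OF M B sub[OF \<beta>] f])
  have dom0: "Domain G0 = N \<beta>"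
    by (simp add: G0_def Domain_fst image_image)
  \<comment> \<open>The last condition makes every domain a union of levels. It survives unions of
    chains, and it allows the domain of a maximal graph to be identified with a level, so that the
    one-step hypothesis applies.\<close>
  define \<A> where "\<A> = {G. lin_graph R M B G \<and> G0 \<subseteq> G \<and>
      (\<forall>x\<in>Domain G. \<exists>\<delta>\<in>W. x \<in> N \<delta> \<and> N \<delta> \<subseteq> Domain G)}"
  have AI: "G \<in> \<A>" if "lin_graph R M B G" "G0 \<subseteq> G"
    "\<And>x. x \<in> Domain G \<Longrightarrow> \<exists>\<delta>\<in>W. x \<in> N \<delta> \<and> N \<delta> \<subseteq> Domain G" for G
    using that by (simp add: \<A>_def)
  have AD: "lin_graph R M B G" "G0 \<subseteq> G" if "G \<in> \<A>" for G
    using that by (simp_all add: \<A>_def)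
  have Adom: "\<exists>\<delta>\<in>W. x \<in> N \<delta> \<and> N \<delta> \<subseteq> Domain G" if "G \<in> \<A>" "x \<in> Domain G" for G x
    using that by (simp add: \<A>_def)
  have "\<exists>G\<in>\<A>. \<forall>X\<in>\<A>. G \<subseteq> X \<longrightarrow> X = G"
  proof (rule subset_Zorn_nonempty)
    have "G0 \<in> \<A>"
      by (rule AI[OF lin0 order_refl]) (use \<beta> in \<open>auto simp: dom0\<close>)
    then show "\<A> \<noteq> {}" by blast
  next
    fix \<C> assume ne: "\<C> \<noteq> {}" and "subset.chain \<A> \<C>"
    then have CA: "\<And>G. G \<in> \<C> \<Longrightarrow> G \<in> \<A>" and ch: "\<And>G H. G \<in> \<C> \<Longrightarrow> H \<in> \<C> \<Longrightarrow> G \<subseteq> H \<or> H \<subseteq> G"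
      by (auto simp: subset_chain_def)
    show "\<Union>\<C> \<in> \<A>"
    proof (rule AI)
      show "lin_graph R M B (\<Union>\<C>)"
      proof (rule lin_graphI)
        fix x b assume "(x, b) \<in> \<Union>\<C>"
        then obtain G where G: "G \<in> \<C>" "(x, b) \<in> G" by blast
        note lin = AD(1)[OF CA[OF G(1)], unfolded lin_graph_def]
        show "x \<in> carrier M \<and> b \<in> carrier B"
          using lin G(2) by blast
        show "(x \<star>\<^bsub>M\<^esub> a, b \<star>\<^bsub>B\<^esub> a) \<in> \<Union>\<C>" if "a \<in> carrier R" for a
          using lin G that by blast
        fix y c assume "(y, c) \<in> \<Union>\<C>"
        then obtain H where H: "H \<in> \<C>" "(y, c) \<in> H" by blast
        obtain K where K: "K \<in> \<C>" "(x, b) \<in> K" "(y, c) \<in> K"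
          using ch[OF G(1) H(1)] G H by blast
        have "(x \<oplus>\<^bsub>M\<^esub> y, b \<oplus>\<^bsub>B\<^esub> c) \<in> K"
          using AD(1)[OF CA[OF K(1)], unfolded lin_graph_def] K(2,3) by blast
        with K(1) show "(x \<oplus>\<^bsub>M\<^esub> y, b \<oplus>\<^bsub>B\<^esub> c) \<in> \<Union>\<C>" by blast
      next
        fix b assume "(\<zero>\<^bsub>M\<^esub>, b) \<in> \<Union>\<C>"
        then obtain G where G: "G \<in> \<C>" "(\<zero>\<^bsub>M\<^esub>, b) \<in> G" by blast
        then show "b = \<zero>\<^bsub>B\<^esub>"
          using AD(1)[OF CA[OF G(1)], unfolded lin_graph_def] by blast
      qed
      show "G0 \<subseteq> \<Union>\<C>"
        using ne AD(2)[OF CA] by blast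
      fix x assume "x \<in> Domain (\<Union>\<C>)"
      then obtain G where G: "G \<in> \<C>" "x \<in> Domain G" by blast
      from Adom[OF CA[OF G(1)] G(2)] obtain \<delta> where \<delta>: "\<delta> \<in> W" "x \<in> N \<delta>" "N \<delta> \<subseteq> Domain G"
        by blast
      have "Domain G \<subseteq> Domain (\<Union>\<C>)"
        using G(1) by (intro Domain_mono) blast
      with \<delta> show "\<exists>\<delta>\<in>W. x \<in> N \<delta> \<and> N \<delta> \<subseteq> Domain (\<Union>\<C>)"
        by (intro bexI[of _ \<delta>] conjI) auto
    qed
  qed
  then obtain G where G: "G \<in> \<A>" and max: "\<And>X. X \<in> \<A> \<Longrightarrow> G \<subseteq> X \<Longrightarrow> X = G"
    by blast
  obtain h where h: "h \<in> rhom R (M\<lparr>carrier := Domain G\<rparr>) B" "\<And>x b. (x, b) \<in> G \<Longrightarrow> h x = b"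
    by (fact rhom_of_lin_graph[OF M B AD(1)[OF G]])
  \<comment> \<open>A least level \<open>\<mu>\<close> not contained in the domain would be a
    successor: the zero level lies inside \<open>N \<beta>\<close>, and a limit level is the union
    of earlier ones, all contained in the domain.\<close>
  have dom: "N \<gamma> \<subseteq> Domain G" if "\<gamma> \<in> W" for \<gamma>
  proof (rule ccontr)
    assume "\<not> N \<gamma> \<subseteq> Domain G"
    with that have "\<gamma> \<in> {\<gamma> \<in> W. \<not> N \<gamma> \<subseteq> Domain G}" by simp
    then obtain \<mu> where \<mu>0: "\<mu> \<in> {\<gamma> \<in> W. \<not> N \<gamma> \<subseteq> Domain G}"
      "\<And>\<delta>. (\<delta>, \<mu>) \<in> r - Id \<Longrightarrow> \<delta> \<notin> {\<gamma> \<in> W. \<not> N \<gamma> \<subseteq> Domain G}"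
      by (rule wfE_min[OF wf_r]) blast
    then have \<mu>: "\<mu> \<in> W" "\<not> N \<mu> \<subseteq> Domain G"
      by simp_all
    have below: "N \<delta> \<subseteq> Domain G" if "\<delta> \<in> underS r \<mu>" for \<delta>
      using \<mu>0(2)[of \<delta>] that underS_W[OF that] by (auto simp: underS_def)
    have sub0: "N \<beta> \<subseteq> Domain G"
      using Domain_mono[OF AD(2)[OF G]] by (simp add: dom0)
    have "underS r \<mu> \<noteq> {}"
    proof
      assume "underS r \<mu> = {}"
      then have "N \<mu> = {\<zero>\<^bsub>M\<^esub>}"
        by (rule bottom[OF \<mu>(1)])
      with \<mu>(2) sub0 rsubmoduleD(2)[OF sub[OF \<beta>]] show False by auto
    qed
    then have "\<exists>\<delta>. covered_by r \<delta> \<mu>"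
      using limit[OF \<mu>(1)] \<mu>(2) below by (metis UN_least)
    then obtain \<delta> where \<delta>: "covered_by r \<delta> \<mu>" ..
    then have \<delta>S: "\<delta> \<in> underS r \<mu>" and \<delta>top: "\<And>\<gamma>. \<gamma> \<in> underS r \<mu> \<Longrightarrow> (\<gamma>, \<delta>) \<in> r"
      by (auto simp: covered_by_def)
    \<comment> \<open>Any level inside the domain lies strictly below \<open>\<mu>\<close>, hence at
      or below its predecessor \<open>\<delta>\<close>. The homomorphism is thus defined on exactly
      \<open>N \<delta>\<close> and extends to \<open>N \<mu>\<close>, contradicting
      maximality.\<close>
    have Dom: "Domain G = N \<delta>"
    proof
      show "N \<delta> \<subseteq> Domain G" by (rule below[OF \<delta>S])
      show "Domain G \<subseteq> N \<delta>"
      proof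
        fix x assume "x \<in> Domain G"
        from Adom[OF G this] obtain \<epsilon> where \<epsilon>: "\<epsilon> \<in> W" "x \<in> N \<epsilon>" "N \<epsilon> \<subseteq> Domain G" by blast
        have "(\<mu>, \<epsilon>) \<notin> r"
          using mono[of \<mu> \<epsilon>] \<mu>(2) \<epsilon>(3) by blast
        then have "(\<epsilon>, \<delta>) \<in> r"
          using le_cases[OF \<mu>(1) \<epsilon>(1)] \<delta>top by blast
        with \<epsilon>(2) mono show "x \<in> N \<delta>" by blast
      qed
    qed
    obtain g where g: "g \<in> rhom R (M\<lparr>carrier := N \<mu>\<rparr>) B" "\<And>x. x \<in> N \<delta> \<Longrightarrow> g x = h x"
      using step[OF \<delta>] h(1) by (auto simp: hom_extends_def Dom)
    define G' where "G' = (\<lambda>x. (x, g x)) ` N \<mu>"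
    have dom': "Domain G' = N \<mu>"
      by (simp add: G'_def Domain_fst image_image)
    have sub': "G \<subseteq> G'"
    proof (rule subrelI)
      fix x b assume xb: "(x, b) \<in> G"
      then have "x \<in> N \<delta>"
        unfolding Dom[symmetric] by blast
      then have "x \<in> N \<mu>" "b = g x"
        using mono_underS[OF \<delta>S] g(2) h(2)[OF xb] by auto
      then show "(x, b) \<in> G'"
        by (simp add: G'_def)
    qed
    have "G' \<in> \<A>"
    proof (rule AI)
      show "lin_graph R M B G'"
        unfolding G'_def by (rule lin_graph_of_rhom[OF M B sub[OF \<mu>(1)] g(1)])
      show "G0 \<subseteq> G'"
        using AD(2)[OF G] sub' by (rule subset_trans)
    qed (use \<mu>(1) in \<open>auto simp: dom'\<close>)
    from max[OF this sub'] dom' \<mu>(2) show False by simp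
  qed
  have "Domain G = carrier M"
  proof
    show "carrier M \<subseteq> Domain G"
      using dom[OF \<tau>] by (simp add: top)
    show "Domain G \<subseteq> carrier M"
      using AD(1)[OF G] by (auto simp: lin_graph_def)
  qed
  with h(1) have "h \<in> rhom R M B" by simp
  moreover have "h x = f x" if "x \<in> N \<beta>" for x
    by (rule h(2)) (use AD(2)[OF G] that in \<open>auto simp: G0_def\<close>)
  ultimately show "\<exists>g\<in>rhom R M B. \<forall>x\<in>N \<beta>. g x = f x"
    by blast
qed

end

section \<open>Stationarity along the filtration\<close>

lemma rsubmodule_of_submodule:
  assumes "rsubmodule R N M" "rsubmodule R K M" "K \<subseteq> N" "right_module R M"
  shows "rsubmodule R K (M\<lparr>carrier := N\<rparr>)"
  by (rule rsubmoduleI[OF right_module_submodule[OF assms(4,1)]])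
    (use assms(3) rsubmoduleD[OF assms(2)] in auto)

text \<open>Trades an isomorphism with the quotient for a surjection with kernel \<open>K\<close>,
  so that cosets no longer occur in the extension arguments.\<close>

lemma rquot_iso_surj:
  assumes M: "right_module R M" and K: "rsubmodule R K M" and C: "right_module R C"
    and iso: "risomorphic R (rquot M K) C"
  obtains \<pi> where "\<pi> \<in> rhom R M C" "\<pi> ` carrier M = carrier C" "K = {x \<in> carrier M. \<pi> x = \<zero>\<^bsub>C\<^esub>}"
proof -
  have Q: "right_module R (rquot M K)"
    by (rule right_module_rquot[OF M K])
  obtain i p where ip: "i \<in> rhom R (rquot M K) C" "p \<in> rhom R C (rquot M K)"
    "\<And>x. x \<in> carrier (rquot M K) \<Longrightarrow> p (i x) = x" "\<And>y. y \<in> carrier C \<Longrightarrow> i (p y) = y"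
    by (fact riso_retract[OF Q iso])
  define \<pi> where "\<pi> = compose (carrier M) i (qmap M K)"
  have \<pi>: "\<pi> \<in> rhom R M C"
    unfolding \<pi>_def by (rule rhom_compose[OF qmap_rhom[OF M K] ip(1) M])
  moreover have "\<pi> ` carrier M = carrier C"
  proof
    show "carrier C \<subseteq> \<pi> ` carrier M"
    proof
      fix y assume y: "y \<in> carrier C"
      have "p y \<in> qmap M K ` carrier M"
        unfolding qmap_image[OF M K] by (rule rhomD(1)[OF ip(2) y])
      then obtain x where x: "x \<in> carrier M" "p y = qmap M K x" by blast
      then have "\<pi> x = y"
        using ip(4)[OF y] by (simp add: \<pi>_def compose_eq)
      with x(1) show "y \<in> \<pi> ` carrier M" by blast
    qed
  qed (use rhomD(1)[OF \<pi>] in blast)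
  moreover have "\<pi> x = \<zero>\<^bsub>C\<^esub> \<longleftrightarrow> x \<in> K" if x: "x \<in> carrier M" for x
  proof -
    have "qmap M K x = p (\<pi> x)"
      using x ip(3)[OF rhomD(1)[OF qmap_rhom[OF M K] x]] by (simp add: \<pi>_def compose_eq)
    then have "\<pi> x = \<zero>\<^bsub>C\<^esub> \<Longrightarrow> qmap M K x = \<zero>\<^bsub>rquot M K\<^esub>"
      using rhom_zero[OF ip(2) C Q] by simp
    moreover have "qmap M K x = \<zero>\<^bsub>rquot M K\<^esub> \<Longrightarrow> \<pi> x = \<zero>\<^bsub>C\<^esub>"
      using x rhom_zero[OF ip(1) Q C] by (simp add: \<pi>_def compose_eq)
    ultimately show ?thesis
      using qmap_eq_zero[OF M K x] by blast
  qed
  then have "K = {x \<in> carrier M. \<pi> x = \<zero>\<^bsub>C\<^esub>}"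
    using rsubmoduleD(1)[OF K] by auto
  ultimately show thesis by (rule that)
qed

context submodule_filtration
begin

lemma rel_stationary_level:
  assumes B: "right_module R B"
    and ext: "\<And>\<alpha> \<beta>. covered_by r \<alpha> \<beta> \<Longrightarrow> hom_extends R (M\<lparr>carrier := N \<beta>\<rparr>) (N \<alpha>) B"
    and step: "\<And>\<alpha> \<beta>. covered_by r \<alpha> \<beta> \<Longrightarrow> rel_stationary R B (M\<lparr>carrier := N \<alpha>\<rparr>) \<Longrightarrow>
      rel_stationary R B (M\<lparr>carrier := N \<beta>\<rparr>)"
    and "\<alpha> \<in> W"
  shows "rel_stationary R B (M\<lparr>carrier := N \<alpha>\<rparr>)"
  using wf_r \<open>\<alpha> \<in> W\<close>
proof (induction \<alpha> rule: wf_induct_rule)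
  case (less \<alpha>)
  interpret M: right_module R M by (rule M)
  interpret B: right_module R B by (rule B)
  have IH: "rel_stationary R B (M\<lparr>carrier := N \<beta>\<rparr>)" if "\<beta> \<in> underS r \<alpha>" for \<beta>
    by (rule less.IH) (use that underS_W[OF that] in \<open>auto simp: underS_def\<close>)
  note sub\<alpha> = sub[OF less.prems]
  let ?A = "M\<lparr>carrier := N \<alpha>\<rparr>" and ?B = "\<lambda>\<beta>. M\<lparr>carrier := N \<beta>\<rparr>"
  consider (bot) "underS r \<alpha> = {}" | (suc) \<beta> where "covered_by r \<beta> \<alpha>"
    | (lim) "underS r \<alpha> \<noteq> {}" "\<nexists>\<beta>. covered_by r \<beta> \<alpha>"
    by blast
  then show ?case
  proof cases
    case bot
    have N0: "N \<alpha> = {\<zero>\<^bsub>M\<^esub>}"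
      by (rule bottom[OF less.prems bot])
    show ?thesis
    proof (rule rel_stationaryI)
      fix X assume "finite X" "X \<subseteq> carrier ?A"
      then have X: "x = \<zero>\<^bsub>M\<^esub>" if "x \<in> X" for x
        using that by (auto simp: N0)
      let ?z = "\<lambda>x\<in>carrier ?A. \<zero>\<^bsub>B\<^esub>"
      have z: "?z \<in> rhom R ?A B"
        by (rule zero_rhom[OF right_module_submodule[OF M sub\<alpha>] B])
      \<comment> \<open>Even on the zero module a relation is required: \<open>b\<close> is an
        arbitrary function, and \<open>b\<close> takes the value zero at zero only because the
        relation with coefficient one is imposed.\<close>
      have "\<exists>f\<in>rhom R ?A B. \<forall>x\<in>X. f x = b x"
        if "b \<in> carrier ?A \<rightarrow> carrier B"
          "lincomb B b [(\<zero>\<^bsub>M\<^esub>, \<one>\<^bsub>R\<^esub>)] = \<zero>\<^bsub>B\<^esub>" for b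
      proof -
        have "b \<zero>\<^bsub>M\<^esub> \<in> carrier B"
          by (rule funcset_mem[OF that(1)]) (simp add: N0)
        then have "b \<zero>\<^bsub>M\<^esub> = \<zero>\<^bsub>B\<^esub>"
          using that(2) by simp
        then have "\<forall>x\<in>X. ?z x = b x"
          using X by (auto simp: N0)
        with z show ?thesis by blast
      qed
      then show "\<exists>E. controls R B ?A X E"
      unfolding controls_def
        by (intro exI[of _ "{[(\<zero>\<^bsub>M\<^esub>, \<one>\<^bsub>R\<^esub>)]}"]) (simp add: module_relations_def N0)
    qed
  next
    case (suc \<beta>)
    then show ?thesis
      by (intro step[OF suc] IH) (simp add: covered_by_def)
  next
    case lim
    have Nlim: "N \<alpha> = (\<Union>\<beta>\<in>underS r \<alpha>. N \<beta>)"
      by (rule limit[OF less.prems lim])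
    show ?thesis
    proof (rule rel_stationaryI)
      fix X assume X: "finite X" "X \<subseteq> carrier ?A"
      have "\<exists>\<beta>\<in>underS r \<alpha>. X \<subseteq> N \<beta>"
        using X
      proof (induction X rule: finite_induct)
        case empty
        then show ?case using lim(1) by blast
      next
        case (insert x X)
        obtain \<beta> where \<beta>: "\<beta> \<in> underS r \<alpha>" "X \<subseteq> N \<beta>"
          using insert.IH insert.prems by auto
        obtain \<gamma> where \<gamma>: "\<gamma> \<in> underS r \<alpha>" "x \<in> N \<gamma>"
          using insert.prems by (auto simp: Nlim)
        have "(\<beta>, \<gamma>) \<in> r \<or> \<gamma> \<in> underS r \<beta>"
          using le_cases underS_W[OF \<beta>(1)] underS_W[OF \<gamma>(1)] by blast
        then have "N \<beta> \<subseteq> N \<gamma> \<or> N \<gamma> \<subseteq> N \<beta>"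
          using mono mono_underS by blast
        then show ?case
        proof
          assume "N \<beta> \<subseteq> N \<gamma>"
          with \<beta>(2) \<gamma> show ?case by (intro bexI[of _ \<gamma>]) auto
        next
          assume "N \<gamma> \<subseteq> N \<beta>"
          with \<beta> \<gamma>(2) show ?case by (intro bexI[of _ \<beta>]) auto
        qed
      qed
      then obtain \<beta> where \<beta>: "\<beta> \<in> underS r \<alpha>" "X \<subseteq> carrier (?B \<beta>)"
        by auto
      note sub\<beta> = sub[OF conjunct1[OF underS_W[OF \<beta>(1)]]]
      have N\<beta>\<alpha>: "N \<beta> \<subseteq> N \<alpha>"
        by (rule mono_underS[OF \<beta>(1)])
      obtain E where E: "finite E" "E \<subseteq> module_relations R (?B \<beta>)"
        "\<forall>b. b \<in> carrier (?B \<beta>) \<rightarrow> carrier B \<longrightarrow> (\<forall>l\<in>E. lincomb B b l = \<zero>\<^bsub>B\<^esub>) \<longrightarrow>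
          (\<exists>f\<in>rhom R (?B \<beta>) B. \<forall>x\<in>X. f x = b x)"
        by (rule rel_stationaryE[OF IH[OF \<beta>(1)] X(1) \<beta>(2)])
      have "E \<subseteq> module_relations R ?A"
      proof
        fix l assume "l \<in> E"
        then have "set l \<subseteq> N \<beta> \<times> carrier R" "lincomb M (\<lambda>x. x) l = \<zero>\<^bsub>M\<^esub>"
          using E(2) by (auto simp: module_relations_def)
        moreover have "N \<beta> \<times> carrier R \<subseteq> N \<alpha> \<times> carrier R"
          using N\<beta>\<alpha> by auto
        ultimately show "l \<in> module_relations R ?A"
          by (simp add: module_relations_def)
      qed
      moreover have "\<exists>f\<in>rhom R ?A B. \<forall>x\<in>X. f x = b x"
        if b: "b \<in> carrier ?A \<rightarrow> carrier B" "\<forall>l\<in>E. lincomb B b l = \<zero>\<^bsub>B\<^esub>" for b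
      proof -
        have "b \<in> carrier (?B \<beta>) \<rightarrow> carrier B"
          using N\<beta>\<alpha> by (intro funcsetI funcset_mem[OF b(1)]) auto
        with E(3) b(2) obtain f where f: "f \<in> rhom R (?B \<beta>) B" "\<forall>x\<in>X. f x = b x"
          by blast
        \<comment> \<open>The relations found in \<open>N \<beta>\<close> give a homomorphism on
          \<open>N \<beta>\<close> only. It is extended to all of \<open>M\<close> and then
          restricted to \<open>N \<alpha>\<close>.\<close>
        obtain g where g: "g \<in> rhom R M B" "\<forall>x\<in>N \<beta>. g x = f x"
          using hom_extends_level[OF B ext conjunct1[OF underS_W[OF \<beta>(1)]]] f(1)
          unfolding hom_extends_def by blast
        have "\<forall>x\<in>X. restrict g (N \<alpha>) x = b x"
        proof
          fix x assume x: "x \<in> X"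
          then have "x \<in> N \<beta>" using \<beta>(2) by auto
          with x f(2) g(2) N\<beta>\<alpha> show "restrict g (N \<alpha>) x = b x" by auto
        qed
        with rhom_restrict[OF g(1) sub\<alpha>] show ?thesis by blast
      qed
      ultimately show "\<exists>E. controls R B ?A X E"
      unfolding controls_def
        using E(1) by (intro exI[of _ E]) simp
    qed
  qed
qed

end

lemma rel_stationary_filtered:
  fixes M :: "('r, 'm) rmodule"
  assumes R: "ring R" and filt: "filtered TYPE('k) R (\<S> \<union> Add_R R) M"
    and \<S>: "\<S> \<subseteq> rmods R"
    and B: "right_module R B"
    and triv: "\<And>S. S \<in> \<S> \<Longrightarrow> trivial_group (Ext1 R S B)"
    and stat: "\<And>S. S \<in> \<S> \<Longrightarrow> rel_stationary R B S"
  shows "rel_stationary R B M"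
proof -
  have M: "right_module R M"
    using filt by (simp add: filtered_def)
  obtain W :: "'k set" and r \<tau> and N :: "'k \<Rightarrow> 'm set" where
    F: "well_order_on W r" "\<tau> \<in> W" "\<forall>\<alpha>\<in>W. rsubmodule R (N \<alpha>) M"
      "\<forall>\<alpha> \<beta>. (\<alpha>, \<beta>) \<in> r \<longrightarrow> N \<alpha> \<subseteq> N \<beta>"
      "\<forall>\<alpha>\<in>W. underS r \<alpha> = {} \<longrightarrow> N \<alpha> = {\<zero>\<^bsub>M\<^esub>}" "N \<tau> = carrier M"
      "\<forall>\<alpha>\<in>W. underS r \<alpha> \<noteq> {} \<and> \<not> (\<exists>\<beta>. covered_by r \<beta> \<alpha>) \<longrightarrow> N \<alpha> = (\<Union>\<beta>\<in>underS r \<alpha>. N \<beta>)"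
      "\<forall>\<alpha> \<beta>. covered_by r \<alpha> \<beta> \<longrightarrow>
          (\<exists>C\<in>\<S> \<union> Add_R R. risomorphic R (rquot (M\<lparr>carrier := N \<beta>\<rparr>) (N \<alpha>)) C)"
    using filt unfolding filtered_def by (elim conjE exE)
  interpret submodule_filtration R M W r \<tau> N
    by (rule submodule_filtration.intro) (use M F in \<open>simp_all\<close>)
  \<comment> \<open>Both properties of a successor step come from one surjection
    \<open>\<pi>\<close> onto the factor. The factor decides how homomorphisms extend: by vanishing
    Ext for members of \<open>\<S>\<close>, by splitting for members of
    \<open>Add_R R\<close>.\<close>
  have step: "hom_extends R (M\<lparr>carrier := N \<beta>\<rparr>) (N \<alpha>) B \<and>
      (rel_stationary R B (M\<lparr>carrier := N \<alpha>\<rparr>) \<longrightarrow> rel_stationary R B (M\<lparr>carrier := N \<beta>\<rparr>))"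
    if cov: "covered_by r \<alpha> \<beta>" for \<alpha> \<beta>
  proof -
    have \<alpha>\<beta>: "\<alpha> \<in> underS r \<beta>"
      using cov by (simp add: covered_by_def)
    then have sub\<alpha>: "rsubmodule R (N \<alpha>) M" and sub\<beta>: "rsubmodule R (N \<beta>) M"
      using underS_W[OF \<alpha>\<beta>] sub by simp_all
    let ?N = "M\<lparr>carrier := N \<beta>\<rparr>"
    have Nm: "right_module R ?N"
      by (rule right_module_submodule[OF M sub\<beta>])
    have sub\<alpha>\<beta>: "rsubmodule R (N \<alpha>) ?N"
      by (rule rsubmodule_of_submodule[OF sub\<beta> sub\<alpha> mono_underS[OF \<alpha>\<beta>] M])
    obtain C where C: "C \<in> \<S> \<union> Add_R R" "risomorphic R (rquot ?N (N \<alpha>)) C"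
      using F(8) cov by blast
    have Cm: "right_module R C"
      using C(1) \<S> by (auto simp: rmods_def Add_R_def)
    obtain \<pi> where \<pi>: "\<pi> \<in> rhom R ?N C" "\<pi> ` carrier ?N = carrier C"
      "N \<alpha> = {x \<in> carrier ?N. \<pi> x = \<zero>\<^bsub>C\<^esub>}"
      by (fact rquot_iso_surj[OF Nm sub\<alpha>\<beta> Cm C(2)])
    have ext: "hom_extends R ?N (N \<alpha>) B"
    proof (cases "C \<in> \<S>")
      case True
      show ?thesis
        by (rule hom_extends_perp[OF R Nm Cm B triv[OF True] \<pi>])
    next
      case False
      with C(1) have "C \<in> Add_R R" by simp
      then show ?thesis
        by (rule hom_extends_Add_R[OF R Nm _ B \<pi>])
    qed
    have statC: "rel_stationary R B C"
      using C(1) stat rel_stationary_Add_R[OF R _ B] by blast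
    have "rel_stationary R B ?N" if "rel_stationary R B (M\<lparr>carrier := N \<alpha>\<rparr>)"
      using rel_stationary_extension[OF Nm Cm B \<pi> _ statC ext] that by simp
    with ext show ?thesis by blast
  qed
  have "rel_stationary R B (M\<lparr>carrier := N \<tau>\<rparr>)"
    by (rule rel_stationary_level[OF B _ _ F(2)]) (use step in auto)
  then show ?thesis
    by (simp add: F(6))
qed

section \<open>Direct limits\<close>

locale module_system =
  fixes R :: "('r, 'z) ring_scheme" and I :: "'i set" and po
    and F :: "'i \<Rightarrow> ('r, 'f) rmodule" and u
  assumes sys: "direct_system R I po F u"
begin

abbreviation "rel \<equiv> dirlim_rel I po F u"
abbreviation "L \<equiv> dirlim I po F u"
abbreviation "can \<equiv> dirlim_map I po F u"

lemma po_I: "(\<alpha>, \<beta>) \<in> po \<Longrightarrow> \<alpha> \<in> I \<and> \<beta> \<in> I"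
  using sys by (auto simp: direct_system_def order_on_defs)

lemma po_refl: "\<alpha> \<in> I \<Longrightarrow> (\<alpha>, \<alpha>) \<in> po"
  using sys by (auto simp: direct_system_def order_on_defs refl_on_def)

lemma po_trans: "(\<alpha>, \<beta>) \<in> po \<Longrightarrow> (\<beta>, \<gamma>) \<in> po \<Longrightarrow> (\<alpha>, \<gamma>) \<in> po"
proof -
  have "trans po"
    using sys by (simp add: direct_system_def order_on_defs)
  then show "(\<alpha>, \<beta>) \<in> po \<Longrightarrow> (\<beta>, \<gamma>) \<in> po \<Longrightarrow> (\<alpha>, \<gamma>) \<in> po"
    by (rule transD)
qed

lemma directed:
  assumes "\<alpha> \<in> I" "\<beta> \<in> I"
  obtains \<gamma> where "(\<alpha>, \<gamma>) \<in> po" "(\<beta>, \<gamma>) \<in> po"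
  using sys assms unfolding direct_system_def by meson

lemma F_module: "\<alpha> \<in> I \<Longrightarrow> right_module R (F \<alpha>)"
  using sys by (simp add: direct_system_def)

lemma u_rhom: "(\<alpha>, \<beta>) \<in> po \<Longrightarrow> u \<beta> \<alpha> \<in> rhom R (F \<alpha>) (F \<beta>)"
  using sys by (simp add: direct_system_def)

lemma u_refl: "\<alpha> \<in> I \<Longrightarrow> x \<in> carrier (F \<alpha>) \<Longrightarrow> u \<alpha> \<alpha> x = x"
  using sys by (simp add: direct_system_def)

lemma u_trans:
  assumes "(\<alpha>, \<beta>) \<in> po" "(\<beta>, \<gamma>) \<in> po" "x \<in> carrier (F \<alpha>)"
  shows "u \<gamma> \<beta> (u \<beta> \<alpha> x) = u \<gamma> \<alpha> x"
proof -
  have "compose (carrier (F \<alpha>)) (u \<gamma> \<beta>) (u \<beta> \<alpha>) = u \<gamma> \<alpha>"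
    using sys assms(1,2) unfolding direct_system_def by meson
  then show ?thesis
    using assms(3) by (metis compose_eq)
qed

lemma relI:
  assumes "(\<alpha>, \<gamma>) \<in> po" "(\<beta>, \<gamma>) \<in> po" "x \<in> carrier (F \<alpha>)" "y \<in> carrier (F \<beta>)" "u \<gamma> \<alpha> x = u \<gamma> \<beta> y"
  shows "((\<alpha>, x), (\<beta>, y)) \<in> rel"
  using assms po_I[OF assms(1)] po_I[OF assms(2)] unfolding dirlim_rel_def by blast

lemma relE:
  assumes "((\<alpha>, x), (\<beta>, y)) \<in> rel"
  obtains \<gamma> where "(\<alpha>, \<gamma>) \<in> po" "(\<beta>, \<gamma>) \<in> po" "x \<in> carrier (F \<alpha>)" "y \<in> carrier (F \<beta>)" "u \<gamma> \<alpha> x = u \<gamma> \<beta> y"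
  using assms unfolding dirlim_rel_def by blast

lemma equiv_rel: "equiv (SIGMA \<alpha>:I. carrier (F \<alpha>)) rel"
proof (rule equivI)
  show "rel \<subseteq> (SIGMA \<alpha>:I. carrier (F \<alpha>)) \<times> (SIGMA \<alpha>:I. carrier (F \<alpha>))"
    by (auto simp: dirlim_rel_def)
  show "refl_on (SIGMA \<alpha>:I. carrier (F \<alpha>)) rel"
    by (auto simp: refl_on_def intro!: relI po_refl)
  show "sym rel"
  proof (rule symI)
    fix p q assume "(p, q) \<in> rel"
    then show "(q, p) \<in> rel"
      by (cases p, cases q) (auto elim!: relE intro: relI)
  qed
  show "trans rel"
  proof (rule transI)
    fix p q s assume 1: "(p, q) \<in> rel" "(q, s) \<in> rel"
    obtain \<alpha> x \<beta> y \<gamma> z where pqs: "p = (\<alpha>, x)" "q = (\<beta>, y)" "s = (\<gamma>, z)"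
      by (cases p, cases q, cases s)
    obtain \<delta> where \<delta>: "(\<alpha>, \<delta>) \<in> po" "(\<beta>, \<delta>) \<in> po" "x \<in> carrier (F \<alpha>)" "y \<in> carrier (F \<beta>)"
      "u \<delta> \<alpha> x = u \<delta> \<beta> y"
      using 1(1) unfolding pqs by (rule relE)
    obtain \<epsilon> where \<epsilon>: "(\<beta>, \<epsilon>) \<in> po" "(\<gamma>, \<epsilon>) \<in> po" "y \<in> carrier (F \<beta>)" "z \<in> carrier (F \<gamma>)"
      "u \<epsilon> \<beta> y = u \<epsilon> \<gamma> z"
      using 1(2) unfolding pqs by (rule relE)
    obtain \<mu> where \<mu>: "(\<delta>, \<mu>) \<in> po" "(\<epsilon>, \<mu>) \<in> po"
      by (rule directed[OF conjunct2[OF po_I[OF \<delta>(1)]] conjunct2[OF po_I[OF \<epsilon>(1)]]])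
    have "u \<mu> \<alpha> x = u \<mu> \<delta> (u \<delta> \<beta> y)"
      using u_trans[OF \<delta>(1) \<mu>(1) \<delta>(3)] \<delta>(5) by simp
    also have "\<dots> = u \<mu> \<epsilon> (u \<epsilon> \<gamma> z)"
      using u_trans[OF \<delta>(2) \<mu>(1) \<delta>(4)] u_trans[OF \<epsilon>(1) \<mu>(2) \<delta>(4)] \<epsilon>(5) by simp
    also have "\<dots> = u \<mu> \<gamma> z"
      by (rule u_trans[OF \<epsilon>(2) \<mu>(2) \<epsilon>(4)])
    finally show "(p, s) \<in> rel"
      unfolding pqs
      by (rule relI[OF po_trans[OF \<delta>(1) \<mu>(1)] po_trans[OF \<epsilon>(2) \<mu>(2)] \<delta>(3) \<epsilon>(4)])
  qed
qed

lemma can_eq_iff: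
  assumes "\<alpha> \<in> I" "x \<in> carrier (F \<alpha>)" "\<beta> \<in> I" "y \<in> carrier (F \<beta>)"
  shows "can \<alpha> x = can \<beta> y \<longleftrightarrow> ((\<alpha>, x), (\<beta>, y)) \<in> rel"
  using assms by (simp add: dirlim_map_def eq_equiv_class_iff[OF equiv_rel])

lemma mem_can:
  assumes "\<alpha> \<in> I" "x \<in> carrier (F \<alpha>)"
  shows "(\<beta>, y) \<in> can \<alpha> x \<longleftrightarrow> ((\<alpha>, x), (\<beta>, y)) \<in> rel"
  using assms by (simp add: dirlim_map_def)

lemma can_closed: "\<alpha> \<in> I \<Longrightarrow> x \<in> carrier (F \<alpha>) \<Longrightarrow> can \<alpha> x \<in> carrier L"
  by (simp add: dirlim_def dirlim_map_def quotientI)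

lemma can_cases:
  assumes "X \<in> carrier L"
  obtains \<alpha> x where "\<alpha> \<in> I" "x \<in> carrier (F \<alpha>)" "X = can \<alpha> x"
proof -
  have "X \<in> (SIGMA \<alpha>:I. carrier (F \<alpha>)) // rel"
    using assms by (simp add: dirlim_def)
  then obtain p where p: "p \<in> (SIGMA \<alpha>:I. carrier (F \<alpha>))" "X = rel `` {p}"
    by (rule quotientE)
  then show thesis
    by (cases p) (auto intro!: that simp: dirlim_map_def)
qed

lemma can_u:
  assumes "(\<alpha>, \<beta>) \<in> po" "x \<in> carrier (F \<alpha>)"
  shows "can \<beta> (u \<beta> \<alpha> x) = can \<alpha> x"
proof -
  have I: "\<alpha> \<in> I" "\<beta> \<in> I"
    using po_I[OF assms(1)] by simp_all
  have ux: "u \<beta> \<alpha> x \<in> carrier (F \<beta>)"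
    by (rule rhomD(1)[OF u_rhom[OF assms(1)] assms(2)])
  have "((\<beta>, u \<beta> \<alpha> x), (\<alpha>, x)) \<in> rel"
    by (rule relI[OF po_refl[OF I(2)] assms(1) ux assms(2) u_refl[OF I(2) ux]])
  then show ?thesis
    using can_eq_iff[OF I(2) ux I(1) assms(2)] by simp
qed

text \<open>The operations of \<open>dirlim\<close> are saturations of the set of all results
  obtained from representatives. If those results are all related to one of them, the saturation is
  its class.\<close>

lemma rel_Image_eq:
  assumes "\<alpha> \<in> I" "x \<in> carrier (F \<alpha>)" "(\<alpha>, x) \<in> S" "\<And>p. p \<in> S \<Longrightarrow> ((\<alpha>, x), p) \<in> rel"
  shows "rel `` S = can \<alpha> x"
proof -
  have "rel `` {p} = rel `` {(\<alpha>, x)}" if "p \<in> S" for p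
    by (rule equiv_class_eq[OF equiv_rel assms(4)[OF that], symmetric])
  then have "(\<Union>p\<in>S. rel `` {p}) = rel `` {(\<alpha>, x)}"
    by (intro UN_constant_eq[OF assms(3)] ballI)
  with Image_eq_UN[of rel S] have "rel `` S = rel `` {(\<alpha>, x)}"
    by (rule trans)
  then show ?thesis
    using assms(2) by (simp add: dirlim_map_def)
qed

lemma can_rhom:
  assumes \<alpha>: "\<alpha> \<in> I"
  shows "can \<alpha> \<in> rhom R (F \<alpha>) L"
proof (rule rhomI)
  show "can \<alpha> \<in> carrier (F \<alpha>) \<rightarrow>\<^sub>E carrier L"
  proof
    show "can \<alpha> x \<in> carrier L" if "x \<in> carrier (F \<alpha>)" for x
      by (rule can_closed[OF \<alpha> that])
  qed (simp add: dirlim_map_def)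
next
  interpret F: right_module R "F \<alpha>" by (rule F_module[OF \<alpha>])
  fix x y assume x: "x \<in> carrier (F \<alpha>)" and y: "y \<in> carrier (F \<alpha>)"
  let ?S = "{(\<gamma>, u \<gamma> \<alpha>' x' \<oplus>\<^bsub>F \<gamma>\<^esub> u \<gamma> \<beta> y') | \<alpha>' x' \<beta> y' \<gamma>.
    (\<alpha>', x') \<in> can \<alpha> x \<and> (\<beta>, y') \<in> can \<alpha> y \<and> (\<alpha>', \<gamma>) \<in> po \<and> (\<beta>, \<gamma>) \<in> po}"
  have "rel `` ?S = can \<alpha> (x \<oplus>\<^bsub>F \<alpha>\<^esub> y)"
  proof (rule rel_Image_eq[OF \<alpha>])
    show "x \<oplus>\<^bsub>F \<alpha>\<^esub> y \<in> carrier (F \<alpha>)"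
      using x y by simp
    have "((\<alpha>, z), (\<alpha>, z)) \<in> rel" if "z \<in> carrier (F \<alpha>)" for z
      by (rule relI[OF po_refl[OF \<alpha>] po_refl[OF \<alpha>] that that refl])
    then have "(\<alpha>, x) \<in> can \<alpha> x \<and> (\<alpha>, y) \<in> can \<alpha> y"
      using x y by (simp add: mem_can[OF \<alpha>])
    moreover have "(\<alpha>, x \<oplus>\<^bsub>F \<alpha>\<^esub> y) = (\<alpha>, u \<alpha> \<alpha> x \<oplus>\<^bsub>F \<alpha>\<^esub> u \<alpha> \<alpha> y)"
      using x y by (simp add: u_refl[OF \<alpha>])
    ultimately show "(\<alpha>, x \<oplus>\<^bsub>F \<alpha>\<^esub> y) \<in> ?S"
      using po_refl[OF \<alpha>] by blast
    fix p assume "p \<in> ?S"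
    then obtain \<alpha>' x' \<beta> y' \<gamma> where p: "p = (\<gamma>, u \<gamma> \<alpha>' x' \<oplus>\<^bsub>F \<gamma>\<^esub> u \<gamma> \<beta> y')"
      and x': "((\<alpha>, x), (\<alpha>', x')) \<in> rel" and y': "((\<alpha>, y), (\<beta>, y')) \<in> rel"
      and \<gamma>: "(\<alpha>', \<gamma>) \<in> po" "(\<beta>, \<gamma>) \<in> po"
      using mem_can[OF \<alpha> x] mem_can[OF \<alpha> y] by auto
    obtain \<delta> where \<delta>: "(\<alpha>, \<delta>) \<in> po" "(\<alpha>', \<delta>) \<in> po" "x' \<in> carrier (F \<alpha>')" "u \<delta> \<alpha> x = u \<delta> \<alpha>' x'"
      using x' by (rule relE)
    obtain \<epsilon> where \<epsilon>: "(\<alpha>, \<epsilon>) \<in> po" "(\<beta>, \<epsilon>) \<in> po" "y' \<in> carrier (F \<beta>)" "u \<epsilon> \<alpha> y = u \<epsilon> \<beta> y'"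
      using y' by (rule relE)
    \<comment> \<open>The witnesses \<open>\<delta>\<close> and \<open>\<epsilon>\<close> of the two
      equivalences and the index \<open>\<gamma>\<close> of the sum are unrelated. Above all three
      lies \<open>\<mu>\<close>, where both sums can be compared.\<close>
    obtain \<mu>0 where \<mu>0: "(\<delta>, \<mu>0) \<in> po" "(\<epsilon>, \<mu>0) \<in> po"
      by (rule directed[OF conjunct2[OF po_I[OF \<delta>(1)]] conjunct2[OF po_I[OF \<epsilon>(1)]]])
    obtain \<mu> where \<mu>: "(\<mu>0, \<mu>) \<in> po" "(\<gamma>, \<mu>) \<in> po"
      by (rule directed[OF conjunct2[OF po_I[OF \<mu>0(1)]] conjunct2[OF po_I[OF \<gamma>(1)]]])
    note \<delta>\<mu> = po_trans[OF \<mu>0(1) \<mu>(1)] and \<epsilon>\<mu> = po_trans[OF \<mu>0(2) \<mu>(1)]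
    have \<alpha>\<mu>: "(\<alpha>, \<mu>) \<in> po"
      by (rule po_trans[OF \<delta>(1) \<delta>\<mu>])
    have ux: "u \<mu> \<alpha> x = u \<mu> \<gamma> (u \<gamma> \<alpha>' x')"
      using u_trans[OF \<delta>(1) \<delta>\<mu> x] u_trans[OF \<delta>(2) \<delta>\<mu> \<delta>(3)] u_trans[OF \<gamma>(1) \<mu>(2) \<delta>(3)] \<delta>(4)
      by simp
    have uy: "u \<mu> \<alpha> y = u \<mu> \<gamma> (u \<gamma> \<beta> y')"
      using u_trans[OF \<epsilon>(1) \<epsilon>\<mu> y] u_trans[OF \<epsilon>(2) \<epsilon>\<mu> \<epsilon>(3)] u_trans[OF \<gamma>(2) \<mu>(2) \<epsilon>(3)] \<epsilon>(4)
      by simp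
    note c = rhomD(1)[OF u_rhom[OF \<gamma>(1)] \<delta>(3)] rhomD(1)[OF u_rhom[OF \<gamma>(2)] \<epsilon>(3)]
    interpret G: right_module R "F \<gamma>"
      by (rule F_module[OF conjunct2[OF po_I[OF \<gamma>(1)]]])
    show "((\<alpha>, x \<oplus>\<^bsub>F \<alpha>\<^esub> y), p) \<in> rel"
      unfolding p
    proof (rule relI[OF \<alpha>\<mu> \<mu>(2)])
      show "u \<mu> \<alpha> (x \<oplus>\<^bsub>F \<alpha>\<^esub> y) = u \<mu> \<gamma> (u \<gamma> \<alpha>' x' \<oplus>\<^bsub>F \<gamma>\<^esub> u \<gamma> \<beta> y')"
        by (simp add: rhomD(2)[OF u_rhom[OF \<alpha>\<mu>] x y] rhomD(2)[OF u_rhom[OF \<mu>(2)] c] ux uy)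
    qed (use x y c in simp_all)
  qed
  then show "can \<alpha> (x \<oplus>\<^bsub>F \<alpha>\<^esub> y) = can \<alpha> x \<oplus>\<^bsub>L\<^esub> can \<alpha> y"
    by (simp add: dirlim_def)
next
  interpret F: right_module R "F \<alpha>" by (rule F_module[OF \<alpha>])
  fix x a assume x: "x \<in> carrier (F \<alpha>)" and a: "a \<in> carrier R"
  let ?S = "{(\<beta>, y \<star>\<^bsub>F \<beta>\<^esub> a) | \<beta> y. (\<beta>, y) \<in> can \<alpha> x}"
  have "rel `` ?S = can \<alpha> (x \<star>\<^bsub>F \<alpha>\<^esub> a)"
  proof (rule rel_Image_eq[OF \<alpha>])
    show "x \<star>\<^bsub>F \<alpha>\<^esub> a \<in> carrier (F \<alpha>)"
      using x a by simp
    have "((\<alpha>, x), (\<alpha>, x)) \<in> rel"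
      by (rule relI[OF po_refl[OF \<alpha>] po_refl[OF \<alpha>] x x refl])
    then show "(\<alpha>, x \<star>\<^bsub>F \<alpha>\<^esub> a) \<in> ?S"
      using x by (auto simp: mem_can[OF \<alpha>])
    fix p assume "p \<in> ?S"
    then obtain \<beta> y where p: "p = (\<beta>, y \<star>\<^bsub>F \<beta>\<^esub> a)" and y: "((\<alpha>, x), (\<beta>, y)) \<in> rel"
      using mem_can[OF \<alpha> x] by auto
    obtain \<gamma> where \<gamma>: "(\<alpha>, \<gamma>) \<in> po" "(\<beta>, \<gamma>) \<in> po" "y \<in> carrier (F \<beta>)" "u \<gamma> \<alpha> x = u \<gamma> \<beta> y"
      using y by (rule relE)
    interpret G: right_module R "F \<beta>"
      by (rule F_module[OF conjunct1[OF po_I[OF \<gamma>(2)]]])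
    show "((\<alpha>, x \<star>\<^bsub>F \<alpha>\<^esub> a), p) \<in> rel"
      unfolding p
    proof (rule relI[OF \<gamma>(1,2)])
      show "u \<gamma> \<alpha> (x \<star>\<^bsub>F \<alpha>\<^esub> a) = u \<gamma> \<beta> (y \<star>\<^bsub>F \<beta>\<^esub> a)"
        by (simp add: rhomD(3)[OF u_rhom[OF \<gamma>(1)] x a] rhomD(3)[OF u_rhom[OF \<gamma>(2)] \<gamma>(3) a] \<gamma>(4))
    qed (use x a \<gamma>(3) in simp_all)
  qed
  then show "can \<alpha> (x \<star>\<^bsub>F \<alpha>\<^esub> a) = can \<alpha> x \<star>\<^bsub>L\<^esub> a"
    by (simp add: dirlim_def)
qed

lemma dirlim_finite_subset:
  assumes "finite X" "X \<subseteq> carrier L"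
  obtains \<alpha> where "\<alpha> \<in> I" "X \<subseteq> can \<alpha> ` carrier (F \<alpha>)"
proof -
  have "\<exists>\<alpha>\<in>I. X \<subseteq> can \<alpha> ` carrier (F \<alpha>)"
    using assms
  proof (induction X rule: finite_induct)
    case empty
    then show ?case
      using sys by (auto simp: direct_system_def)
  next
    case (insert x X)
    obtain \<alpha> where \<alpha>: "\<alpha> \<in> I" "X \<subseteq> can \<alpha> ` carrier (F \<alpha>)"
      using insert.IH insert.prems by auto
    have "x \<in> carrier L"
      using insert.prems by simp
    then obtain \<beta> y where \<beta>: "\<beta> \<in> I" "y \<in> carrier (F \<beta>)" "x = can \<beta> y"
      by (rule can_cases)
    obtain \<gamma> where \<gamma>: "(\<alpha>, \<gamma>) \<in> po" "(\<beta>, \<gamma>) \<in> po"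
      by (rule directed[OF \<alpha>(1) \<beta>(1)])
    have up: "can \<delta> z \<in> can \<gamma> ` carrier (F \<gamma>)" if "(\<delta>, \<gamma>) \<in> po" "z \<in> carrier (F \<delta>)" for \<delta> z
      unfolding can_u[OF that, symmetric]
      by (rule imageI) (rule rhomD(1)[OF u_rhom[OF that(1)] that(2)])
    have "insert x X \<subseteq> can \<gamma> ` carrier (F \<gamma>)"
    proof
      fix z assume "z \<in> insert x X"
      then consider "z = x" | "z \<in> can \<alpha> ` carrier (F \<alpha>)"
        using \<alpha>(2) by blast
      then show "z \<in> can \<gamma> ` carrier (F \<gamma>)"
      proof cases
        case 1
        then show ?thesis using up[OF \<gamma>(2) \<beta>(2)] \<beta>(3) by simp
      next
        case 2
        then show ?thesis using up[OF \<gamma>(1)] by auto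
      qed
    qed
    then show ?case
      using po_I[OF \<gamma>(1)] by blast
  qed
  then show thesis
    using that by blast
qed

text \<open>Recognition of a direct limit: a compatible family that is jointly surjective and whose
  kernels die at later indices. For injectivity, two classes are moved to a common index and the
  last condition is applied to the difference of their representatives.\<close>

lemma riso_dirlim:
  assumes M: "right_module R M"
    and c: "\<And>\<alpha>. \<alpha> \<in> I \<Longrightarrow> c \<alpha> \<in> rhom R (F \<alpha>) M"
    and compat: "\<And>\<alpha> \<beta> x. (\<alpha>, \<beta>) \<in> po \<Longrightarrow> x \<in> carrier (F \<alpha>) \<Longrightarrow> c \<beta> (u \<beta> \<alpha> x) = c \<alpha> x"
    and surj: "\<And>m. m \<in> carrier M \<Longrightarrow> \<exists>\<alpha>\<in>I. \<exists>x\<in>carrier (F \<alpha>). c \<alpha> x = m"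
    and ker: "\<And>\<alpha> x. \<alpha> \<in> I \<Longrightarrow> x \<in> carrier (F \<alpha>) \<Longrightarrow> c \<alpha> x = \<zero>\<^bsub>M\<^esub> \<Longrightarrow>
      \<exists>\<beta>. (\<alpha>, \<beta>) \<in> po \<and> u \<beta> \<alpha> x = \<zero>\<^bsub>F \<beta>\<^esub>"
  obtains \<phi> where "\<phi> \<in> riso R L M" "\<And>\<alpha> x. \<alpha> \<in> I \<Longrightarrow> x \<in> carrier (F \<alpha>) \<Longrightarrow> \<phi> (can \<alpha> x) = c \<alpha> x"
proof -
  interpret M: right_module R M by (rule M)
  have wd: "c \<alpha> x = c \<beta> y" if rel: "((\<alpha>, x), (\<beta>, y)) \<in> rel" for \<alpha> x \<beta> y
  proof -
    obtain \<gamma> where \<gamma>: "(\<alpha>, \<gamma>) \<in> po" "(\<beta>, \<gamma>) \<in> po" "x \<in> carrier (F \<alpha>)" "y \<in> carrier (F \<beta>)"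
      "u \<gamma> \<alpha> x = u \<gamma> \<beta> y"
      using rel by (rule relE)
    then show ?thesis
      using compat[OF \<gamma>(1,3)] compat[OF \<gamma>(2,4)] by simp
  qed
  define \<phi> where "\<phi> = (\<lambda>X\<in>carrier L. THE m. \<exists>(\<alpha>, x)\<in>X. m = c \<alpha> x)"
  have \<phi>: "\<phi> (can \<alpha> x) = c \<alpha> x" if \<alpha>: "\<alpha> \<in> I" and x: "x \<in> carrier (F \<alpha>)" for \<alpha> x
  proof -
    have "((\<alpha>, x), (\<alpha>, x)) \<in> rel"
      by (rule relI[OF po_refl[OF \<alpha>] po_refl[OF \<alpha>] x x refl])
    then have "(\<alpha>, x) \<in> can \<alpha> x"
      by (simp add: mem_can[OF \<alpha> x])
    then have "(THE m. \<exists>(\<alpha>', x')\<in>can \<alpha> x. m = c \<alpha>' x') = c \<alpha> x"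
    proof (intro the_equality bexI[of _ "(\<alpha>, x)"])
      fix m assume "\<exists>(\<alpha>', x')\<in>can \<alpha> x. m = c \<alpha>' x'"
      then obtain \<beta> y where "(\<beta>, y) \<in> can \<alpha> x" "m = c \<beta> y" by auto
      then show "m = c \<alpha> x"
        using wd[of \<alpha> x \<beta> y] by (simp add: mem_can[OF \<alpha> x])
    qed simp_all
    then show ?thesis
      by (simp add: \<phi>_def can_closed[OF \<alpha> x])
  qed
  have two: thesis if X: "X \<in> carrier L" and Y: "Y \<in> carrier L" and T:
    "\<And>\<gamma> x y. \<gamma> \<in> I \<Longrightarrow> x \<in> carrier (F \<gamma>) \<Longrightarrow> y \<in> carrier (F \<gamma>) \<Longrightarrow> X = can \<gamma> x \<Longrightarrow> Y = can \<gamma> y \<Longrightarrow> thesis"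
    for X Y thesis
  proof -
    obtain \<alpha> x where \<alpha>: "\<alpha> \<in> I" "x \<in> carrier (F \<alpha>)" "X = can \<alpha> x"
      using X by (rule can_cases)
    obtain \<beta> y where \<beta>: "\<beta> \<in> I" "y \<in> carrier (F \<beta>)" "Y = can \<beta> y"
      using Y by (rule can_cases)
    obtain \<gamma> where \<gamma>: "(\<alpha>, \<gamma>) \<in> po" "(\<beta>, \<gamma>) \<in> po"
      by (rule directed[OF \<alpha>(1) \<beta>(1)])
    show thesis
      by (rule T[of \<gamma> "u \<gamma> \<alpha> x" "u \<gamma> \<beta> y"])
        (simp_all add: po_I[OF \<gamma>(1)] rhomD(1)[OF u_rhom[OF \<gamma>(1)] \<alpha>(2)]
          rhomD(1)[OF u_rhom[OF \<gamma>(2)] \<beta>(2)] can_u[OF \<gamma>(1) \<alpha>(2)] can_u[OF \<gamma>(2) \<beta>(2)] \<alpha>(3) \<beta>(3))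
  qed
  have \<phi>h: "\<phi> \<in> rhom R L M"
  proof (rule rhomI)
    show "\<phi> \<in> carrier L \<rightarrow>\<^sub>E carrier M"
    proof
      fix X assume "X \<in> carrier L"
      then obtain \<alpha> x where "\<alpha> \<in> I" "x \<in> carrier (F \<alpha>)" "X = can \<alpha> x"
        by (rule can_cases)
      then show "\<phi> X \<in> carrier M"
        by (simp add: \<phi> rhomD(1)[OF c])
    qed (simp add: \<phi>_def)
  next
    fix X Y assume "X \<in> carrier L" "Y \<in> carrier L"
    then show "\<phi> (X \<oplus>\<^bsub>L\<^esub> Y) = \<phi> X \<oplus>\<^bsub>M\<^esub> \<phi> Y"
    proof (rule two)
      fix \<gamma> x y assume \<gamma>: "\<gamma> \<in> I" and x: "x \<in> carrier (F \<gamma>)" and y: "y \<in> carrier (F \<gamma>)"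
        and XY: "X = can \<gamma> x" "Y = can \<gamma> y"
      interpret F: right_module R "F \<gamma>" by (rule F_module[OF \<gamma>])
      show ?thesis
        using x y by (simp add: XY rhomD(2)[OF can_rhom[OF \<gamma>], symmetric] \<phi>[OF \<gamma>] rhomD(2)[OF c[OF \<gamma>]])
    qed
  next
    fix X a assume X: "X \<in> carrier L" and a: "a \<in> carrier R"
    obtain \<alpha> x where \<alpha>: "\<alpha> \<in> I" and x: "x \<in> carrier (F \<alpha>)" and X: "X = can \<alpha> x"
      using X by (rule can_cases)
    interpret F: right_module R "F \<alpha>" by (rule F_module[OF \<alpha>])
    show "\<phi> (X \<star>\<^bsub>L\<^esub> a) = \<phi> X \<star>\<^bsub>M\<^esub> a"
      using x a by (simp add: X rhomD(3)[OF can_rhom[OF \<alpha>], symmetric] \<phi>[OF \<alpha>] rhomD(3)[OF c[OF \<alpha>]])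
  qed
  moreover have "bij_betw \<phi> (carrier L) (carrier M)"
    unfolding bij_betw_def
  proof
    show "inj_on \<phi> (carrier L)"
    proof (rule inj_onI)
      fix X Y assume eq: "\<phi> X = \<phi> Y" and "X \<in> carrier L" "Y \<in> carrier L"
      from this(2,3) show "X = Y"
      proof (rule two)
        fix \<gamma> x y assume \<gamma>: "\<gamma> \<in> I" and x: "x \<in> carrier (F \<gamma>)" and y: "y \<in> carrier (F \<gamma>)"
          and XY: "X = can \<gamma> x" "Y = can \<gamma> y"
        interpret F: right_module R "F \<gamma>" by (rule F_module[OF \<gamma>])
        have xy: "x \<ominus>\<^bsub>F \<gamma>\<^esub> y \<in> carrier (F \<gamma>)"
          using x y by simp
        have "c \<gamma> x = c \<gamma> y"
          using eq x y by (simp add: XY \<phi>[OF \<gamma>])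
        then have "c \<gamma> (x \<ominus>\<^bsub>F \<gamma>\<^esub> y) = \<zero>\<^bsub>M\<^esub>"
          using rhomD(1)[OF c[OF \<gamma>] y]
          by (simp add: rhom_diff[OF c[OF \<gamma>] F_module[OF \<gamma>] M x y] M.minus_eq_zero_iff)
        then obtain \<delta> where \<delta>: "(\<gamma>, \<delta>) \<in> po" "u \<delta> \<gamma> (x \<ominus>\<^bsub>F \<gamma>\<^esub> y) = \<zero>\<^bsub>F \<delta>\<^esub>"
          using ker[OF \<gamma> xy] by blast
        note \<delta>m = F_module[OF conjunct2[OF po_I[OF \<delta>(1)]]]
        interpret D: right_module R "F \<delta>" by (rule \<delta>m)
        have "u \<delta> \<gamma> x = u \<delta> \<gamma> y"
          using \<delta>(2) rhomD(1)[OF u_rhom[OF \<delta>(1)] x] rhomD(1)[OF u_rhom[OF \<delta>(1)] y]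
          by (simp add: rhom_diff[OF u_rhom[OF \<delta>(1)] F_module[OF \<gamma>] \<delta>m x y] D.minus_eq_zero_iff)
        then have "can \<delta> (u \<delta> \<gamma> x) = can \<delta> (u \<delta> \<gamma> y)" by simp
        then show "X = Y"
          by (simp add: XY can_u[OF \<delta>(1) x] can_u[OF \<delta>(1) y])
      qed
    qed
    show "\<phi> ` carrier L = carrier M"
    proof
      show "carrier M \<subseteq> \<phi> ` carrier L"
      proof
        fix m assume "m \<in> carrier M"
        from surj[OF this] obtain \<alpha> x where "\<alpha> \<in> I" "x \<in> carrier (F \<alpha>)" "c \<alpha> x = m" by blast
        then show "m \<in> \<phi> ` carrier L"
          by (intro image_eqI[of _ _ "can \<alpha> x"]) (simp_all add: \<phi> can_closed)
      qed
    qed (use rhomD(1)[OF \<phi>h] in blast)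
  qed
  ultimately have "\<phi> \<in> riso R L M"
    by (simp add: riso_def)
  then show thesis
    using \<phi> by (rule that)
qed

end

section \<open>Finite presentations\<close>

lemma fin_presentedE:
  assumes R: "ring R" and "fin_presented R F"
  obtains n :: nat and A q where "finite A" "A \<subseteq> carrier (rfree R {..<n})"
    "q \<in> rhom R (rfree R {..<n}) F" "q ` carrier (rfree R {..<n}) = carrier F"
    "rspan R (rfree R {..<n}) A = {x \<in> carrier (rfree R {..<n}). q x = \<zero>\<^bsub>F\<^esub>}"
proof -
  obtain n :: nat and A where F: "right_module R F" and A: "finite A" "A \<subseteq> carrier (rfree R {..<n})"
    and iso: "risomorphic R F (rquot (rfree R {..<n}) (rspan R (rfree R {..<n}) A))"
    using assms(2) unfolding fin_presented_def by blast
  let ?P = "rfree R {..<n}"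
  have P: "right_module R ?P"
    by (rule right_module_rfree[OF R])
  obtain f where f: "f \<in> riso R F (rquot ?P (rspan R ?P A))"
    using iso unfolding risomorphic_def by blast
  obtain g where g: "g \<in> riso R (rquot ?P (rspan R ?P A)) F" "\<And>x. x \<in> carrier F \<Longrightarrow> g (f x) = x"
    "\<And>y. y \<in> carrier (rquot ?P (rspan R ?P A)) \<Longrightarrow> f (g y) = y"
    by (fact riso_inverse[OF f F])
  have "risomorphic R (rquot ?P (rspan R ?P A)) F"
    using g(1) unfolding risomorphic_def by blast
  then obtain q where "q \<in> rhom R ?P F" "q ` carrier ?P = carrier F"
    "rspan R ?P A = {x \<in> carrier ?P. q x = \<zero>\<^bsub>F\<^esub>}"
    by (rule rquot_iso_surj[OF P rsubmodule_rspan[OF P A(2)] F])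
  with A show thesis by (rule that)
qed

lemma fin_presentedI:
  fixes n :: nat
  assumes R: "ring R" and F: "right_module R F" and A: "finite A" "A \<subseteq> carrier (rfree R {..<n})"
    and q: "q \<in> rhom R (rfree R {..<n}) F" "q ` carrier (rfree R {..<n}) = carrier F"
    and ker: "{x \<in> carrier (rfree R {..<n}). q x = \<zero>\<^bsub>F\<^esub>} = rspan R (rfree R {..<n}) A"
  shows "fin_presented R F"
  unfolding fin_presented_def
proof (intro conjI exI)
  show "risomorphic R F (rquot (rfree R {..<n}) (rspan R (rfree R {..<n}) A))"
    using first_isomorphism[OF right_module_rfree[OF R] F q] by (simp add: ker)
qed (fact F A)+

section \<open>Strict stationarity and stationarity by relations\<close>

text \<open>A finite presentation of \<open>F \<beta>\<close> turns solutions of finitely many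
  relations into homomorphisms from \<open>F \<beta>\<close> to \<open>B\<close>. Equality of the
  \<open>Hset\<close>s converts their composites with \<open>u \<beta> \<alpha>\<close> into
  restrictions of homomorphisms on \<open>M\<close>.\<close>

lemma strict_stationary_wrt_imp_rel_stationary:
  fixes M :: "('r, 'm) rmodule"
  assumes R: "ring R" and B: "right_module R B"
    and stat: "strict_stationary_wrt TYPE('i) TYPE('f) R B M"
  shows "rel_stationary R B M"
proof (rule rel_stationaryI)
  have M: "right_module R M"
    using stat by (simp add: strict_stationary_wrt_def)
  interpret M: right_module R M by (rule M)
  interpret B: right_module R B by (rule B)
  obtain I :: "'i set" and po and F :: "'i \<Rightarrow> ('r, 'f) rmodule" and u \<phi> c where
    sys: "direct_system R I po F u" and fp: "\<forall>\<alpha>\<in>I. fin_presented R (F \<alpha>)"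
    and \<phi>: "\<phi> \<in> riso R (dirlim I po F u) M"
    and c_def: "\<forall>\<alpha>\<in>I. c \<alpha> = compose (carrier (F \<alpha>)) \<phi> (dirlim_map I po F u \<alpha>)"
    and H: "\<forall>\<alpha>\<in>I. \<exists>\<beta>\<in>I. (\<alpha>, \<beta>) \<in> po \<and>
          Hset R (F \<alpha>) M (c \<alpha>) B = Hset R (F \<alpha>) (F \<beta>) (u \<beta> \<alpha>) B"
    using stat unfolding strict_stationary_wrt_def by (elim conjE exE)
  interpret sys: module_system R I po F u
    by (rule module_system.intro[OF sys])
  have \<phi>h: "\<phi> \<in> rhom R sys.L M" and \<phi>img: "\<phi> ` carrier sys.L = carrier M"
    using \<phi> by (auto simp: riso_def bij_betw_def)
  have c: "c \<alpha> \<in> rhom R (F \<alpha>) M" if "\<alpha> \<in> I" for \<alpha>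
    using c_def that rhom_compose[OF sys.can_rhom[OF that] \<phi>h sys.F_module[OF that]] by simp
  have c_u: "c \<beta> (u \<beta> \<alpha> x) = c \<alpha> x" if po: "(\<alpha>, \<beta>) \<in> po" and x: "x \<in> carrier (F \<alpha>)" for \<alpha> \<beta> x
    using c_def sys.po_I[OF po] x rhomD(1)[OF sys.u_rhom[OF po] x]
    by (simp add: compose_eq sys.can_u[OF po x])
  fix X assume X: "finite X" "X \<subseteq> carrier M"
  have "X \<subseteq> \<phi> ` carrier sys.L"
    unfolding \<phi>img by (rule X(2))
  from finite_subset_image[OF X(1) this]
  obtain X' where X': "X' \<subseteq> carrier sys.L" "finite X'" "X = \<phi> ` X'" by blast
  obtain \<alpha> where \<alpha>: "\<alpha> \<in> I" "X' \<subseteq> sys.can \<alpha> ` carrier (F \<alpha>)"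
    by (rule sys.dirlim_finite_subset[OF X'(2,1)])
  have "\<forall>x\<in>X. \<exists>y. y \<in> carrier (F \<alpha>) \<and> c \<alpha> y = x"
  proof
    fix x assume "x \<in> X"
    then obtain x' where x': "x' \<in> X'" "x = \<phi> x'"
      using X'(3) by blast
    then obtain y where "y \<in> carrier (F \<alpha>)" "x' = sys.can \<alpha> y"
      using \<alpha>(2) by blast
    with x'(2) show "\<exists>y. y \<in> carrier (F \<alpha>) \<and> c \<alpha> y = x"
      using c_def \<alpha>(1) by (intro exI[of _ y]) (simp add: compose_eq)
  qed
  from bchoice[OF this] obtain y where "\<forall>x\<in>X. y x \<in> carrier (F \<alpha>) \<and> c \<alpha> (y x) = x" ..
  then have y: "y x \<in> carrier (F \<alpha>)" "c \<alpha> (y x) = x" if "x \<in> X" for x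
    using that by simp_all
  \<comment> \<open>\<open>X\<close> is lifted to \<open>F \<alpha>\<close>, but the relations will
    come from the stabilizing index \<open>\<beta>\<close>, because homomorphisms out of
    \<open>F \<beta>\<close> are the ones to be constructed.\<close>
  obtain \<beta> where \<beta>: "\<beta> \<in> I" "(\<alpha>, \<beta>) \<in> po"
    and Heq: "Hset R (F \<alpha>) M (c \<alpha>) B = Hset R (F \<alpha>) (F \<beta>) (u \<beta> \<alpha>) B"
    using H \<alpha>(1) by blast
  note F\<beta> = sys.F_module[OF \<beta>(1)]
  have fp\<beta>: "fin_presented R (F \<beta>)"
    using fp \<beta>(1) by blast
  obtain A q and n :: nat where A: "finite A" "A \<subseteq> carrier (rfree R {..<n})"
    and q: "q \<in> rhom R (rfree R {..<n}) (F \<beta>)" "q ` carrier (rfree R {..<n}) = carrier (F \<beta>)"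
    and span: "rspan R (rfree R {..<n}) A = {x \<in> carrier (rfree R {..<n}). q x = \<zero>\<^bsub>F \<beta>\<^esub>}"
    by (rule fin_presentedE[OF R fp\<beta>])
  let ?P = "rfree R {..<n}"
  have P: "right_module R ?P"
    by (rule right_module_rfree[OF R])
  have "\<forall>p\<in>carrier ?P. \<exists>l. set l \<subseteq> {..<n} \<times> carrier R \<and> lincomb ?P (runit R {..<n}) l = p"
  proof
    fix p assume "p \<in> carrier ?P"
    then obtain l where "set l \<subseteq> ({..<n} \<inter> {..<n}) \<times> carrier R" "p = lincomb ?P (runit R {..<n}) l"
      by (rule rfree_lincomb[OF R, of _ _ "{..<n}"]) auto
    then show "\<exists>l. set l \<subseteq> {..<n} \<times> carrier R \<and> lincomb ?P (runit R {..<n}) l = p"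
      by auto
  qed
  from bchoice[OF this] obtain l where
    "\<forall>p\<in>carrier ?P. set (l p) \<subseteq> {..<n} \<times> carrier R \<and> lincomb ?P (runit R {..<n}) (l p) = p" ..
  then have l: "set (l p) \<subseteq> {..<n} \<times> carrier R" "lincomb ?P (runit R {..<n}) (l p) = p"
    if "p \<in> carrier ?P" for p
    using that by simp_all
  have "\<forall>x\<in>X. \<exists>p. p \<in> carrier ?P \<and> q p = u \<beta> \<alpha> (y x)"
  proof
    fix x assume "x \<in> X"
    then have "u \<beta> \<alpha> (y x) \<in> q ` carrier ?P"
      unfolding q(2) by (intro rhomD(1)[OF sys.u_rhom[OF \<beta>(2)]] y(1))
    then show "\<exists>p. p \<in> carrier ?P \<and> q p = u \<beta> \<alpha> (y x)" by auto
  qed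
  from bchoice[OF this] obtain w where "\<forall>x\<in>X. w x \<in> carrier ?P \<and> q (w x) = u \<beta> \<alpha> (y x)" ..
  then have w: "w x \<in> carrier ?P" "q (w x) = u \<beta> \<alpha> (y x)" if "x \<in> X" for x
    using that by simp_all
  \<comment> \<open>The presentation of \<open>F \<beta>\<close> followed by its canonical map;
    \<open>g i\<close> below is thus the image in \<open>M\<close> of the \<open>i\<close>-th
    generator.\<close>
  define k where "k = compose (carrier ?P) (c \<beta>) q"
  have k: "k \<in> rhom R ?P M"
    unfolding k_def by (rule rhom_compose[OF q(1) c[OF \<beta>(1)] P])
  define g where "g = (\<lambda>i. k (runit R {..<n} i))"
  have gM: "g i \<in> carrier M" for i
    unfolding g_def by (rule rhomD(1)[OF k runit_closed[OF R]])
  have kl: "lincomb M g (l p) = k p" if "p \<in> carrier ?P" for p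
    using rhom_rfree_lincomb[OF R M k l(1)[OF that]] by (simp add: g_def l(2)[OF that])
  have kw: "k (w x) = x" if "x \<in> X" for x
    using that by (simp add: k_def compose_eq w c_u[OF \<beta>(2)] y)
  define re where "re p = map (map_prod g id) (l p)" for p
  have re: "set (re p) \<subseteq> carrier M \<times> carrier R" "lincomb M (\<lambda>x. x) (re p) = k p"
    "lincomb B b (re p) = lincomb B (\<lambda>i. b (g i)) (l p)" if "p \<in> carrier ?P" for p b
    using l(1)[OF that] gM kl[OF that] by (auto simp: re_def)
  \<comment> \<open>States that \<open>x\<close> equals the combination of the \<open>g i\<close>
    with the coordinates of \<open>w x\<close>. The lists \<open>re a\<close> for \<open>a\<close>
    in \<open>A\<close> are the defining relations of \<open>F \<beta>\<close>, carried to
    \<open>M\<close>.\<close>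
  define rx where "rx x = (x, \<ominus>\<^bsub>R\<^esub> \<one>\<^bsub>R\<^esub>) # re (w x)" for x
  let ?E = "re ` A \<union> rx ` X"
  have AP: "a \<in> carrier ?P" "q a = \<zero>\<^bsub>F \<beta>\<^esub>" if "a \<in> A" for a
    using that A(2) rspan_superset[of A R ?P] by (auto simp: span)
  have "re a \<in> module_relations R M" if a: "a \<in> A" for a
    using re(1,2)[OF AP(1)[OF a]] AP[OF a]
    by (simp add: module_relations_def k_def compose_eq rhom_zero[OF c[OF \<beta>(1)] F\<beta> M])
  moreover have "rx x \<in> module_relations R M" if x: "x \<in> X" for x
  proof -
    have "x \<in> carrier M" using x X(2) by blast
    then show ?thesis
      using re(1,2)[OF w(1)[OF x]]
      by (simp add: module_relations_def rx_def kw[OF x] M.rsmult_minus_one M.M.l_neg)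
  qed
  ultimately have "?E \<subseteq> module_relations R M" by blast
  moreover have "finite ?E"
    using A(1) X(1) by simp
  moreover have "\<exists>f\<in>rhom R M B. \<forall>x\<in>X. f x = b x"
    if b: "b \<in> carrier M \<rightarrow> carrier B" and rel: "\<forall>l\<in>?E. lincomb B b l = \<zero>\<^bsub>B\<^esub>" for b
  proof -
    have bg: "b (g i) \<in> carrier B" for i
      by (rule funcset_mem[OF b gM])
    define h' where "h' = free_ext R {..<n} B (\<lambda>i. b (g i))"
    have h': "h' \<in> rhom R ?P B"
      unfolding h'_def by (rule free_ext_rhom[OF B bg])
    have hl: "h' p = lincomb B b (re p)" if p: "p \<in> carrier ?P" for p
    proof -
      have "h' p = lincomb B (\<lambda>i. h' (runit R {..<n} i)) (l p)"
        using rhom_rfree_lincomb[OF R B h' l(1)[OF p]] by (simp add: l(2)[OF p])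
      also have "\<dots> = lincomb B (\<lambda>i. b (g i)) (l p)"
      proof (rule lincomb_cong)
        fix i a assume "(i, a) \<in> set (l p)"
        then have "i \<in> {..<n}" using l(1)[OF p] by blast
        then show "h' (runit R {..<n} i) = b (g i)"
          unfolding h'_def by (rule free_ext_runit[OF B bg])
      qed
      finally show ?thesis
        by (simp add: re(3)[OF p])
    qed
    have "rspan R ?P A \<subseteq> {p \<in> carrier ?P. h' p = \<zero>\<^bsub>B\<^esub>}"
      by (rule rspan_least[OF rsubmodule_kernel[OF h' P B]]) (use rel AP hl in auto)
    then have "h' p = \<zero>\<^bsub>B\<^esub>" if "p \<in> carrier ?P" "q p = \<zero>\<^bsub>F \<beta>\<^esub>" for p
      using that by (auto simp: span)
    from rhom_factor[OF P F\<beta> B q h' this] obtain h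
      where h: "h \<in> rhom R (F \<beta>) B" "\<forall>p\<in>carrier ?P. h (q p) = h' p" by blast
    \<comment> \<open>The stationarity hypothesis enters here: a map that factors through
      \<open>F \<beta>\<close> also factors through \<open>M\<close>.\<close>
    have "compose (carrier (F \<alpha>)) h (u \<beta> \<alpha>) \<in> Hset R (F \<alpha>) M (c \<alpha>) B"
      unfolding Heq using h(1) by (auto simp: Hset_def)
    then obtain f where f: "f \<in> rhom R M B"
      and eq: "compose (carrier (F \<alpha>)) h (u \<beta> \<alpha>) = compose (carrier (F \<alpha>)) f (c \<alpha>)"
      unfolding Hset_def by blast
    have "f x = b x" if x: "x \<in> X" for x
    proof -
      have xM: "x \<in> carrier M" "b x \<in> carrier B"
        using x X(2) funcset_mem[OF b] by blast+
      have "f x = h (u \<beta> \<alpha> (y x))"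
        using fun_cong[OF eq, of "y x"] y[OF x] by (simp add: compose_eq)
      also have "\<dots> = h' (w x)"
        using bspec[OF h(2) w(1)[OF x]] w(2)[OF x] by simp
      finally have fx: "f x = lincomb B b (re (w x))"
        by (simp add: hl[OF w(1)[OF x]])
      have "lincomb B b (rx x) = \<zero>\<^bsub>B\<^esub>"
        using rel x by blast
      then have "\<ominus>\<^bsub>B\<^esub> b x \<oplus>\<^bsub>B\<^esub> f x = \<zero>\<^bsub>B\<^esub>"
        using xM by (simp add: rx_def fx B.rsmult_minus_one)
      then have "f x \<ominus>\<^bsub>B\<^esub> b x = \<zero>\<^bsub>B\<^esub>"
        using xM rhomD(1)[OF f xM(1)] by (simp add: a_minus_def B.M.a_comm)
      then show ?thesis
        using xM rhomD(1)[OF f xM(1)] by (simp add: B.minus_eq_zero_iff)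
    qed
    with f show ?thesis by blast
  qed
  ultimately show "\<exists>E. controls R B M X E"
      unfolding controls_def
    by (intro exI[of _ ?E]) simp
qed

section \<open>The canonical presentation\<close>

text \<open>The index \<open>(Y, E)\<close> stands for the module generated by the finite set \<open>Y\<close> subject to the finite
set \<open>E\<close> of relations on \<open>Y\<close>. Generators and relations are kept inside the free module on the whole
of \<open>M\<close>, so that indices are compared by inclusion.\<close>

locale canonical_presentation =
  fixes R :: "('r, 'z) ring_scheme" and M :: "('r, 'm) rmodule"
  assumes M: "right_module R M"
begin

sublocale M: right_module R M by (rule M)

abbreviation "P \<equiv> rfree R (carrier M)"
abbreviation "unit \<equiv> runit R (carrier M)"
abbreviation "\<pi> \<equiv> free_cover R M"

definition supp_in :: "'m set \<Rightarrow> ('m \<Rightarrow> 'r) set"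
  where "supp_in Y = {e \<in> carrier P. \<forall>x\<in>carrier M - Y. e x = \<zero>\<^bsub>R\<^esub>}"

definition J :: "('m set \<times> ('m \<Rightarrow> 'r) set) set"
  where "J = {(Y, E). finite Y \<and> Y \<subseteq> carrier M \<and> finite E \<and> E \<subseteq> supp_in Y \<and> (\<forall>e\<in>E. \<pi> e = \<zero>\<^bsub>M\<^esub>)}"

definition po :: "('m set \<times> ('m \<Rightarrow> 'r) set) rel"
  where "po = {(\<alpha>, \<beta>). \<alpha> \<in> J \<and> \<beta> \<in> J \<and> fst \<alpha> \<subseteq> fst \<beta> \<and> snd \<alpha> \<subseteq> snd \<beta>}"

definition PY :: "'m set \<times> ('m \<Rightarrow> 'r) set \<Rightarrow> ('r, 'm \<Rightarrow> 'r) rmodule"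
  where "PY \<alpha> = P\<lparr>carrier := supp_in (fst \<alpha>)\<rparr>"

text \<open>The span is taken in \<open>P\<close>, so it depends on the relations only. For
  \<open>\<alpha>\<close> in \<open>J\<close> it lies inside \<open>supp_in (fst \<alpha>)\<close>
  because the relations do.\<close>

abbreviation "K \<alpha> \<equiv> rspan R P (snd \<alpha>)"

definition F :: "'m set \<times> ('m \<Rightarrow> 'r) set \<Rightarrow> ('r, ('m \<Rightarrow> 'r) set) rmodule"
  where "F \<alpha> = rquot (PY \<alpha>) (K \<alpha>)"

abbreviation "Q \<alpha> \<equiv> qmap (PY \<alpha>) (K \<alpha>)"

lemma P_module: "right_module R P"
  by (rule right_module_rfree[OF M.R.ring_axioms])

sublocale P: right_module R P by (rule P_module)

lemma \<pi>_rhom: "\<pi> \<in> rhom R P M"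
  by (rule free_cover_rhom[OF M])

lemma supp_in_rsubmodule: "rsubmodule R (supp_in Y) P"
proof (rule rsubmoduleI[OF P_module])
  show "\<zero>\<^bsub>P\<^esub> \<in> supp_in Y"
    unfolding supp_in_def using P.M.zero_closed by (simp add: rfree_simps(2))
  show "e \<oplus>\<^bsub>P\<^esub> e' \<in> supp_in Y" if "e \<in> supp_in Y" "e' \<in> supp_in Y" for e e'
    using that P.M.a_closed[of e e'] by (simp add: supp_in_def rfree_simps(3))
  show "e \<star>\<^bsub>P\<^esub> a \<in> supp_in Y" if "e \<in> supp_in Y" "a \<in> carrier R" for e a
    using that P.rsmult_closed[of e a] by (simp add: supp_in_def rfree_simps(4))
qed (simp add: supp_in_def)

lemma supp_in_carrier: "e \<in> supp_in Y \<Longrightarrow> e \<in> carrier P"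
  by (simp add: supp_in_def)

lemma supp_in_mono: "Y \<subseteq> Y' \<Longrightarrow> supp_in Y \<subseteq> supp_in Y'"
  by (auto simp: supp_in_def)

lemma unit_supp_in: "x \<in> Y \<Longrightarrow> unit x \<in> supp_in Y"
  by (simp add: supp_in_def runit_closed[OF M.R.ring_axioms]) (auto simp: runit_def)

lemma lincomb_supp_in: "set l \<subseteq> Y \<times> carrier R \<Longrightarrow> lincomb P unit l \<in> supp_in Y"
  by (rule lincomb_mem_submodule[OF supp_in_rsubmodule _ unit_supp_in])

lemma supp_in_lincomb:
  assumes "e \<in> supp_in Y"
  obtains l where "set l \<subseteq> (carrier M \<inter> Y) \<times> carrier R" "e = lincomb P unit l"
proof -
  have "e \<in> carrier P" "\<And>x. x \<in> carrier M - Y \<Longrightarrow> e x = \<zero>\<^bsub>R\<^esub>"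
    using assms by (simp_all add: supp_in_def)
  then show thesis
    by (rule rfree_lincomb[OF M.R.ring_axioms _ _ that])
qed

lemma JD:
  assumes "\<alpha> \<in> J"
  shows "finite (fst \<alpha>)" "fst \<alpha> \<subseteq> carrier M" "finite (snd \<alpha>)" "snd \<alpha> \<subseteq> supp_in (fst \<alpha>)"
    "\<And>e. e \<in> snd \<alpha> \<Longrightarrow> \<pi> e = \<zero>\<^bsub>M\<^esub>"
  using assms by (auto simp: J_def)

lemma PY_simps [simp]: "carrier (PY \<alpha>) = supp_in (fst \<alpha>)" "lincomb (PY \<alpha>) b l = lincomb P b l"
  "\<zero>\<^bsub>PY \<alpha>\<^esub> = \<zero>\<^bsub>P\<^esub>"
  by (simp_all add: PY_def)

section \<open>The modules of the canonical system and their maps\<close>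

lemma PY_module: "right_module R (PY \<alpha>)"
  unfolding PY_def by (rule right_module_submodule[OF P_module supp_in_rsubmodule])

lemma K_submodule:
  assumes "\<alpha> \<in> J"
  shows "rsubmodule R (K \<alpha>) P"
  by (rule rsubmodule_rspan[OF P_module]) (use JD(4)[OF assms] supp_in_carrier in blast)

lemma K_submodule_PY:
  assumes "\<alpha> \<in> J"
  shows "rsubmodule R (K \<alpha>) (PY \<alpha>)"
  unfolding PY_def
  by (rule rsubmodule_of_submodule[OF supp_in_rsubmodule K_submodule[OF assms]
        rspan_least[OF supp_in_rsubmodule JD(4)[OF assms]] P_module])

lemma F_module: "\<alpha> \<in> J \<Longrightarrow> right_module R (F \<alpha>)"
  unfolding F_def by (rule right_module_rquot[OF PY_module K_submodule_PY])

lemma Q_rhom: "\<alpha> \<in> J \<Longrightarrow> Q \<alpha> \<in> rhom R (PY \<alpha>) (F \<alpha>)"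
  unfolding F_def by (rule qmap_rhom[OF PY_module K_submodule_PY])

lemma Q_image: "\<alpha> \<in> J \<Longrightarrow> Q \<alpha> ` carrier (PY \<alpha>) = carrier (F \<alpha>)"
  unfolding F_def by (rule qmap_image[OF PY_module K_submodule_PY])

lemma Q_closed: "\<alpha> \<in> J \<Longrightarrow> e \<in> supp_in (fst \<alpha>) \<Longrightarrow> Q \<alpha> e \<in> carrier (F \<alpha>)"
  using rhomD(1)[OF Q_rhom] by simp

lemma Q_cases:
  assumes "\<alpha> \<in> J" "X \<in> carrier (F \<alpha>)"
  obtains e where "e \<in> supp_in (fst \<alpha>)" "X = Q \<alpha> e"
proof -
  have "X \<in> Q \<alpha> ` carrier (PY \<alpha>)"
    unfolding Q_image[OF assms(1)] by (rule assms(2))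
  then show thesis by (auto intro: that)
qed

lemma Q_eq_zero: "\<alpha> \<in> J \<Longrightarrow> e \<in> supp_in (fst \<alpha>) \<Longrightarrow> Q \<alpha> e = \<zero>\<^bsub>F \<alpha>\<^esub> \<longleftrightarrow> e \<in> K \<alpha>"
  unfolding F_def by (rule qmap_eq_zero[OF PY_module K_submodule_PY]) simp_all

text \<open>Universal property of generators and relations: only the finitely many elements of
  \<open>snd \<alpha>\<close> have to be killed, since the kernel of \<open>f\<close> is a submodule
  and so contains their span.\<close>

lemma factor_F:
  assumes \<alpha>: "\<alpha> \<in> J" and B: "right_module R B" and f: "f \<in> rhom R (PY \<alpha>) B"
    and rel: "\<And>e. e \<in> snd \<alpha> \<Longrightarrow> f e = \<zero>\<^bsub>B\<^esub>"
  shows "\<exists>h\<in>rhom R (F \<alpha>) B. \<forall>e\<in>supp_in (fst \<alpha>). h (Q \<alpha> e) = f e"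
proof -
  have ker: "f e = \<zero>\<^bsub>B\<^esub>" if e: "e \<in> carrier (PY \<alpha>)" "Q \<alpha> e = \<zero>\<^bsub>F \<alpha>\<^esub>" for e
  proof -
    \<comment> \<open>The span is minimal among submodules of \<open>P\<close>, so the kernel, known
      as a submodule of \<open>PY \<alpha>\<close>, has to be seen as one of
      \<open>P\<close>.\<close>
    let ?Z = "{e \<in> carrier (PY \<alpha>). f e = \<zero>\<^bsub>B\<^esub>}"
    note Z = rsubmoduleD[OF rsubmodule_kernel[OF f PY_module B]]
    have "rsubmodule R ?Z P"
    proof (rule rsubmoduleI[OF P_module])
      show "?Z \<subseteq> carrier P"
        using supp_in_carrier by auto
    qed (use Z in \<open>simp_all add: PY_def\<close>)
    moreover have "snd \<alpha> \<subseteq> ?Z"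
      using JD(4)[OF \<alpha>] rel by auto
    ultimately have "K \<alpha> \<subseteq> ?Z"
      by (rule rspan_least)
    then show ?thesis
      using e Q_eq_zero[OF \<alpha>, of e] by auto
  qed
  show ?thesis
    using rhom_factor[OF PY_module F_module[OF \<alpha>] B Q_rhom[OF \<alpha>] Q_image[OF \<alpha>] f ker] by simp
qed

text \<open>For comparable indices the choice is among a single candidate: the classes
  \<open>Q \<alpha> e\<close> exhaust the carrier of \<open>F \<alpha>\<close>, and homomorphisms
  are extensional.\<close>

definition u :: "'m set \<times> ('m \<Rightarrow> 'r) set \<Rightarrow> 'm set \<times> ('m \<Rightarrow> 'r) set \<Rightarrow> ('m \<Rightarrow> 'r) set \<Rightarrow> ('m \<Rightarrow> 'r) set"
  where "u \<beta> \<alpha> = (SOME h. h \<in> rhom R (F \<alpha>) (F \<beta>) \<and> (\<forall>e\<in>supp_in (fst \<alpha>). h (Q \<alpha> e) = Q \<beta> e))"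

definition c :: "'m set \<times> ('m \<Rightarrow> 'r) set \<Rightarrow> ('m \<Rightarrow> 'r) set \<Rightarrow> 'm"
  where "c \<alpha> = (SOME h. h \<in> rhom R (F \<alpha>) M \<and> (\<forall>e\<in>supp_in (fst \<alpha>). h (Q \<alpha> e) = \<pi> e))"

lemma poD:
  assumes "(\<alpha>, \<beta>) \<in> po"
  shows "\<alpha> \<in> J" "\<beta> \<in> J" "supp_in (fst \<alpha>) \<subseteq> supp_in (fst \<beta>)" "snd \<alpha> \<subseteq> snd \<beta>"
  using assms supp_in_mono by (auto simp: po_def)

lemma
  assumes po: "(\<alpha>, \<beta>) \<in> po"
  shows u_rhom: "u \<beta> \<alpha> \<in> rhom R (F \<alpha>) (F \<beta>)"
    and u_Q: "e \<in> supp_in (fst \<alpha>) \<Longrightarrow> u \<beta> \<alpha> (Q \<alpha> e) = Q \<beta> e"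
proof -
  note D = poD[OF po]
  have sub: "rsubmodule R (supp_in (fst \<alpha>)) (PY \<beta>)"
    unfolding PY_def by (rule rsubmodule_of_submodule[OF supp_in_rsubmodule supp_in_rsubmodule D(3) P_module])
  have r: "restrict (Q \<beta>) (supp_in (fst \<alpha>)) \<in> rhom R (PY \<alpha>) (F \<beta>)"
    using rhom_restrict[OF Q_rhom[OF D(2)] sub] by (simp add: PY_def)
  have "restrict (Q \<beta>) (supp_in (fst \<alpha>)) e = \<zero>\<^bsub>F \<beta>\<^esub>" if "e \<in> snd \<alpha>" for e
  proof -
    have e: "e \<in> supp_in (fst \<alpha>)" "e \<in> supp_in (fst \<beta>)"
      using that JD(4)[OF D(1)] D(3) by blast+
    moreover have "e \<in> K \<beta>"
      by (rule subsetD[OF rspan_superset]) (use that D(4) in blast)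
    ultimately show ?thesis
      by (simp add: Q_eq_zero[OF D(2)])
  qed
  from factor_F[OF D(1) F_module[OF D(2)] r this] obtain h where h: "h \<in> rhom R (F \<alpha>) (F \<beta>)"
    "\<forall>e\<in>supp_in (fst \<alpha>). h (Q \<alpha> e) = restrict (Q \<beta>) (supp_in (fst \<alpha>)) e" ..
  have "h (Q \<alpha> e) = Q \<beta> e" if "e \<in> supp_in (fst \<alpha>)" for e
    using bspec[OF h(2) that] that by (simp only: restrict_apply')
  with h(1) have "h \<in> rhom R (F \<alpha>) (F \<beta>) \<and> (\<forall>e\<in>supp_in (fst \<alpha>). h (Q \<alpha> e) = Q \<beta> e)"
    by (intro conjI ballI)
  then have "u \<beta> \<alpha> \<in> rhom R (F \<alpha>) (F \<beta>) \<and> (\<forall>e\<in>supp_in (fst \<alpha>). u \<beta> \<alpha> (Q \<alpha> e) = Q \<beta> e)"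
    unfolding u_def
    by (rule someI[where P = "\<lambda>h. h \<in> rhom R (F \<alpha>) (F \<beta>) \<and> (\<forall>e\<in>supp_in (fst \<alpha>). h (Q \<alpha> e) = Q \<beta> e)"])
  then show "u \<beta> \<alpha> \<in> rhom R (F \<alpha>) (F \<beta>)" "e \<in> supp_in (fst \<alpha>) \<Longrightarrow> u \<beta> \<alpha> (Q \<alpha> e) = Q \<beta> e"
    by simp_all
qed

lemma
  assumes \<alpha>: "\<alpha> \<in> J"
  shows c_rhom: "c \<alpha> \<in> rhom R (F \<alpha>) M"
    and c_Q: "e \<in> supp_in (fst \<alpha>) \<Longrightarrow> c \<alpha> (Q \<alpha> e) = \<pi> e"
proof -
  have r: "restrict \<pi> (supp_in (fst \<alpha>)) \<in> rhom R (PY \<alpha>) M"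
    unfolding PY_def by (rule rhom_restrict[OF \<pi>_rhom supp_in_rsubmodule])
  have "restrict \<pi> (supp_in (fst \<alpha>)) e = \<zero>\<^bsub>M\<^esub>" if "e \<in> snd \<alpha>" for e
    using JD(4,5)[OF \<alpha>] that by auto
  from factor_F[OF \<alpha> M r this] obtain h where h: "h \<in> rhom R (F \<alpha>) M"
    "\<forall>e\<in>supp_in (fst \<alpha>). h (Q \<alpha> e) = restrict (\<pi>) (supp_in (fst \<alpha>)) e" ..
  have "h (Q \<alpha> e) = \<pi> e" if "e \<in> supp_in (fst \<alpha>)" for e
    using bspec[OF h(2) that] that by (simp only: restrict_apply')
  with h(1) have "h \<in> rhom R (F \<alpha>) M \<and> (\<forall>e\<in>supp_in (fst \<alpha>). h (Q \<alpha> e) = \<pi> e)"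
    by (intro conjI ballI)
  then have "c \<alpha> \<in> rhom R (F \<alpha>) M \<and> (\<forall>e\<in>supp_in (fst \<alpha>). c \<alpha> (Q \<alpha> e) = \<pi> e)"
    unfolding c_def
    by (rule someI[where P = "\<lambda>h. h \<in> rhom R (F \<alpha>) M \<and> (\<forall>e\<in>supp_in (fst \<alpha>). h (Q \<alpha> e) = \<pi> e)"])
  then show "c \<alpha> \<in> rhom R (F \<alpha>) M" "e \<in> supp_in (fst \<alpha>) \<Longrightarrow> c \<alpha> (Q \<alpha> e) = \<pi> e"
    by simp_all
qed

lemma F_extI:
  assumes "\<alpha> \<in> J" "f \<in> extensional (carrier (F \<alpha>))" "g \<in> extensional (carrier (F \<alpha>))"
    "\<And>e. e \<in> supp_in (fst \<alpha>) \<Longrightarrow> f (Q \<alpha> e) = g (Q \<alpha> e)"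
  shows "f = g"
proof (rule extensionalityI[OF assms(2,3)])
  fix X assume "X \<in> carrier (F \<alpha>)"
  then obtain e where "e \<in> supp_in (fst \<alpha>)" "X = Q \<alpha> e"
    by (rule Q_cases[OF assms(1)])
  then show "f X = g X"
    using assms(4) by simp
qed

section \<open>Directedness, finite presentation and the limit of the canonical system\<close>

lemma directed_J:
  assumes "\<alpha> \<in> J" "\<beta> \<in> J"
  shows "\<exists>\<gamma>\<in>J. (\<alpha>, \<gamma>) \<in> po \<and> (\<beta>, \<gamma>) \<in> po"
proof -
  let ?\<gamma> = "(fst \<alpha> \<union> fst \<beta>, snd \<alpha> \<union> snd \<beta>)"
  have "supp_in (fst \<alpha>) \<subseteq> supp_in (fst ?\<gamma>)" "supp_in (fst \<beta>) \<subseteq> supp_in (fst ?\<gamma>)"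
    by (rule supp_in_mono, simp)+
  then have "?\<gamma> \<in> J"
    using JD(1-4)[OF assms(1)] JD(1-4)[OF assms(2)] JD(5)[OF assms(1)] JD(5)[OF assms(2)]
    unfolding J_def by auto
  then show ?thesis
    using assms by (intro bexI[of _ ?\<gamma>]) (auto simp: po_def)
qed

lemma direct_system: "direct_system R J po F u"
  unfolding direct_system_def
proof (intro conjI ballI allI impI)
  show "partial_order_on J po"
    unfolding order_on_defs
    by (auto simp: po_def refl_on_def trans_def antisym_def prod_eq_iff)
  show "J \<noteq> {}"
    by (auto simp: J_def)
  show "u \<alpha> \<alpha> = (\<lambda>x\<in>carrier (F \<alpha>). x)" if \<alpha>: "\<alpha> \<in> J" for \<alpha>
  proof (rule F_extI[OF \<alpha>])
    have po: "(\<alpha>, \<alpha>) \<in> po" using \<alpha> by (simp add: po_def)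
    show "u \<alpha> \<alpha> \<in> extensional (carrier (F \<alpha>))"
      by (rule rhomD(4)[OF u_rhom[OF po]])
    show "u \<alpha> \<alpha> (Q \<alpha> e) = (\<lambda>x\<in>carrier (F \<alpha>). x) (Q \<alpha> e)" if "e \<in> supp_in (fst \<alpha>)" for e
      using that by (simp add: u_Q[OF po] Q_closed[OF \<alpha>])
  qed simp
  show "compose (carrier (F \<alpha>)) (u \<gamma> \<beta>) (u \<beta> \<alpha>) = u \<gamma> \<alpha>" if po: "(\<alpha>, \<beta>) \<in> po" "(\<beta>, \<gamma>) \<in> po" for \<alpha> \<beta> \<gamma>
  proof (rule F_extI[OF poD(1)[OF po(1)]])
    have po': "(\<alpha>, \<gamma>) \<in> po" using po by (auto simp: po_def)
    show "u \<gamma> \<alpha> \<in> extensional (carrier (F \<alpha>))"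
      by (rule rhomD(4)[OF u_rhom[OF po']])
    fix e assume e: "e \<in> supp_in (fst \<alpha>)"
    then have "e \<in> supp_in (fst \<beta>)" using poD(3)[OF po(1)] by blast
    with e show "compose (carrier (F \<alpha>)) (u \<gamma> \<beta>) (u \<beta> \<alpha>) (Q \<alpha> e) = u \<gamma> \<alpha> (Q \<alpha> e)"
      by (simp add: compose_eq Q_closed[OF poD(1)[OF po(1)]] u_Q[OF po(1)] u_Q[OF po(2)] u_Q[OF po'])
  qed simp
qed (use directed_J F_module u_rhom in blast)+

sublocale module_system R J po F u
  by (rule module_system.intro[OF direct_system])

text \<open>An enumeration of the generators identifies the free module on numbers below
  \<open>n\<close> with \<open>supp_in (fst \<alpha>)\<close>; the relations are transported by this
  identification.\<close>

lemma fin_presented_F: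
  assumes \<alpha>: "\<alpha> \<in> J"
  shows "fin_presented R (F \<alpha>)"
proof -
  note R = M.R.ring_axioms
  define n where "n = card (fst \<alpha>)"
  obtain h where h: "bij_betw h {..<n} (fst \<alpha>)"
    using ex_bij_betw_nat_finite[OF JD(1)[OF \<alpha>]] by (auto simp: n_def atLeast0LessThan)
  let ?h = "inv_into {..<n} h"
  let ?Rn = "rfree R {..<n}" and ?un = "runit R {..<n}"
  have Rn: "right_module R ?Rn"
    by (rule right_module_rfree[OF R])
  have hY: "h i \<in> fst \<alpha>" "h i \<in> carrier M" "?h (h i) = i" if "i \<in> {..<n}" for i
    using bij_betwE[OF h] that JD(2)[OF \<alpha>] bij_betw_inv_into_left[OF h that] by auto
  have h': "?h x \<in> {..<n}" "h (?h x) = x" if "x \<in> fst \<alpha>" for x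
    using bij_betwE[OF bij_betw_inv_into[OF h]] bij_betw_inv_into_right[OF h] that by auto
  define \<theta> where "\<theta> = free_ext R {..<n} P (\<lambda>i. unit (h i))"
  \<comment> \<open>Defined on all of \<open>P\<close>, although the inverse enumeration is
    meaningful on \<open>fst \<alpha>\<close> only. It inverts \<open>\<theta>\<close> on
    \<open>supp_in (fst \<alpha>)\<close>, where it is going to be used.\<close>
  define \<theta>' where "\<theta>' = free_ext R (carrier M) ?Rn (\<lambda>x. ?un (?h x))"
  have \<theta>: "\<theta> \<in> rhom R ?Rn P" and \<theta>u: "\<And>i. i \<in> {..<n} \<Longrightarrow> \<theta> (?un i) = unit (h i)"
    unfolding \<theta>_def
    by (rule free_ext_rhom[OF P_module runit_closed[OF R]], rule free_ext_runit[OF P_module runit_closed[OF R]])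
  have \<theta>': "\<theta>' \<in> rhom R P ?Rn" and \<theta>'u: "\<And>x. x \<in> carrier M \<Longrightarrow> \<theta>' (unit x) = ?un (?h x)"
    unfolding \<theta>'_def
    by (rule free_ext_rhom[OF Rn runit_closed[OF R]], rule free_ext_runit[OF Rn runit_closed[OF R]])
  note uP = runit_closed[OF R, of "carrier M"] and uR = runit_closed[OF R, of "{..<n}"]
  have inv1: "\<theta>' (\<theta> p) = p" if p: "p \<in> carrier ?Rn" for p
  proof -
    have "compose (carrier ?Rn) \<theta>' \<theta> p = (\<lambda>x\<in>carrier ?Rn. x) p"
    proof (rule rhom_rfree_eqI[OF R Rn rhom_compose[OF \<theta> \<theta>' Rn] _ _ p])
      show "(\<lambda>x\<in>carrier ?Rn. x) \<in> rhom R ?Rn ?Rn"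
        by (rule rhomI) (use right_module.axioms[OF Rn] in \<open>auto simp: abelian_group_def abelian_monoid.a_closed right_module.rsmult_closed[OF Rn]\<close>)
      show "compose (carrier ?Rn) \<theta>' \<theta> (?un i) = (\<lambda>x\<in>carrier ?Rn. x) (?un i)" if "i \<in> {..<n}" for i
        using that by (simp only: compose_eq uR \<theta>u \<theta>'u hY restrict_apply' if_True)
    qed
    then show ?thesis using p by (simp add: compose_eq)
  qed
  have \<theta>Y: "\<theta> p \<in> supp_in (fst \<alpha>)" if p: "p \<in> carrier ?Rn" for p
  proof -
    obtain l where l: "set l \<subseteq> ({..<n} \<inter> UNIV) \<times> carrier R" "p = lincomb ?Rn ?un l"
      using p by (rule rfree_lincomb[OF R, of _ _ UNIV]) auto
    have l': "set l \<subseteq> {..<n} \<times> carrier R" using l(1) by simp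
    have "lincomb P (\<lambda>i. \<theta> (?un i)) l \<in> supp_in (fst \<alpha>)"
      by (rule lincomb_mem_submodule[OF supp_in_rsubmodule l']) (simp only: \<theta>u unit_supp_in hY)
    then show ?thesis
      by (simp only: l(2) rhom_rfree_lincomb[OF R P_module \<theta> l'])
  qed
  have inv2: "\<theta> (\<theta>' e) = e" if e: "e \<in> supp_in (fst \<alpha>)" for e
  proof -
    obtain l where l: "set l \<subseteq> (carrier M \<inter> fst \<alpha>) \<times> carrier R" "e = lincomb P unit l"
      using e by (rule supp_in_lincomb)
    have l': "set l \<subseteq> carrier M \<times> carrier R" using l(1) by blast
    have "compose (carrier P) \<theta> \<theta>' e = lincomb P (\<lambda>x. compose (carrier P) \<theta> \<theta>' (unit x)) l"
      unfolding l(2) by (rule rhom_rfree_lincomb[OF R P_module rhom_compose[OF \<theta>' \<theta> P_module] l'])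
    also have "\<dots> = lincomb P unit l"
    proof (rule lincomb_cong)
      fix x a assume "(x, a) \<in> set l"
      then have "x \<in> carrier M" "x \<in> fst \<alpha>" using l(1) by auto
      then show "compose (carrier P) \<theta> \<theta>' (unit x) = unit x"
        by (simp only: compose_eq uP \<theta>'u \<theta>u h')
    qed
    finally show ?thesis
      using supp_in_carrier[OF e] l(2) by (simp add: compose_eq)
  qed
  have \<theta>PY: "\<theta> \<in> rhom R ?Rn (PY \<alpha>)"
    unfolding PY_def by (rule rhom_corestrict[OF \<theta> \<theta>Y])
  define q where "q = compose (carrier ?Rn) (Q \<alpha>) \<theta>"
  have q: "q \<in> rhom R ?Rn (F \<alpha>)"
    unfolding q_def by (rule rhom_compose[OF \<theta>PY Q_rhom[OF \<alpha>] Rn])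
  have q_eq: "q p = Q \<alpha> (\<theta> p)" if "p \<in> carrier ?Rn" for p
    using that by (simp add: q_def compose_eq)
  have \<theta>'R: "\<theta>' e \<in> carrier ?Rn" if "e \<in> supp_in (fst \<alpha>)" for e
    by (rule rhomD(1)[OF \<theta>' supp_in_carrier[OF that]])
  have surj: "q ` carrier ?Rn = carrier (F \<alpha>)"
  proof
    show "carrier (F \<alpha>) \<subseteq> q ` carrier ?Rn"
    proof
      fix X assume "X \<in> carrier (F \<alpha>)"
      then obtain e where e: "e \<in> supp_in (fst \<alpha>)" "X = Q \<alpha> e"
        by (rule Q_cases[OF \<alpha>])
      then show "X \<in> q ` carrier ?Rn"
        by (intro image_eqI[OF _ \<theta>'R[OF e(1)]]) (simp add: q_eq[OF \<theta>'R[OF e(1)]] inv2)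
    qed
  qed (use rhomD(1)[OF q] in blast)
  let ?A = "\<theta>' ` snd \<alpha>"
  have A: "finite ?A" "?A \<subseteq> carrier ?Rn"
    using JD(3,4)[OF \<alpha>] \<theta>'R by auto
  have E: "e \<in> supp_in (fst \<alpha>)" "e \<in> K \<alpha>" if "e \<in> snd \<alpha>" for e
    using that JD(4)[OF \<alpha>] subsetD[OF rspan_superset that] by auto
  have qE: "q (\<theta>' e) = \<zero>\<^bsub>F \<alpha>\<^esub>" if "e \<in> snd \<alpha>" for e
    using Q_eq_zero[OF \<alpha> E(1)[OF that]] E(2)[OF that]
    by (simp add: q_eq[OF \<theta>'R[OF E(1)[OF that]]] inv2[OF E(1)[OF that]])
  have ker: "{p \<in> carrier ?Rn. q p = \<zero>\<^bsub>F \<alpha>\<^esub>} = rspan R ?Rn ?A"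
  proof
    show "rspan R ?Rn ?A \<subseteq> {p \<in> carrier ?Rn. q p = \<zero>\<^bsub>F \<alpha>\<^esub>}"
      by (rule rspan_least[OF rsubmodule_kernel[OF q Rn F_module[OF \<alpha>]]])
        (use A(2) qE in auto)
    note N = rsubmodule_rspan[OF Rn A(2)]
    \<comment> \<open>The image under \<open>\<theta>\<close> of the span of the transported
      relations is a submodule containing \<open>snd \<alpha>\<close>, hence all of
      \<open>K \<alpha>\<close>. Injectivity of \<open>\<theta>\<close> then brings the kernel of
      \<open>q\<close> back into the span.\<close>
    have "snd \<alpha> \<subseteq> \<theta> ` rspan R ?Rn ?A"
    proof
      fix e assume e: "e \<in> snd \<alpha>"
      then have "\<theta>' e \<in> rspan R ?Rn ?A"
        by (intro subsetD[OF rspan_superset] imageI)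
      then show "e \<in> \<theta> ` rspan R ?Rn ?A"
        by (intro image_eqI[of _ _ "\<theta>' e"]) (simp_all add: inv2 E(1)[OF e])
    qed
    then have KA: "K \<alpha> \<subseteq> \<theta> ` rspan R ?Rn ?A"
      by (rule rspan_least[OF rsubmodule_image[OF \<theta> Rn P_module N]])
    show "{p \<in> carrier ?Rn. q p = \<zero>\<^bsub>F \<alpha>\<^esub>} \<subseteq> rspan R ?Rn ?A"
    proof
      fix p assume "p \<in> {p \<in> carrier ?Rn. q p = \<zero>\<^bsub>F \<alpha>\<^esub>}"
      then have p: "p \<in> carrier ?Rn" "\<theta> p \<in> K \<alpha>"
        using Q_eq_zero[OF \<alpha> \<theta>Y] q_eq by auto
      with KA obtain p' where p': "p' \<in> rspan R ?Rn ?A" "\<theta> p = \<theta> p'" by blast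
      have p'R: "p' \<in> carrier ?Rn"
        by (rule subsetD[OF rsubmoduleD(1)[OF N] p'(1)])
      have "p = p'"
        using inv1[OF p(1)] unfolding p'(2) inv1[OF p'R] by (rule sym)
      with p'(1) show "p \<in> rspan R ?Rn ?A" by simp
    qed
  qed
  show ?thesis
    by (rule fin_presentedI[OF R F_module[OF \<alpha>] A q surj ker])
qed

lemma riso_L_M:
  obtains \<phi> where "\<phi> \<in> riso R L M" "\<And>\<alpha>. \<alpha> \<in> J \<Longrightarrow> compose (carrier (F \<alpha>)) \<phi> (can \<alpha>) = c \<alpha>"
proof -
  have "\<exists>\<phi>. \<phi> \<in> riso R L M \<and> (\<forall>\<alpha> x. \<alpha> \<in> J \<longrightarrow> x \<in> carrier (F \<alpha>) \<longrightarrow> \<phi> (can \<alpha> x) = c \<alpha> x)"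
  proof (rule riso_dirlim[OF M c_rhom])
    show "c \<beta> (u \<beta> \<alpha> X) = c \<alpha> X" if po: "(\<alpha>, \<beta>) \<in> po" and X: "X \<in> carrier (F \<alpha>)" for \<alpha> \<beta> X
    proof -
      obtain e where e: "e \<in> supp_in (fst \<alpha>)" "X = Q \<alpha> e"
        using X by (rule Q_cases[OF poD(1)[OF po]])
      have "e \<in> supp_in (fst \<beta>)"
        using e(1) poD(3)[OF po] by blast
      with e show ?thesis
        by (simp add: u_Q[OF po] c_Q poD(1,2)[OF po])
    qed
    show "\<exists>\<alpha>\<in>J. \<exists>X\<in>carrier (F \<alpha>). c \<alpha> X = m" if m: "m \<in> carrier M" for m
    proof -
      \<comment> \<open>A single generator without relations suffices to reach
        \<open>m\<close>.\<close>
      have \<alpha>: "({m}, {}) \<in> J"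
        using m by (simp add: J_def)
      have um: "unit m \<in> supp_in (fst ({m}, {}))"
        by (simp add: unit_supp_in)
      have "c ({m}, {}) (Q ({m}, {}) (unit m)) = m"
        by (simp only: c_Q[OF \<alpha> um] free_cover_runit[OF M m])
      then show ?thesis
        using \<alpha> Q_closed[OF \<alpha> um] by blast
    qed
    show "\<exists>\<beta>. (\<alpha>, \<beta>) \<in> po \<and> u \<beta> \<alpha> X = \<zero>\<^bsub>F \<beta>\<^esub>"
      if \<alpha>: "\<alpha> \<in> J" and X: "X \<in> carrier (F \<alpha>)" and zero: "c \<alpha> X = \<zero>\<^bsub>M\<^esub>" for \<alpha> X
    proof -
      obtain e where e: "e \<in> supp_in (fst \<alpha>)" "X = Q \<alpha> e"
        using X by (rule Q_cases[OF \<alpha>])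
      \<comment> \<open>An element that vanishes in \<open>M\<close> is killed by declaring it a
        relation; the generators stay the same.\<close>
      let ?\<beta> = "(fst \<alpha>, insert e (snd \<alpha>))"
      have "\<pi> e = \<zero>\<^bsub>M\<^esub>"
        using zero e by (simp add: c_Q[OF \<alpha>])
      then have \<beta>: "?\<beta> \<in> J"
        using JD[OF \<alpha>] e(1) by (auto simp: J_def)
      then have po: "(\<alpha>, ?\<beta>) \<in> po"
        using \<alpha> by (auto simp: po_def)
      have "e \<in> K ?\<beta>"
        by (rule subsetD[OF rspan_superset]) simp
      then have "Q ?\<beta> e = \<zero>\<^bsub>F ?\<beta>\<^esub>"
        by (intro iffD2[OF Q_eq_zero[OF \<beta>]]) (simp_all add: e(1))
      then have "u ?\<beta> \<alpha> X = \<zero>\<^bsub>F ?\<beta>\<^esub>"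
        by (simp only: e(2) u_Q[OF po e(1)])
      with po show ?thesis by blast
    qed
  next
    fix \<phi> assume "\<phi> \<in> riso R L M"
      and "\<And>\<alpha> X. \<alpha> \<in> J \<Longrightarrow> X \<in> carrier (F \<alpha>) \<Longrightarrow> \<phi> (can \<alpha> X) = c \<alpha> X"
    then show "\<exists>\<phi>. \<phi> \<in> riso R L M \<and> (\<forall>\<alpha> X. \<alpha> \<in> J \<longrightarrow> X \<in> carrier (F \<alpha>) \<longrightarrow> \<phi> (can \<alpha> X) = c \<alpha> X)"
      by (intro exI[of _ \<phi>]) simp
  qed
  then obtain \<phi> where \<phi>: "\<phi> \<in> riso R L M" "\<forall>\<alpha> x. \<alpha> \<in> J \<longrightarrow> x \<in> carrier (F \<alpha>) \<longrightarrow> \<phi> (can \<alpha> x) = c \<alpha> x"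
    by blast
  have "compose (carrier (F \<alpha>)) \<phi> (can \<alpha>) = c \<alpha>" if \<alpha>: "\<alpha> \<in> J" for \<alpha>
    by (rule extensionalityI[OF compose_extensional rhomD(4)[OF c_rhom[OF \<alpha>]]])
      (simp add: compose_eq \<phi>(2)[rule_format, OF \<alpha>])
  with \<phi>(1) show thesis by (rule that)
qed

text \<open>The index is enlarged by the relations that control its generators, together with the
  elements occurring in them. A homomorphism from \<open>F \<beta>\<close> then yields a solution of
  these relations, hence a homomorphism on \<open>M\<close> with the same values on the generators
  of \<open>F \<alpha>\<close>.\<close>

lemma Hset_stabilizes:
  assumes B: "right_module R B" and stat: "rel_stationary R B M" and \<alpha>: "\<alpha> \<in> J"
  shows "\<exists>\<beta>\<in>J. (\<alpha>, \<beta>) \<in> po \<and> Hset R (F \<alpha>) M (c \<alpha>) B = Hset R (F \<alpha>) (F \<beta>) (u \<beta> \<alpha>) B"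
proof -
  note R = M.R.ring_axioms
  interpret B: right_module R B by (rule B)
  obtain E where E: "finite E" "E \<subseteq> module_relations R M"
    "\<forall>b. b \<in> carrier M \<rightarrow> carrier B \<longrightarrow> (\<forall>l\<in>E. lincomb B b l = \<zero>\<^bsub>B\<^esub>) \<longrightarrow>
      (\<exists>f\<in>rhom R M B. \<forall>x\<in>fst \<alpha>. f x = b x)"
    by (rule rel_stationaryE[OF stat JD(1,2)[OF \<alpha>]])
  have E1: "set l \<subseteq> carrier M \<times> carrier R" "lincomb M (\<lambda>x. x) l = \<zero>\<^bsub>M\<^esub>" if "l \<in> E" for l
    using that E(2) by (auto simp: module_relations_def)
  \<comment> \<open>The elements occurring in the relations of \<open>E\<close> must be generators
    too, or these relations would not be admissible at the new index.\<close>
  define Y where "Y = fst \<alpha> \<union> (\<Union>l\<in>E. fst ` set l)"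
  define \<beta> where "\<beta> = (Y, snd \<alpha> \<union> (\<lambda>l. lincomb P unit l) ` E)"
  have Y: "finite Y" "Y \<subseteq> carrier M" "fst \<alpha> \<subseteq> Y"
    using JD(1,2)[OF \<alpha>] E(1) E1(1) by (fastforce simp: Y_def)+
  have EY: "set l \<subseteq> Y \<times> carrier R" if l: "l \<in> E" for l
  proof
    fix p assume p: "p \<in> set l"
    then have "fst p \<in> Y" using l by (auto simp: Y_def)
    moreover have "snd p \<in> carrier R" using E1(1)[OF l] p by auto
    ultimately show "p \<in> Y \<times> carrier R" by (simp add: mem_Times_iff)
  qed
  have \<pi>E: "\<pi> (lincomb P unit l) = \<zero>\<^bsub>M\<^esub>" if l: "l \<in> E" for l
  proof -
    have "\<pi> (lincomb P unit l) = lincomb M (\<lambda>x. \<pi> (unit x)) l"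
      by (rule rhom_rfree_lincomb[OF R M \<pi>_rhom E1(1)[OF l]])
    also have "\<dots> = lincomb M (\<lambda>x. x) l"
      by (rule lincomb_cong) (use E1(1)[OF l] free_cover_runit[OF M] in auto)
    finally show ?thesis by (simp add: E1(2)[OF l])
  qed
  have \<beta>J: "\<beta> \<in> J"
    unfolding \<beta>_def J_def
    using Y E(1) JD(3-5)[OF \<alpha>] supp_in_mono[OF Y(3)] lincomb_supp_in[OF EY] \<pi>E by auto
  have po: "(\<alpha>, \<beta>) \<in> po"
    using \<alpha> \<beta>J Y(3) by (auto simp: po_def \<beta>_def)
  have fst\<beta>: "fst \<beta> = Y"
    by (simp add: \<beta>_def)
  have "Hset R (F \<alpha>) M (c \<alpha>) B = Hset R (F \<alpha>) (F \<beta>) (u \<beta> \<alpha>) B"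
  proof
    show "Hset R (F \<alpha>) M (c \<alpha>) B \<subseteq> Hset R (F \<alpha>) (F \<beta>) (u \<beta> \<alpha>) B"
    proof
      fix k assume "k \<in> Hset R (F \<alpha>) M (c \<alpha>) B"
      then obtain f where f: "f \<in> rhom R M B" "k = compose (carrier (F \<alpha>)) f (c \<alpha>)"
        by (auto simp: Hset_def)
      have "compose (carrier (F \<alpha>)) f (c \<alpha>) =
          compose (carrier (F \<alpha>)) (compose (carrier (F \<beta>)) f (c \<beta>)) (u \<beta> \<alpha>)"
      proof (rule F_extI[OF \<alpha> compose_extensional compose_extensional])
        fix e assume e: "e \<in> supp_in (fst \<alpha>)"
        then have e': "e \<in> supp_in (fst \<beta>)" using poD(3)[OF po] by blast
        show "compose (carrier (F \<alpha>)) f (c \<alpha>) (Q \<alpha> e) =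
            compose (carrier (F \<alpha>)) (compose (carrier (F \<beta>)) f (c \<beta>)) (u \<beta> \<alpha>) (Q \<alpha> e)"
          by (simp add: compose_eq Q_closed[OF \<alpha> e] Q_closed[OF \<beta>J e'] u_Q[OF po e] c_Q[OF \<alpha> e] c_Q[OF \<beta>J e'])
      qed
      with f show "k \<in> Hset R (F \<alpha>) (F \<beta>) (u \<beta> \<alpha>) B"
        using rhom_compose[OF c_rhom[OF \<beta>J] f(1) F_module[OF \<beta>J]] by (auto simp: Hset_def)
    qed
    show "Hset R (F \<alpha>) (F \<beta>) (u \<beta> \<alpha>) B \<subseteq> Hset R (F \<alpha>) M (c \<alpha>) B"
    proof
      fix k assume "k \<in> Hset R (F \<alpha>) (F \<beta>) (u \<beta> \<alpha>) B"
      then obtain h where h: "h \<in> rhom R (F \<beta>) B" "k = compose (carrier (F \<alpha>)) h (u \<beta> \<alpha>)"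
        by (auto simp: Hset_def)
      have hQ: "compose (carrier (PY \<beta>)) h (Q \<beta>) \<in> rhom R (PY \<beta>) B"
        by (rule rhom_compose[OF Q_rhom[OF \<beta>J] h(1) PY_module])
      have hQl: "h (Q \<beta> (lincomb P unit l)) = lincomb B (\<lambda>x. h (Q \<beta> (unit x))) l"
        if l: "set l \<subseteq> Y \<times> carrier R" for l
      proof -
        have "compose (carrier (PY \<beta>)) h (Q \<beta>) (lincomb (PY \<beta>) unit l) =
            lincomb B (\<lambda>x. compose (carrier (PY \<beta>)) h (Q \<beta>) (unit x)) l"
          by (rule rhom_lincomb[OF hQ PY_module B l]) (simp add: fst\<beta> unit_supp_in)
        also have "\<dots> = lincomb B (\<lambda>x. h (Q \<beta> (unit x))) l"
        proof (rule lincomb_cong)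
          fix x a assume "(x, a) \<in> set l"
          then have "x \<in> Y" using l by blast
          then show "compose (carrier (PY \<beta>)) h (Q \<beta>) (unit x) = h (Q \<beta> (unit x))"
            by (simp add: compose_eq fst\<beta> unit_supp_in)
        qed
        finally show ?thesis
          using lincomb_supp_in[OF l] by (simp add: compose_eq fst\<beta>)
      qed
      \<comment> \<open>Off \<open>Y\<close> the value zero is only a default making
        \<open>b\<close> a function on the whole carrier; the relations in \<open>E\<close> and the
        set \<open>fst \<alpha>\<close> involve elements of \<open>Y\<close> alone.\<close>
      define b where "b x = (if x \<in> Y then h (Q \<beta> (unit x)) else \<zero>\<^bsub>B\<^esub>)" for x
      have b: "b \<in> carrier M \<rightarrow> carrier B"
        using rhomD(1)[OF h(1)] Q_closed[OF \<beta>J] by (auto simp: b_def fst\<beta> unit_supp_in)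
      have "lincomb B b l = \<zero>\<^bsub>B\<^esub>" if l: "l \<in> E" for l
      proof -
        have "lincomb B b l = lincomb B (\<lambda>x. h (Q \<beta> (unit x))) l"
          by (rule lincomb_cong) (use EY[OF l] in \<open>auto simp: b_def\<close>)
        also have "\<dots> = h (Q \<beta> (lincomb P unit l))"
          by (rule hQl[OF EY[OF l], symmetric])
        also have "Q \<beta> (lincomb P unit l) = \<zero>\<^bsub>F \<beta>\<^esub>"
        proof -
          have "lincomb P unit l \<in> K \<beta>"
            by (rule subsetD[OF rspan_superset]) (use l in \<open>simp add: \<beta>_def\<close>)
          then show ?thesis
            using lincomb_supp_in[OF EY[OF l]] by (simp add: Q_eq_zero[OF \<beta>J] fst\<beta>)
        qed
        also have "h \<zero>\<^bsub>F \<beta>\<^esub> = \<zero>\<^bsub>B\<^esub>"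
          by (rule rhom_zero[OF h(1) F_module[OF \<beta>J] B])
        finally show ?thesis .
      qed
      with E(3) b obtain f where f: "f \<in> rhom R M B" "\<forall>x\<in>fst \<alpha>. f x = b x"
        by blast
      have "compose (carrier (F \<alpha>)) h (u \<beta> \<alpha>) = compose (carrier (F \<alpha>)) f (c \<alpha>)"
      proof (rule F_extI[OF \<alpha> compose_extensional compose_extensional])
        fix e assume e: "e \<in> supp_in (fst \<alpha>)"
        then obtain l where l: "set l \<subseteq> (carrier M \<inter> fst \<alpha>) \<times> carrier R" "e = lincomb P unit l"
          by (rule supp_in_lincomb)
        have lM: "set l \<subseteq> carrier M \<times> carrier R" and lY: "set l \<subseteq> Y \<times> carrier R"
          using l(1) Y(3) by blast+
        have fp: "compose (carrier P) f \<pi> \<in> rhom R P B"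
          by (rule rhom_compose[OF \<pi>_rhom f(1) P_module])
        have "compose (carrier P) f \<pi> e = lincomb B (\<lambda>x. compose (carrier P) f \<pi> (unit x)) l"
          unfolding l(2) by (rule rhom_rfree_lincomb[OF R B fp lM])
        also have "\<dots> = lincomb B (\<lambda>x. h (Q \<beta> (unit x))) l"
        proof (rule lincomb_cong)
          fix x a assume "(x, a) \<in> set l"
          then have x: "x \<in> carrier M" "x \<in> fst \<alpha>" "x \<in> Y"
            using l(1) Y(3) by auto
          have "compose (carrier P) f \<pi> (unit x) = f x"
            by (simp only: compose_eq runit_closed[OF R] free_cover_runit[OF M x(1)])
          then show "compose (carrier P) f \<pi> (unit x) = h (Q \<beta> (unit x))"
            using f(2) x(2,3) by (simp add: b_def)
        qed
        finally have "f (\<pi> e) = h (Q \<beta> e)"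
          using supp_in_carrier[OF e] hQl[OF lY] by (simp add: compose_eq l(2))
        then show "compose (carrier (F \<alpha>)) h (u \<beta> \<alpha>) (Q \<alpha> e) = compose (carrier (F \<alpha>)) f (c \<alpha>) (Q \<alpha> e)"
          by (simp add: compose_eq Q_closed[OF \<alpha> e] u_Q[OF po e] c_Q[OF \<alpha> e])
      qed
      with h(2) f(1) show "k \<in> Hset R (F \<alpha>) M (c \<alpha>) B"
        by (auto simp: Hset_def)
    qed
  qed
  with \<beta>J po show ?thesis by blast
qed

end

lemma rel_stationary_imp_strict_stationary_wrt:
  fixes M :: "('r, 'm) rmodule"
  assumes M: "right_module R M" and B: "right_module R B" and stat: "rel_stationary R B M"
  shows "strict_stationary_wrt TYPE('m set \<times> ('m \<Rightarrow> 'r) set) TYPE(('m \<Rightarrow> 'r) set) R B M"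
proof -
  interpret canonical_presentation R M
    by (rule canonical_presentation.intro[OF M])
  obtain \<phi> where \<phi>: "\<phi> \<in> riso R L M" "\<And>\<alpha>. \<alpha> \<in> J \<Longrightarrow> compose (carrier (F \<alpha>)) \<phi> (can \<alpha>) = c \<alpha>"
    by (fact riso_L_M)
  show ?thesis
    unfolding strict_stationary_wrt_def
    by (intro conjI exI[of _ J] exI[of _ po] exI[of _ F] exI[of _ u] exI[of _ \<phi>] exI[of _ c])
      (use M direct_system fin_presented_F \<phi> Hset_stabilizes[OF B stat] in auto)
qed

text \<open>The types \<open>'i\<close>, \<open>'f\<close> and \<open>'k\<close> of the given
  systems and filtration disappear in \<open>rel_stationary\<close>, which mentions no direct
  system. The types in the conclusion are those of the canonical presentation of
  \<open>N\<close>.\<close>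

theorem proposition8p12:
  fixes R :: "('r, 'z) ring_scheme"
    and \<S> \<B> :: "('r, 'a) rmodule set"
    and M N :: "('r, 'a) rmodule"
  assumes "ring R"
    and "\<S> \<subseteq> rmods R"
    and "\<B> \<subseteq> rmods R"
    and "\<forall>S\<in>\<S>. strict_stationary TYPE('i) TYPE('f) R \<B> S"
    and "\<B> \<subseteq> perp R \<S>"
    and "filtered TYPE('k) R (\<S> \<union> Add_R R) M"
    and "right_module R N"
    and "\<exists>D. direct_summand R D M \<and> risomorphic R N (M\<lparr>carrier := D\<rparr>)"
  shows "strict_stationary TYPE('a set \<times> ('a \<Rightarrow> 'r) set) TYPE(('a \<Rightarrow> 'r) set) R \<B> N"
  unfolding strict_stationary_def
proof (intro conjI ballI)
  show N: "right_module R N" by (rule assms(7))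
  fix B assume "B \<in> \<B>"
  then have B: "right_module R B"
    using assms(3) by (auto simp: rmods_def)
  have M: "right_module R M"
    using assms(6) by (simp add: filtered_def)
  have "rel_stationary R B M"
  proof (rule rel_stationary_filtered[OF assms(1,6,2) B])
    fix S assume "S \<in> \<S>"
    show "trivial_group (Ext1 R S B)"
      using assms(5) \<open>B \<in> \<B>\<close> \<open>S \<in> \<S>\<close> by (auto simp: perp_def)
    have "strict_stationary_wrt TYPE('i) TYPE('f) R B S"
      using assms(4) \<open>B \<in> \<B>\<close> \<open>S \<in> \<S>\<close> by (simp add: strict_stationary_def)
    then show "rel_stationary R B S"
      by (rule strict_stationary_wrt_imp_rel_stationary[OF assms(1) B])
  qed
  moreover obtain D where D: "direct_summand R D M" "risomorphic R N (M\<lparr>carrier := D\<rparr>)"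
    using assms(8) by blast
  obtain i p where "i \<in> rhom R N M" "p \<in> rhom R M N" "\<And>x. x \<in> carrier N \<Longrightarrow> p (i x) = x"
    by (fact direct_summand_retract[OF M N D])
  ultimately have "rel_stationary R B N"
    by (intro rel_stationary_retract[OF M N])
  then show "strict_stationary_wrt TYPE('a set \<times> ('a \<Rightarrow> 'r) set) TYPE(('a \<Rightarrow> 'r) set) R B N"
    by (rule rel_stationary_imp_strict_stationary_wrt[OF N B])
qed

end
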